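(* Let $n$ be even and let $\widehat{f}$ be the arc-full-rank polynomial defined in the context. Then $\widehat{f}$ is computable by syntactic multilinear ABPs of size polynomial in $n$, and there is $\epsilon$ with $0<\epsilon<1/500$ such that if $\widehat{f}=f_1+\cdots+f_s$ where each $f_i$ is computable by a ROABP of size $\mathrm{poly}(n)$, then $s=\exp(\Omega(n^{\epsilon}))$.
   Context: $X=\{x_0,\ldots,x_{n-1}\}$ identified with $V=\{0,\ldots,n-1\}$; arithmetic on indices is mod $n$, and the arc $[i,j]$ is $\{i,i+1,\ldots,j\}$ mod $n$. A random arc pairing $(P_1,\ldots,P_{n/2})$ of $V$ is built as follows: $P_1=(0,1)$; given $P_1,\ldots,P_t$ spanning the arc $[L_t,R_t]$, choose $P_{t+1}$ to be $(L_t-2,L_t-1)$, $(L_t-1,R_t+1)$ or $(R_t+1,R_t+2)$ each with probability $1/3$. For a pairing $\mathcal{P}=\{(\ell_i,r_i)\}$ let $M_{\mathcal{P}}=\prod_{i=1}^{n/2}(x_{\ell_i}+x_{r_i})$. Then $\widehat{f}=\sum_{\mathcal{P}}\lambda_{\mathcal{P}}M_{\mathcal{P}}$, the sum over all pairings in the support of this distribution, where the $\lambda_{\mathcal{P}}$ are formal variables; polynomials are viewed in the variables $X$ over the field $\mathbb{G}=\mathbb{F}(\{\lambda_{\mathcal{P}}\})$. An algebraic branching program (ABP) is a layered DAG with a source $s$ and sink $t$, edges labeled by variables or field constants, computing the sum over $s$–$t$ paths of the product of edge labels; size is the number of nodes. It is syntactic multilinear (smABP) if every $s$–$t$ path reads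 each variable at most once. A read-once oblivious ABP (ROABP) is a syntactic multilinear ABP in which each layer's edges read at most one variable and each variable appears in at most one layer.
   Formalization: With independent λ_P the upper bound fails (exponentially many independent coefficients, few constants), so it is proved for λ_P = product of one formal variable per pair in P, over the field these generate; the lower bound is proved for both this and the original polynomial. *)

theory Defs
  imports
    "HOL-Probability.Probability_Mass_Function"
    "HOL-Library.Poly_Mapping"
    "HOL-Library.Nat_Bijection"
    "HOL-Library.Landau_Symbols"
    "HOL-Computational_Algebra.Fraction_Field"
begin

section \<open>Polynomials and rational functions in variables indexed by naturals\<close>

type_synonym 'c mpoly = "(nat \<Rightarrow>\<^sub>0 nat) \<Rightarrow>\<^sub>0 'c"

definition mvar :: "nat \<Rightarrow> 'c::comm_semiring_1 mpoly" where
  "mvar i = Poly_Mapping.single (Poly_Mapping.single i 1) 1"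

definition mconst :: "'c::comm_semiring_1 \<Rightarrow> 'c mpoly" where
  "mconst c = Poly_Mapping.single 0 c"

definition mvars :: "'c::zero mpoly \<Rightarrow> nat set" where
  "mvars p = (\<Union>m \<in> Poly_Mapping.keys p. Poly_Mapping.keys m)"

text \<open>Rational functions over the field \<open>'f\<close> in countably many formal variables.\<close>

type_synonym 'f ratfun = "'f mpoly fract"

definition rvar :: "nat \<Rightarrow> 'f::field ratfun" where
  "rvar k = Fract (mvar k) 1"

text \<open>The field generated over \<open>'f\<close> by the formal variables with index in \<open>I\<close>.\<close>

definition ratfun_field :: "nat set \<Rightarrow> 'f::field ratfun set" where
  "ratfun_field I = {Fract a b | a b. b \<noteq> 0 \<and> mvars a \<subseteq> I \<and> mvars b \<subseteq> I}"


section \<open>Arc pairings\<close>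

text \<open>A pairing of \<open>{0..<n}\<close> is a set of two-element sets.\<close>

type_synonym pairing = "nat set set"

datatype choice = Left | Cross | Right

text \<open>
  The state \<open>(L, R, P)\<close> consists of the end points of the arc \<open>[L, R]\<close> and the set of the pairs
  chosen so far. Indices are residues in \<open>{0..<n}\<close>; for \<open>n \<ge> 2\<close>, the number \<open>(L + n - d) mod n\<close>
  is \<open>L - d\<close> modulo \<open>n\<close> (\<open>d = 1, 2\<close>) without truncation. When only two points are left the three
  choices give the same pair.
\<close>

fun arc_step :: "nat \<Rightarrow> nat \<times> nat \<times> pairing \<Rightarrow> choice \<Rightarrow> nat \<times> nat \<times> pairing" where
  "arc_step n (L, R, P) Left =
     ((L + n - 2) mod n, R, insert {(L + n - 2) mod n, (L + n - 1) mod n} P)"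
| "arc_step n (L, R, P) Cross =
     ((L + n - 1) mod n, (R + 1) mod n, insert {(L + n - 1) mod n, (R + 1) mod n} P)"
| "arc_step n (L, R, P) Right =
     (L, (R + 2) mod n, insert {(R + 1) mod n, (R + 2) mod n} P)"

primrec arc_process :: "nat \<Rightarrow> nat \<Rightarrow> (nat \<times> nat \<times> pairing) pmf" where
  "arc_process n 0 = return_pmf (0, 1, {{0, 1}})"
| "arc_process n (Suc t) =
     bind_pmf (arc_process n t)
       (\<lambda>s. map_pmf (arc_step n s) (pmf_of_set {Left, Cross, Right}))"

definition random_arc_pairing :: "nat \<Rightarrow> pairing pmf" where
  "random_arc_pairing n = map_pmf (\<lambda>(L, R, P). P) (arc_process n (n div 2 - 1))"

definition arc_pairings :: "nat \<Rightarrow> pairing set" where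
  "arc_pairings n = set_pmf (random_arc_pairing n)"

text \<open>For a pair \<open>p = {l, r}\<close> of distinct indices the inner sum is \<open>x\<^sub>l + x\<^sub>r\<close>.\<close>

definition pairing_poly :: "pairing \<Rightarrow> 'c::comm_semiring_1 mpoly" where
  "pairing_poly P = (\<Prod>p\<in>P. \<Sum>i\<in>p. mvar i)"

definition arc_poly :: "(pairing \<Rightarrow> 'c) \<Rightarrow> nat \<Rightarrow> 'c::comm_semiring_1 mpoly" where
  "arc_poly w n = (\<Sum>P\<in>arc_pairings n. mconst (w P) * pairing_poly P)"


section \<open>The weights of the pairings\<close>

text \<open>
  There are two weight families. Formal variables are indexed by naturals because the integral
  domain instance of polynomial mappings needs a linear order on the variables; \<open>set_encode\<close> is
  injective on finite sets, so distinct pairs (or pairings) get distinct variables.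

  In \<open>fhat\<close> the weight of a pairing is the formal monomial \<open>\<lambda>\<^sub>P = (\<Prod>p\<in>P. \<lambda>\<^sub>p)\<close>, with one formal
  variable for each pair. In \<open>fhat_indep\<close> the weights are themselves algebraically independent
  variables, one for each pairing. The upper bound on branching programs can only hold for the
  former: the polynomials \<open>pairing_poly P\<close> of the exponentially many arc pairings are linearly
  independent (arc pairings are non-crossing matchings of a circle), so the coefficients of
  \<open>fhat_indep\<close> generate a field of exponential transcendence degree over \<open>'f\<close>, whereas a branching
  program with \<open>S\<close> nodes has at most \<open>S\<^sup>2\<close> constants. The lower bound makes sense for both.
\<close>

definition pair_weight :: "pairing \<Rightarrow> 'f::field ratfun" where
  "pair_weight P = (\<Prod>p\<in>P. rvar (set_encode p))"

definition fhat :: "nat \<Rightarrow> 'f::field ratfun mpoly" where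
  "fhat n = arc_poly pair_weight n"

definition fhat_field :: "nat \<Rightarrow> 'f::field ratfun set" where
  "fhat_field n = ratfun_field (set_encode ` \<Union>(arc_pairings n))"

definition indep_index :: "pairing \<Rightarrow> nat" where
  "indep_index P = set_encode (set_encode ` P)"

definition fhat_indep :: "nat \<Rightarrow> 'f::field ratfun mpoly" where
  "fhat_indep n = arc_poly (\<lambda>P. rvar (indep_index P)) n"

definition fhat_indep_field :: "nat \<Rightarrow> 'f::field ratfun set" where
  "fhat_indep_field n = ratfun_field (indep_index ` arc_pairings n)"


section \<open>Algebraic branching programs\<close>

datatype 'c label = Var nat | Const 'c

record 'c abp =
  nodes :: "nat set"
  edges :: "(nat \<times> nat) set"
  layer :: "nat \<Rightarrow> nat"
  lab :: "nat \<times> nat \<Rightarrow> 'c label"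
  src :: nat
  snk :: nat

text \<open>Programs over the variables \<open>x\<^sub>0, \<dots>, x\<^sub>n\<^sub>-\<^sub>1\<close> with constants from the field \<open>K\<close>.\<close>

definition is_abp :: "'c set \<Rightarrow> nat \<Rightarrow> 'c abp \<Rightarrow> bool" where
  "is_abp K n A \<longleftrightarrow>
     finite (nodes A) \<and> src A \<in> nodes A \<and> snk A \<in> nodes A \<and>
     edges A \<subseteq> nodes A \<times> nodes A \<and>
     layer A (src A) = 0 \<and> (\<forall>v\<in>nodes A. layer A v \<le> layer A (snk A)) \<and>
     (\<forall>(u, v)\<in>edges A. layer A v = Suc (layer A u)) \<and>
     (\<forall>e\<in>edges A. case lab A e of Var i \<Rightarrow> i < n | Const c \<Rightarrow> c \<in> K)"

definition abp_paths :: "'c abp \<Rightarrow> nat list set" where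
  "abp_paths A = {p. p \<noteq> [] \<and> hd p = src A \<and> last p = snk A \<and>
     successively (\<lambda>u v. (u, v) \<in> edges A) p}"

definition path_labels :: "'c abp \<Rightarrow> nat list \<Rightarrow> 'c label list" where
  "path_labels A p = map (lab A) (zip p (tl p))"

fun label_poly :: "'c label \<Rightarrow> 'c::comm_semiring_1 mpoly" where
  "label_poly (Var i) = mvar i"
| "label_poly (Const c) = mconst c"

definition abp_poly :: "'c abp \<Rightarrow> 'c::comm_semiring_1 mpoly" where
  "abp_poly A = (\<Sum>p\<in>abp_paths A. prod_list (map label_poly (path_labels A p)))"

definition abp_size :: "'c abp \<Rightarrow> nat" where
  "abp_size A = card (nodes A)"

definition syntactic_multilinear :: "'c abp \<Rightarrow> bool" where
  "syntactic_multilinear A \<longleftrightarrow>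
     (\<forall>p\<in>abp_paths A. \<forall>i. count_list (path_labels A p) (Var i) \<le> 1)"

text \<open>The layer of an edge is the layer of its tail.\<close>

definition read_once_oblivious :: "'c abp \<Rightarrow> bool" where
  "read_once_oblivious A \<longleftrightarrow> syntactic_multilinear A \<and>
     (\<forall>(u, v)\<in>edges A. \<forall>(u', v')\<in>edges A. \<forall>i j.
        lab A (u, v) = Var i \<longrightarrow> lab A (u', v') = Var j \<longrightarrow>
        (layer A u = layer A u' \<longleftrightarrow> i = j))"

definition smABP_computable :: "'c set \<Rightarrow> nat \<Rightarrow> nat \<Rightarrow> 'c::comm_semiring_1 mpoly \<Rightarrow> bool" where
  "smABP_computable K n S f \<longleftrightarrow>
     (\<exists>A. is_abp K n A \<and> syntactic_multilinear A \<and> abp_size A \<le> S \<and> abp_poly A = f)"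

definition ROABP_computable :: "'c set \<Rightarrow> nat \<Rightarrow> nat \<Rightarrow> 'c::comm_semiring_1 mpoly \<Rightarrow> bool" where
  "ROABP_computable K n S f \<longleftrightarrow>
     (\<exists>A. is_abp K n A \<and> read_once_oblivious A \<and> abp_size A \<le> S \<and> abp_poly A = f)"

definition sum_of_ROABPs ::
  "'c set \<Rightarrow> nat \<Rightarrow> nat \<Rightarrow> nat \<Rightarrow> 'c::comm_semiring_1 mpoly \<Rightarrow> bool" where
  "sum_of_ROABPs K n S s f \<longleftrightarrow>
     (\<exists>g. f = (\<Sum>i<s. g i) \<and> (\<forall>i<s. ROABP_computable K n S (g i)))"

definition poly_bounded :: "(nat \<Rightarrow> nat) \<Rightarrow> bool" where
  "poly_bounded S \<longleftrightarrow> (\<exists>k. (\<lambda>n. real (S n)) \<in> O(\<lambda>n. real n ^ k))"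

end

theory Submission
  imports Defs
    "HOL-Computational_Algebra.Polynomial_Factorial"
    "HOL-Analysis.Harmonic_Numbers"
    "HOL-Real_Asymp.Real_Asymp"
begin

text \<open>The obstacle is that one pairing and one split must serve all \<open>s\<close> variable
  orders at once. A union bound over the orders achieves this, but only if each order fails with
  exponentially small probability; hence many independent blocks. The shifts defeat an adversarial
  order: against a fixed block, the order could place the two partners of every cross pair next to
  each other, and almost no pair would be bichromatic. The width \<open>w\<close> balances two
  demands. A sum of \<open>d\<close> signs takes a given value with probability at most
  \<open>1 / sqrt d\<close>, so forcing an imbalance of \<open>t\<close> takes about
  \<open>t^2\<close> free pairs at a colour, and \<open>w\<close> must be a multiple of
  \<open>t^2\<close>. On the other hand the failure probability is only exponential in
  \<open>n / w\<close>, which must exceed a multiple of \<open>t\<close>. With \<open>t\<close>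
  about \<open>n^\<epsilon>\<close> this asks for \<open>3 * \<epsilon> < 1\<close>; the exponent
  \<open>1 / 1000\<close> is simply a value below \<open>1 / 500\<close>. In the end
  \<open>2 ^ t\<close> is compared with \<open>s * S\<close>; a polynomial \<open>S\<close> is
  absorbed because \<open>t\<close> grows like a power of \<open>n\<close>.\<close>

text \<open>
  Upper bound: the points left over after some steps form an interval, so a program only has to remember
  this interval, together with a flag that selects one step sequence for every pairing.

  Lower bound: fix a pairing \<open>P\<close>, and split the variables by giving one element of each pair to \<open>Y\<close> and
  the other to \<open>Z\<close>. The coefficient matrix of the polynomial (rows: monomials in \<open>Y\<close>, columns: monomials
  in \<open>Z\<close>) has full rank \<open>2 ^ (n / 2)\<close>, because the weight of \<open>P\<close> dominates in a suitable grading of the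
  formal variables, and the matrix of \<open>pairing_poly P\<close> is a permutation matrix. A ROABP of size \<open>S\<close> that
  reads the variables in some order gives a matrix of rank at most \<open>S * 2 ^ (n / 2 - t)\<close> as soon as
  a prefix of that order contains \<open>t\<close> more elements of one side than of the other. So it suffices to find
  one \<open>P\<close> and one split for which all \<open>s\<close> orders have such a prefix.

  These are found by counting. Colour the variables by cutting the order into intervals of length
  \<open>w\<close>. We use pairings composed of many independent blocks, each with a free shift; by averaging, a
  constant fraction of the shifts makes many pairs of the block bichromatic. Hence all but an exponentially
  small fraction of the shifts produce many colours with at least \<open>4 t\<^sup>2\<close> pairs leading to later colours.
  The imbalance after each such colour is small with probability at most \<open>1 / 2\<close> even if the earlier
  signs are known, so that all imbalances are small with exponentially small probability.
\<close>

section \<open>Signed sums\<close>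

text \<open>The factor \<open>2 * k + 1\<close> makes the induction close: passing to
  \<open>k + 1\<close> multiplies the left side by
  \<open>4 * (2 * k + 1) * (2 * k + 3) / (k + 1)^2\<close>, which is at most 16 because
  \<open>(2 * k + 1) * (2 * k + 3) \<le> (2 * k + 2)^2\<close>.\<close>

lemma central_binomial_sq_le: "(2 * k choose k)\<^sup>2 * (2 * k + 1) \<le> 16 ^ k"
proof (induction k)
  case 0
  then show ?case by simp
next
  case (Suc k)
  have step: "Suc k * (2 * Suc k choose Suc k) = 2 * (2 * k + 1) * (2 * k choose k)"
  proof -
    have a: "Suc k * (Suc (Suc (2 * k)) choose Suc k) = Suc (Suc (2 * k)) * (Suc (2 * k) choose k)"
      by (metis Suc_times_binomial mult.commute)
    have b: "Suc k * (Suc (2 * k) choose Suc k) = Suc (2 * k) * (2 * k choose k)"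
      by (metis Suc_times_binomial mult.commute)
    have c: "(Suc (2 * k) choose Suc k) = (Suc (2 * k) choose k)"
      using binomial_symmetric[of "Suc k" "Suc (2 * k)"] by simp
    have "Suc k * (2 * Suc k choose Suc k) = 2 * (Suc k * (Suc (2 * k) choose Suc k))"
      using a c by simp
    then show ?thesis using b by simp
  qed
  let ?b = "2 * k choose k"
  have "(Suc k)\<^sup>2 * ((2 * Suc k choose Suc k)\<^sup>2 * (2 * Suc k + 1))
      = (Suc k * (2 * Suc k choose Suc k))\<^sup>2 * (2 * k + 3)"
    unfolding power_mult_distrib by (simp only: mult.assoc) (simp add: algebra_simps del: binomial_Suc_Suc)
  also have "\<dots> = 4 * ((2 * k + 1) * (2 * k + 3)) * (?b\<^sup>2 * (2 * k + 1))"
    unfolding step by (simp add: power2_eq_square algebra_simps)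
  also have "\<dots> \<le> 4 * (4 * (Suc k)\<^sup>2) * 16 ^ k"
  proof (rule mult_le_mono[OF mult_le_mono2 Suc.IH])
    show "(2 * k + 1) * (2 * k + 3) \<le> 4 * (Suc k)\<^sup>2"
      by (simp add: power2_eq_square algebra_simps)
  qed
  finally have "(Suc k)\<^sup>2 * ((2 * Suc k choose Suc k)\<^sup>2 * (2 * Suc k + 1)) \<le> (Suc k)\<^sup>2 * 16 ^ Suc k"
    by (simp add: algebra_simps)
  then show ?case by (simp only: mult_le_cancel1) auto
qed

lemma middle_binomial_sq_le: "(d choose (d div 2))\<^sup>2 * d \<le> 4 ^ d"
proof (cases "even d")
  case True
  then obtain k where d: "d = 2 * k" by blast
  have "(2 * k choose k)\<^sup>2 * (2 * k) \<le> (2 * k choose k)\<^sup>2 * (2 * k + 1)" by simp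
  also have "\<dots> \<le> 16 ^ k" by (rule central_binomial_sq_le)
  finally show ?thesis by (simp add: d power_mult)
next
  case False
  then obtain k where d: "d = 2 * k + 1" using oddE by blast
  \<comment> \<open>An odd row is reduced to the next even one, whose central coefficient is twice
    the middle coefficient of row \<open>d\<close>.\<close>
  have c: "(2 * Suc k choose Suc k) = 2 * (d choose k)"
    using binomial_symmetric[of "Suc k" "Suc (2 * k)"] by (simp add: d)
  have "4 * ((d choose k)\<^sup>2 * d) \<le> (2 * (d choose k))\<^sup>2 * (2 * Suc k + 1)"
    by (simp add: d power_mult_distrib)
  also have "\<dots> \<le> 16 ^ Suc k"
    using central_binomial_sq_le[of "Suc k"] unfolding c .
  also have "\<dots> = 4 * 4 ^ d" by (simp add: d power_mult)
  finally show ?thesis by (simp add: d)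
qed

text \<open>In probabilistic terms: each value of a sum of \<open>d\<close> signs has probability at
  most \<open>1 / sqrt d \<le> 1 / (2 * t)\<close>, so that any \<open>t\<close> values together
  have probability at most \<open>1 / 2\<close>.\<close>

lemma middle_binomial_le:
  assumes "4 * t\<^sup>2 \<le> d"
  shows "2 * t * (d choose (d div 2)) \<le> 2 ^ d"
proof -
  have "(2 * t * (d choose (d div 2)))\<^sup>2 = (d choose (d div 2))\<^sup>2 * (4 * t\<^sup>2)"
    by (simp add: power_mult_distrib)
  also have "\<dots> \<le> (d choose (d div 2))\<^sup>2 * d"
    using assms by simp
  also have "\<dots> \<le> 4 ^ d" by (rule middle_binomial_sq_le)
  also have "\<dots> = (2 ^ d)\<^sup>2" by (simp add: power2_eq_square flip: power_mult_distrib)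
  finally show ?thesis by (simp add: power2_nat_le_eq_le)
qed

lemma card_subsets_card_in_le:
  assumes "finite F" "finite J"
  shows "card {X. X \<subseteq> F \<and> card X \<in> J} \<le> card J * (card F choose (card F div 2))"
proof -
  have "{X. X \<subseteq> F \<and> card X \<in> J} = (\<Union>j\<in>J. {X. X \<subseteq> F \<and> card X = j})" by auto
  then have "card {X. X \<subseteq> F \<and> card X \<in> J} \<le> (\<Sum>j\<in>J. card {X. X \<subseteq> F \<and> card X = j})"
    by (simp only: card_UN_le[OF assms(2)])
  also have "\<dots> = (\<Sum>j\<in>J. card F choose j)"
    by (simp add: n_subsets[OF assms(1)])
  also have "\<dots> \<le> (\<Sum>j\<in>J. card F choose (card F div 2))"
    by (intro sum_mono binomial_maximum)
  finally show ?thesis by simp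
qed

lemma card_signed_sum_small:
  fixes \<alpha> :: "'a \<Rightarrow> int" and h :: int
  assumes fin: "finite F" and sgn: "\<And>p. p \<in> F \<Longrightarrow> \<alpha> p = 1 \<or> \<alpha> p = -1"
    and big: "4 * t\<^sup>2 \<le> card F"
  shows "2 * card {X. X \<subseteq> F \<and> \<bar>h + (\<Sum>p\<in>F. \<alpha> p * (if p \<in> X then 1 else -1))\<bar> < int t} \<le> 2 ^ card F"
proof -
  define N where "N = {p \<in> F. \<alpha> p = -1}"
  \<comment> \<open>Symmetric difference with the negative indices turns every coefficient into 1;
    it is an involution, hence injective.\<close>
  define flip where "flip = (\<lambda>X. (X - N) \<union> (N - X))"
  define d where "d = card F"
  define J where "J = {j. \<bar>h + 2 * int j - int d\<bar> < int t}"
  have sum_flip: "(\<Sum>p\<in>F. \<alpha> p * (if p \<in> X then 1 else -1)) = 2 * int (card (flip X)) - int d"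
    if "X \<subseteq> F" for X
  proof -
    have sub: "flip X \<subseteq> F" using that by (auto simp: flip_def N_def)
    have "(\<Sum>p\<in>F. \<alpha> p * (if p \<in> X then 1 else -1)) = (\<Sum>p\<in>F. 2 * of_bool (p \<in> flip X) - 1)"
      using sgn by (intro sum.cong) (auto simp: flip_def N_def)
    also have "\<dots> = 2 * int (card (flip X)) - int d"
      using sub fin by (simp add: sum_subtractf d_def flip: sum_distrib_left) (simp add: Int_absorb1)
    finally show ?thesis .
  qed
  \<comment> \<open>The open interval from \<open>-t\<close> to \<open>t\<close> has length
    \<open>2 * t\<close>, and the values \<open>h + 2 * j - d\<close> advance in steps of 2, so at
    most \<open>t\<close> indices hit it.\<close>
  have finJ: "finite J \<and> card J \<le> t"
  proof -
    have "\<exists>a. J \<subseteq> {a..<a + t}"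
    proof (cases "J = {}")
      case False
      define a where "a = (LEAST j. j \<in> J)"
      have a: "a \<in> J" unfolding a_def using False by (meson LeastI ex_in_conv)
      have "j \<in> {a..<a + t}" if "j \<in> J" for j
      proof -
        have "a \<le> j" unfolding a_def using that by (rule Least_le)
        moreover have "j < a + t" using a that unfolding J_def mem_Collect_eq by linarith
        ultimately show ?thesis by simp
      qed
      then show ?thesis by blast
    qed auto
    then obtain a where "J \<subseteq> {a..<a + t}" by blast
    then show ?thesis
      using card_mono[of "{a..<a + t}" J] finite_subset by fastforce
  qed
  let ?S = "{X. X \<subseteq> F \<and> \<bar>h + (\<Sum>p\<in>F. \<alpha> p * (if p \<in> X then 1 else -1))\<bar> < int t}"
  have "inj_on flip ?S"
    by (rule inj_onI) (auto simp: flip_def)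
  moreover have "flip ` ?S \<subseteq> {X. X \<subseteq> F \<and> card X \<in> J}"
    using sum_flip by (auto simp: J_def flip_def N_def add_diff_eq)
  moreover have "finite {X. X \<subseteq> F \<and> card X \<in> J}" using fin by simp
  ultimately have "card ?S \<le> card {X. X \<subseteq> F \<and> card X \<in> J}"
    using card_inj_on_le by blast
  also have "\<dots> \<le> card J * (d choose (d div 2))"
    unfolding d_def using card_subsets_card_in_le[OF fin] finJ by blast
  also have "\<dots> \<le> t * (d choose (d div 2))" using finJ by simp
  finally have "2 * card ?S \<le> 2 * t * (d choose (d div 2))" by simp
  also have "\<dots> \<le> 2 ^ d" using big d_def middle_binomial_le by blast
  finally show ?thesis by (simp add: d_def)
qed

text \<open>
  The signs on \<open>F c\<close> are still free when the first \<open>c\<close> sums have been revealed, and they decide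
  whether the next sum is small.
\<close>

lemma card_all_signed_sums_small:
  fixes \<alpha> :: "nat \<Rightarrow> 'a \<Rightarrow> int"
  assumes fin: "finite P" and sub: "\<And>c. F c \<subseteq> P"
    and sgn: "\<And>c p. p \<in> F c \<Longrightarrow> \<alpha> c p = 1 \<or> \<alpha> c p = -1"
    and later: "\<And>c c' p. c < c' \<Longrightarrow> p \<in> F c' \<Longrightarrow> \<alpha> c p = 0"
  shows "card {X. X \<subseteq> P \<and> (\<forall>c<K. \<bar>\<Sum>p\<in>P. \<alpha> c p * (if p \<in> X then 1 else -1)\<bar> < int t)}
           * 2 ^ card {c. c < K \<and> 4 * t\<^sup>2 \<le> card (F c)} \<le> 2 ^ card P"
proof (induction K)
  case 0
  have "{X. X \<subseteq> P} = Pow P" by auto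
  then show ?case using fin by (simp add: card_Pow)
next
  case (Suc K)
  define D where "D c X = (\<Sum>p\<in>P. \<alpha> c p * (if p \<in> X then 1 else -1))" for c X
  define G where "G k = {X. X \<subseteq> P \<and> (\<forall>c<k. \<bar>D c X\<bar> < int t)}" for k
  define r where "r k = card {c. c < k \<and> 4 * t\<^sup>2 \<le> card (F c)}" for k
  have IH: "card (G K) * 2 ^ r K \<le> 2 ^ card P"
    using Suc.IH by (simp add: G_def D_def r_def)
  have finG: "finite (G k)" for k
    using fin by (auto simp: G_def)
  show ?case
  proof (cases "4 * t\<^sup>2 \<le> card (F K)")
    case False
    then have "{c. c < Suc K \<and> 4 * t\<^sup>2 \<le> card (F c)} = {c. c < K \<and> 4 * t\<^sup>2 \<le> card (F c)}"
      by (auto simp: less_Suc_eq)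
    then have "r (Suc K) = r K" by (simp add: r_def)
    moreover have "G (Suc K) \<subseteq> G K" by (auto simp: G_def)
    then have "card (G (Suc K)) \<le> card (G K)" using finG card_mono by blast
    ultimately have "card (G (Suc K)) * 2 ^ r (Suc K) \<le> card (G K) * 2 ^ r K"
      by (simp only: mult_le_mono1)
    then have "card (G (Suc K)) * 2 ^ r (Suc K) \<le> 2 ^ card P"
      using IH by (rule le_trans)
    then show ?thesis by (simp only: G_def D_def r_def)
  next
    case True
    have "{c. c < Suc K \<and> 4 * t\<^sup>2 \<le> card (F c)} = insert K {c. c < K \<and> 4 * t\<^sup>2 \<le> card (F c)}"
      using True by (auto simp: less_Suc_eq)
    then have rSuc: "r (Suc K) = Suc (r K)" by (simp add: r_def)
    \<comment> \<open>The first \<open>K\<close> sums ignore the signs on \<open>F K\<close>. Hence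
      \<open>G K\<close> is the product of \<open>H\<close>, the representatives without elements of
      \<open>F K\<close>, and all choices on \<open>F K\<close>; each fibre can be counted on its
      own.\<close>
    define H where "H = {X \<in> G K. X \<inter> F K = {}}"
    have finH: "finite H" using finG by (simp add: H_def)
    have finF: "finite (F K)" using fin sub finite_subset by blast
    have indep: "D c X = D c (X - F K)" if "c < K" for c X
      unfolding D_def using later[OF that] by (intro sum.cong) auto
    have GK: "bij_betw (\<lambda>(X0, X1). X0 \<union> X1) (H \<times> Pow (F K)) (G K)"
    proof (rule bij_betwI[where g = "\<lambda>X. (X - F K, X \<inter> F K)"])
      show "(\<lambda>(X0, X1). X0 \<union> X1) \<in> H \<times> Pow (F K) \<rightarrow> G K"
      proof (clarsimp simp: H_def G_def)
        fix X0 X1 assume *: "X0 \<subseteq> P" "\<forall>c<K. \<bar>D c X0\<bar> < int t" "X0 \<inter> F K = {}" "X1 \<subseteq> F K"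
        have "X0 \<union> X1 - F K = X0" using * by auto
        then have "\<forall>c<K. D c (X0 \<union> X1) = D c X0" using indep[of _ "X0 \<union> X1"] by simp
        then show "X1 \<subseteq> P \<and> (\<forall>c<K. \<bar>D c (X0 \<union> X1)\<bar> < int t)"
          using * sub[of K] by auto
      qed
      show "(\<lambda>X. (X - F K, X \<inter> F K)) \<in> G K \<rightarrow> H \<times> Pow (F K)"
        by (auto simp: H_def G_def simp flip: indep)
    qed (auto simp: H_def)
    then have "card (G K) = card (H \<times> Pow (F K))"
      by (simp only: bij_betw_same_card[OF GK])
    then have cG: "card (G K) = card H * 2 ^ card (F K)"
      using finF by (simp only: card_cartesian_product card_Pow)
    define B where "B X0 = {X1. X1 \<subseteq> F K \<and> \<bar>D K (X0 \<union> X1)\<bar> < int t}" for X0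
    have B: "2 * card (B X0) \<le> 2 ^ card (F K)" if "X0 \<in> H" for X0
    proof -
      define h where "h = (\<Sum>p\<in>P - F K. \<alpha> K p * (if p \<in> X0 then 1 else -1))"
      have "D K (X0 \<union> X1) = h + (\<Sum>p\<in>F K. \<alpha> K p * (if p \<in> X1 then 1 else -1))"
        if "X1 \<subseteq> F K" for X1
      proof -
        have "D K (X0 \<union> X1) = (\<Sum>p\<in>P - F K. \<alpha> K p * (if p \<in> X0 \<union> X1 then 1 else -1))
          + (\<Sum>p\<in>F K. \<alpha> K p * (if p \<in> X0 \<union> X1 then 1 else -1))"
          unfolding D_def using fin sub by (simp add: sum.subset_diff)
        also have "(\<Sum>p\<in>P - F K. \<alpha> K p * (if p \<in> X0 \<union> X1 then 1 else -1)) = h"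
          unfolding h_def using that by (intro sum.cong) auto
        also have "(\<Sum>p\<in>F K. \<alpha> K p * (if p \<in> X0 \<union> X1 then 1 else -1))
            = (\<Sum>p\<in>F K. \<alpha> K p * (if p \<in> X1 then 1 else -1))"
          using \<open>X0 \<in> H\<close> by (intro sum.cong) (auto simp: H_def)
        finally show ?thesis .
      qed
      then have "B X0 = {X1. X1 \<subseteq> F K \<and>
          \<bar>h + (\<Sum>p\<in>F K. \<alpha> K p * (if p \<in> X1 then 1 else -1))\<bar> < int t}"
        unfolding B_def by auto
      then show ?thesis
        using card_signed_sum_small[OF finF sgn True] by simp
    qed
    have "G (Suc K) \<subseteq> (\<lambda>(X0, X1). X0 \<union> X1) ` (SIGMA X0:H. B X0)"
    proof
      fix X assume X: "X \<in> G (Suc K)"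
      then have "X - F K \<in> H" by (auto simp: H_def G_def simp flip: indep)
      moreover have "X \<inter> F K \<in> B (X - F K)"
        using X Un_Diff_Int[of X "F K"] by (auto simp: B_def G_def)
      ultimately show "X \<in> (\<lambda>(X0, X1). X0 \<union> X1) ` (SIGMA X0:H. B X0)"
        by (intro image_eqI[of _ _ "(X - F K, X \<inter> F K)"]) auto
    qed
    moreover have finS: "finite (SIGMA X0:H. B X0)"
      using finH finF by (auto simp: B_def)
    ultimately have "card (G (Suc K)) \<le> card (SIGMA X0:H. B X0)"
      using surj_card_le by blast
    also have "\<dots> = (\<Sum>X0\<in>H. card (B X0))"
      using finH finF by (intro card_SigmaI) (auto simp: B_def)
    finally have "2 * card (G (Suc K)) \<le> (\<Sum>X0\<in>H. 2 * card (B X0))"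
      by (simp flip: sum_distrib_left)
    also have "\<dots> \<le> (\<Sum>X0\<in>H. 2 ^ card (F K))" using B by (intro sum_mono)
    also have "\<dots> = card (G K)" using cG by simp
    finally have "card (G (Suc K)) * 2 ^ r (Suc K) \<le> card (G K) * 2 ^ r K"
      by (simp add: rSuc)
    then show ?thesis using IH by (simp add: G_def D_def r_def)
  qed
qed

section \<open>Arc pairings as matchings of intervals\<close>

text \<open>The process seen from the uncovered interval \<open>{lo..<lo + 2 * k}\<close>: a right
  step takes its two lowest points, a cross step its two ends, a left step its two highest points.
  This removes the arithmetic modulo \<open>n\<close>.\<close>

primrec arc_matchings :: "nat \<Rightarrow> nat \<Rightarrow> pairing set" where
  "arc_matchings 0 lo = {{}}"
| "arc_matchings (Suc k) lo =
     insert {lo, lo + 1} ` arc_matchings k (lo + 2) \<union>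
     insert {lo, lo + 2 * k + 1} ` arc_matchings k (lo + 1) \<union>
     insert {lo + 2 * k, lo + 2 * k + 1} ` arc_matchings k lo"

lemma arc_matchings_nonempty: "arc_matchings k lo \<noteq> {}"
  by (induction k arbitrary: lo) auto

definition pairs_up :: "pairing \<Rightarrow> nat set \<Rightarrow> bool" where
  "pairs_up P A \<longleftrightarrow> finite P \<and> \<Union>P = A \<and> disjoint P \<and> (\<forall>p\<in>P. card p = 2)"

lemma pairs_up_insert:
  assumes "pairs_up P A" "a \<noteq> b" "a \<notin> A" "b \<notin> A"
  shows "pairs_up (insert {a, b} P) (insert a (insert b A))"
  using assms unfolding pairs_up_def disjoint_def by (auto simp: disjnt_def)

lemma pairs_up_arc_matchings:
  "P \<in> arc_matchings k lo \<Longrightarrow> pairs_up P {lo..<lo + 2 * k}"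
proof (induction k arbitrary: lo P)
  case 0
  then show ?case by (simp add: pairs_up_def)
next
  case (Suc k)
  consider Q where "P = insert {lo, lo + 1} Q" "Q \<in> arc_matchings k (lo + 2)"
    | Q where "P = insert {lo, lo + 2 * k + 1} Q" "Q \<in> arc_matchings k (lo + 1)"
    | Q where "P = insert {lo + 2 * k, lo + 2 * k + 1} Q" "Q \<in> arc_matchings k lo"
    using Suc.prems by auto
  then show ?case
  proof cases
    case 1
    have "insert lo (insert (lo + 1) {lo + 2..<lo + 2 + 2 * k}) = {lo..<lo + 2 * Suc k}" by auto
    with pairs_up_insert[OF Suc.IH[OF 1(2)], of lo "lo + 1"] 1(1) show ?thesis by simp
  next
    case 2
    have "insert lo (insert (lo + 2 * k + 1) {lo + 1..<lo + 1 + 2 * k}) = {lo..<lo + 2 * Suc k}" by auto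
    with pairs_up_insert[OF Suc.IH[OF 2(2)], of lo "lo + 2 * k + 1"] 2(1) show ?thesis by simp
  next
    case 3
    have "insert (lo + 2 * k) (insert (lo + 2 * k + 1) {lo..<lo + 2 * k}) = {lo..<lo + 2 * Suc k}" by auto
    with pairs_up_insert[OF Suc.IH[OF 3(2)], of "lo + 2 * k" "lo + 2 * k + 1"] 3(1) show ?thesis by simp
  qed
qed

lemma card_pairs_up:
  assumes "pairs_up P A"
  shows "card A = 2 * card P"
proof -
  have "card (\<Union>P) = sum card P"
    using assms by (intro card_Union_disjoint) (auto simp: pairs_up_def intro: card_ge_0_finite)
  then show ?thesis using assms by (simp add: pairs_up_def)
qed

text \<open>
  The points not yet covered by the arc \<open>[L, R]\<close> are the integer interval \<open>{R + 1..<R + 1 + 2 * k}\<close>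
  without wrapping around, because the process starts from the pair \<open>{0, 1}\<close>.
\<close>

lemma arc_process_step_matchings:
  assumes n: "n = R + 1 + 2 * Suc k + j" and L: "L = (R + 1 + 2 * Suc k) mod n"
  shows "(\<Union>c\<in>{Left, Cross, Right}. case arc_step n (L, R, P) c of
            (L', R', P') \<Rightarrow> (\<union>) P' ` arc_matchings k (R' + 1))
           = (\<union>) P ` arc_matchings (Suc k) (R + 1)"
    and "(L', R', P') \<in> arc_step n (L, R, P) ` {Left, Cross, Right}
           \<Longrightarrow> L' = (R' + 1 + 2 * k) mod n \<and> R' + 1 + 2 * k \<le> n"
proof -
  \<comment> \<open>For \<open>j = 0\<close> the uncovered interval reaches up to \<open>n\<close>,
    so \<open>L\<close> is 0 and the subtraction really wraps around; for \<open>j > 0\<close> the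
    added \<open>n\<close> is cancelled by the modulus.\<close>
  have l1: "(L + n - 1) mod n = R + 2 + 2 * k"
  proof (cases "j = 0")
    case True
    then show ?thesis using n L by simp
  next
    case False
    then have "L + n - 1 = R + 2 + 2 * k + n" using n L by simp
    then have "(L + n - 1) mod n = (R + 2 + 2 * k) mod n" by (simp only: mod_add_self2)
    then show ?thesis using n by simp
  qed
  have l2: "(L + n - 2) mod n = R + 1 + 2 * k"
  proof (cases "j = 0")
    case True
    then show ?thesis using n L by simp
  next
    case False
    then have "L + n - 2 = R + 1 + 2 * k + n" using n L by simp
    then have "(L + n - 2) mod n = (R + 1 + 2 * k) mod n" by (simp only: mod_add_self2)
    then show ?thesis using n by simp
  qed
  have r1: "(R + 1) mod n = R + 1" "(R + 2) mod n = R + 2" using n by auto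
  show "(\<Union>c\<in>{Left, Cross, Right}. case arc_step n (L, R, P) c of
            (L', R', P') \<Rightarrow> (\<union>) P' ` arc_matchings k (R' + 1))
           = (\<union>) P ` arc_matchings (Suc k) (R + 1)"
    using l1 l2 r1
    by (simp add: image_Un image_image Un_ac numeral_2_eq_2 insert_commute[of "Suc (Suc (R + (k + k)))" "Suc R" "{}"])
  show "(L', R', P') \<in> arc_step n (L, R, P) ` {Left, Cross, Right}
           \<Longrightarrow> L' = (R' + 1 + 2 * k) mod n \<and> R' + 1 + 2 * k \<le> n"
  proof -
    assume "(L', R', P') \<in> arc_step n (L, R, P) ` {Left, Cross, Right}"
    then consider "L' = R + 1 + 2 * k" "R' = R" | "L' = R + 2 + 2 * k" "R' = R + 1"
      | "L' = L" "R' = R + 2"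
      using l1 l2 r1 by auto
    then show ?thesis
    proof cases
      case 3
      then have "R' + 1 + 2 * k = R + 1 + 2 * Suc k" by simp
      then show ?thesis using 3 L n by simp
    qed (use n in simp_all)
  qed
qed

text \<open>An invariant: the pairs chosen so far, combined with every completion of the uncovered
  interval, always give the same family. At time 0 only the pair \<open>{0, 1}\<close> is chosen; at
  \<open>k = 0\<close> only the empty completion remains.\<close>

lemma arc_process_matchings:
  assumes "n = 2 + 2 * (k + t)"
  shows "(\<Union>(L, R, P)\<in>set_pmf (arc_process n t). (\<union>) P ` arc_matchings k (R + 1))
           = insert {0, 1} ` arc_matchings (k + t) 2 \<and>
         (\<forall>(L, R, P)\<in>set_pmf (arc_process n t). L = (R + 1 + 2 * k) mod n \<and> R + 1 + 2 * k \<le> n)"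
  using assms
proof (induction t arbitrary: k)
  case 0
  then show ?case by (simp add: numeral_2_eq_2)
next
  case (Suc t)
  let ?S = "set_pmf (arc_process n t)"
  have IH: "(\<Union>(L, R, P)\<in>?S. (\<union>) P ` arc_matchings (Suc k) (R + 1))
           = insert {0, 1} ` arc_matchings (k + Suc t) 2"
       "\<forall>(L, R, P)\<in>?S. L = (R + 1 + 2 * Suc k) mod n \<and> R + 1 + 2 * Suc k \<le> n"
    using Suc.IH[of "Suc k"] Suc.prems by simp_all
  have S: "set_pmf (arc_process n (Suc t)) = (\<Union>s\<in>?S. arc_step n s ` {Left, Cross, Right})"
    by (simp add: set_pmf_of_set)
  have "(\<Union>(L', R', P')\<in>set_pmf (arc_process n (Suc t)). (\<union>) P' ` arc_matchings k (R' + 1))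
     = (\<Union>s\<in>?S. \<Union>c\<in>{Left, Cross, Right}. case arc_step n s c of
            (L', R', P') \<Rightarrow> (\<union>) P' ` arc_matchings k (R' + 1))"
    unfolding S by (simp only: UN_UN_flatten image_image)
  also have "\<dots> = (\<Union>(L, R, P)\<in>?S. (\<union>) P ` arc_matchings (Suc k) (R + 1))"
  proof (rule SUP_cong[OF refl], clarify)
    fix L R P assume "(L, R, P) \<in> ?S"
    then have "L = (R + 1 + 2 * Suc k) mod n" "R + 1 + 2 * Suc k \<le> n" using IH(2) by auto
    then obtain j where "n = R + 1 + 2 * Suc k + j" using le_Suc_ex by blast
    from arc_process_step_matchings(1)[OF this \<open>L = _\<close>]
    show "(\<Union>c\<in>{Left, Cross, Right}. case arc_step n (L, R, P) c of
            (L', R', P') \<Rightarrow> (\<union>) P' ` arc_matchings k (R' + 1))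
           = (\<union>) P ` arc_matchings (Suc k) (R + 1)" .
  qed
  finally have "(\<Union>(L', R', P')\<in>set_pmf (arc_process n (Suc t)). (\<union>) P' ` arc_matchings k (R' + 1))
     = insert {0, 1} ` arc_matchings (k + Suc t) 2" using IH(1) by simp
  moreover have "L' = (R' + 1 + 2 * k) mod n \<and> R' + 1 + 2 * k \<le> n"
    if mem: "(L', R', P') \<in> set_pmf (arc_process n (Suc t))" for L' R' P'
  proof -
    obtain s where "s \<in> ?S" "(L', R', P') \<in> arc_step n s ` {Left, Cross, Right}"
      using mem unfolding S UN_iff by blast
    moreover obtain L R P where "s = (L, R, P)" by (rule prod_cases3)
    ultimately have s: "(L, R, P) \<in> ?S" "(L', R', P') \<in> arc_step n (L, R, P) ` {Left, Cross, Right}"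
      by simp_all
    then have "L = (R + 1 + 2 * Suc k) mod n" "R + 1 + 2 * Suc k \<le> n" using IH(2) by auto
    then obtain j where "n = R + 1 + 2 * Suc k + j" using le_Suc_ex by blast
    from arc_process_step_matchings(2)[OF this \<open>L = _\<close> s(2)] show ?thesis .
  qed
  then have "\<forall>(L', R', P')\<in>set_pmf (arc_process n (Suc t)). L' = (R' + 1 + 2 * k) mod n \<and> R' + 1 + 2 * k \<le> n"
    by (intro ballI) (simp only: split_paired_all prod.case)
  ultimately show ?case by (rule conjI)
qed

lemma arc_pairings_eq:
  assumes "even n" "n \<ge> 2"
  shows "arc_pairings n = insert {0, 1} ` arc_matchings (n div 2 - 1) 2"
proof -
  have n: "n = 2 + 2 * (0 + (n div 2 - 1))" using assms by auto
  have "arc_pairings n = (\<Union>(L, R, P)\<in>set_pmf (arc_process n (n div 2 - 1)). {P})"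
    by (auto simp: arc_pairings_def random_arc_pairing_def)
  then show ?thesis
    using arc_process_matchings[OF n] by simp
qed

lemma pairs_up_arc_pairings:
  assumes "even n" "n \<ge> 2" "P \<in> arc_pairings n"
  shows "pairs_up P {..<n}"
proof -
  obtain Q where P: "P = insert {0, 1} Q" and "Q \<in> arc_matchings (n div 2 - 1) 2"
    using assms by (auto simp: arc_pairings_eq)
  moreover have "2 + 2 * (n div 2 - 1) = n" using assms by auto
  ultimately have "pairs_up Q {2..<n}"
    using pairs_up_arc_matchings[of Q "n div 2 - 1" 2] by simp
  moreover have "insert 0 (insert 1 {2..<n}) = {..<n}" using assms by auto
  ultimately show ?thesis
    using pairs_up_insert[of Q "{2..<n}" 0 1] by (simp add: P)
qed

lemma finite_arc_matchings: "finite (arc_matchings k lo)"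
  by (induction k arbitrary: lo) auto

lemma finite_arc_pairings: "even n \<Longrightarrow> n \<ge> 2 \<Longrightarrow> finite (arc_pairings n)"
  by (simp add: arc_pairings_eq finite_arc_matchings)

section \<open>Matchings with prescribed pairs across the interval\<close>

lemma arc_matchings_left_run:
  "Q \<in> arc_matchings k lo \<Longrightarrow> \<exists>Q'\<in>arc_matchings (k + c) lo. Q \<subseteq> Q'"
proof (induction c)
  case (Suc c)
  then obtain Q' where "Q' \<in> arc_matchings (k + c) lo" "Q \<subseteq> Q'" by blast
  then show ?case
    by (intro bexI[of _ "insert {lo + 2 * (k + c), lo + 2 * (k + c) + 1} Q'"]) auto
qed auto

lemma arc_matchings_right_run:
  "Q \<in> arc_matchings k (lo + 2 * c) \<Longrightarrow> \<exists>Q'\<in>arc_matchings (k + c) lo. Q \<subseteq> Q'"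
proof (induction c arbitrary: lo)
  case (Suc c)
  have "lo + 2 * Suc c = (lo + 2) + 2 * c" by simp
  then obtain Q' where "Q' \<in> arc_matchings (k + c) (lo + 2)" "Q \<subseteq> Q'"
    using Suc.IH[of "lo + 2"] Suc.prems by metis
  then show ?case
    by (intro bexI[of _ "insert {lo, lo + 1} Q'"]) auto
qed auto

lemma arc_matchings_cross_run:
  "Q \<in> arc_matchings k (lo + c) \<Longrightarrow> \<exists>Q'\<in>arc_matchings (k + c) lo.
     Q \<subseteq> Q' \<and> (\<forall>x<c. {lo + x, lo + 2 * (k + c) - 1 - x} \<in> Q')"
proof (induction c arbitrary: lo)
  case (Suc c)
  then obtain Q' where Q': "Q' \<in> arc_matchings (k + c) (lo + 1)" "Q \<subseteq> Q'"
      "\<forall>x<c. {lo + 1 + x, lo + 1 + 2 * (k + c) - 1 - x} \<in> Q'"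
    using Suc.IH[of "lo + 1"] by auto
  let ?Q = "insert {lo, lo + 2 * (k + c) + 1} Q'"
  have "{lo + x, lo + 2 * (k + Suc c) - 1 - x} \<in> ?Q" if "x < Suc c" for x
  proof (cases x)
    case (Suc y)
    then have "{lo + 1 + y, lo + 1 + 2 * (k + c) - 1 - y} \<in> Q'" using Q'(3) that by simp
    then show ?thesis using Suc that by simp
  qed auto
  then show ?case using Q' by (intro bexI[of _ ?Q]) auto
qed auto

text \<open>
  The block consists of \<open>a\<close> right steps, then cross steps, then \<open>a\<close> left steps: it always consumes
  \<open>2m\<close> points at each end, and \<open>a\<close> shifts the two ends against each other.
\<close>

lemma arc_matchings_block:
  assumes Q: "Q \<in> arc_matchings k (lo + 2 * m)" and a: "a \<le> m"
  shows "\<exists>Q'\<in>arc_matchings (k + 2 * m) lo.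
     Q \<subseteq> Q' \<and> (\<forall>x<2 * m - 2 * a. {lo + 2 * a + x, lo + 2 * (k + 2 * m) - 1 - x} \<in> Q')"
proof -
  \<comment> \<open>The matching grows from the inside outwards, so the last steps of the block are
    added first.\<close>
  obtain Q1 where Q1: "Q1 \<in> arc_matchings (k + a) (lo + 2 * m)" "Q \<subseteq> Q1"
    using arc_matchings_left_run[OF Q] by blast
  define c where "c = 2 * m - 2 * a"
  have "lo + 2 * m = (lo + 2 * a) + c" using a by (simp add: c_def)
  with Q1 obtain Q2 where Q2: "Q2 \<in> arc_matchings (k + a + c) (lo + 2 * a)" "Q1 \<subseteq> Q2"
      "\<forall>x<c. {lo + 2 * a + x, lo + 2 * a + 2 * (k + a + c) - 1 - x} \<in> Q2"
    using arc_matchings_cross_run[of Q1 "k + a" "lo + 2 * a" c] by auto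
  obtain Q3 where Q3: "Q3 \<in> arc_matchings (k + a + c + a) lo" "Q2 \<subseteq> Q3"
    using arc_matchings_right_run[OF Q2(1)] by blast
  have e: "k + a + c + a = k + 2 * m" "lo + 2 * a + 2 * (k + a + c) = lo + 2 * (k + 2 * m)"
    using a by (simp_all add: c_def)
  show ?thesis
  proof (intro bexI[of _ Q3] conjI allI impI)
    show "Q3 \<in> arc_matchings (k + 2 * m) lo" using Q3(1) by (simp only: e)
    show "Q \<subseteq> Q3" using Q1(2) Q2(2) Q3(2) by (rule order_trans[OF order_trans])
    fix x assume "x < 2 * m - 2 * a"
    then have "{lo + 2 * a + x, lo + 2 * a + 2 * (k + a + c) - 1 - x} \<in> Q2"
      using Q2(3) by (simp only: c_def)
    then show "{lo + 2 * a + x, lo + 2 * (k + 2 * m) - 1 - x} \<in> Q3"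
      using Q3(2) unfolding e(2) by (rule subsetD[rotated])
  qed
qed

lemma arc_matchings_blocks:
  assumes "\<And>i. i < N \<Longrightarrow> f i \<le> m"
  shows "\<exists>Q\<in>arc_matchings (k + 2 * m * N) lo. \<forall>i<N. \<forall>x<2 * m - 2 * f i.
     {lo + 2 * m * i + 2 * f i + x, lo + 2 * (k + 2 * m * N) - 1 - 2 * m * i - x} \<in> Q"
  using assms
proof (induction N arbitrary: lo f)
  case 0
  then show ?case using arc_matchings_nonempty by auto
next
  case (Suc N)
  obtain Q where Q: "Q \<in> arc_matchings (k + 2 * m * N) (lo + 2 * m)"
    "\<forall>i<N. \<forall>x<2 * m - 2 * f (Suc i). {lo + 2 * m + 2 * m * i + 2 * f (Suc i) + x,
       lo + 2 * m + 2 * (k + 2 * m * N) - 1 - 2 * m * i - x} \<in> Q"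
    using Suc.IH[of "\<lambda>i. f (Suc i)" "lo + 2 * m"] Suc.prems by auto
  obtain Q' where Q': "Q' \<in> arc_matchings (k + 2 * m * N + 2 * m) lo" "Q \<subseteq> Q'"
    "\<forall>x<2 * m - 2 * f 0. {lo + 2 * f 0 + x, lo + 2 * (k + 2 * m * N + 2 * m) - 1 - x} \<in> Q'"
    using arc_matchings_block[OF Q(1), of "f 0"] Suc.prems by auto
  have "{lo + 2 * m * i + 2 * f i + x, lo + 2 * (k + 2 * m * Suc N) - 1 - 2 * m * i - x} \<in> Q'"
    if "i < Suc N" "x < 2 * m - 2 * f i" for i x
  proof (cases i)
    case 0
    then have "{lo + 2 * f 0 + x, lo + 2 * (k + 2 * m * N + 2 * m) - 1 - x} \<in> Q'"
      using Q'(3) that by blast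
    moreover have "lo + 2 * f 0 + x = lo + 2 * m * i + 2 * f i + x"
      "lo + 2 * (k + 2 * m * N + 2 * m) - 1 - x = lo + 2 * (k + 2 * m * Suc N) - 1 - 2 * m * i - x"
      by (simp_all add: 0 algebra_simps)
    ultimately show ?thesis by (simp only:)
  next
    case (Suc j)
    then have "{lo + 2 * m + 2 * m * j + 2 * f i + x,
        lo + 2 * m + 2 * (k + 2 * m * N) - 1 - 2 * m * j - x} \<in> Q'"
      using Q(2) Q'(2) that by auto
    moreover have "lo + 2 * m + 2 * m * j + 2 * f i + x = lo + 2 * m * i + 2 * f i + x"
      "lo + 2 * m + 2 * (k + 2 * m * N) - 1 - 2 * m * j - x
        = lo + 2 * (k + 2 * m * Suc N) - 1 - 2 * m * i - x"
      by (simp_all add: Suc algebra_simps)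
    ultimately show ?thesis by (simp only:)
  qed
  moreover have "Q' \<in> arc_matchings (k + 2 * m * Suc N) lo"
    using Q'(1) by (simp only: mult_Suc_right add_ac)
  ultimately show ?case by (intro bexI[of _ Q']) simp_all
qed

section \<open>Imbalanced prefixes\<close>

text \<open>A set \<open>X\<close> of pairs encodes a split: the pairs in \<open>X\<close> give
  their smaller element to \<open>Y\<close>, the others their larger one. Counting splits of
  \<open>P\<close> thus becomes counting subsets of \<open>P\<close>.\<close>

definition orient_y :: "pairing \<Rightarrow> nat set \<Rightarrow> nat" where
  "orient_y X p = (if p \<in> X then Min p else Max p)"

definition orient_z :: "pairing \<Rightarrow> nat set \<Rightarrow> nat" where
  "orient_z X p = (if p \<in> X then Max p else Min p)"

definition imbalance :: "pairing \<Rightarrow> pairing \<Rightarrow> nat set \<Rightarrow> int" where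
  "imbalance P X C = int (card {p \<in> P. orient_y X p \<in> C}) - int (card {p \<in> P. orient_z X p \<in> C})"

lemma pairs_up_elim:
  assumes "pairs_up P A" "p \<in> P"
  shows "p = {Min p, Max p}" "Min p \<noteq> Max p" "Min p \<in> p" "Max p \<in> p" "p \<subseteq> A"
proof -
  have "card p = 2" "p \<subseteq> A" using assms by (auto simp: pairs_up_def)
  then obtain a b where ab: "p = {a, b}" "a \<noteq> b" by (auto simp: card_2_iff)
  show "p = {Min p, Max p}" "Min p \<noteq> Max p" using ab by (auto simp: min_def max_def)
  show "Min p \<in> p" "Max p \<in> p" using ab by (intro Min_in Max_in; simp)+
  show "p \<subseteq> A" by fact
qed

lemma imbalance_eq_sum:
  assumes "finite P"
  shows "imbalance P X C = (\<Sum>p\<in>P. (of_bool (Min p \<in> C) - of_bool (Max p \<in> C)) * (if p \<in> X then 1 else -1))"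
proof -
  have "int (card {p \<in> P. f p \<in> C}) = (\<Sum>p\<in>P. of_bool (f p \<in> C))" for f :: "nat set \<Rightarrow> nat"
    using assms by (simp add: Int_def)
  then have "imbalance P X C = (\<Sum>p\<in>P. of_bool (orient_y X p \<in> C) - of_bool (orient_z X p \<in> C))"
    by (simp add: imbalance_def sum_subtractf)
  also have "\<dots> = (\<Sum>p\<in>P. (of_bool (Min p \<in> C) - of_bool (Max p \<in> C)) * (if p \<in> X then 1 else -1))"
    by (intro sum.cong) (auto simp: orient_y_def orient_z_def)
  finally show ?thesis .
qed

text \<open>Such a pair has exactly one element in the prefix \<open>{v. col v \<le> c}\<close> and
  none in any earlier prefix, so its sign affects the imbalance at \<open>c\<close> but no earlier
  one. These sets play the role of \<open>F c\<close> in
  \<open>card_all_signed_sums_small\<close>.\<close>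

definition fresh_pairs :: "(nat \<Rightarrow> nat) \<Rightarrow> pairing \<Rightarrow> nat \<Rightarrow> pairing" where
  "fresh_pairs col P c = {p \<in> P. \<exists>a\<in>p. \<exists>b\<in>p. col a = c \<and> c < col b}"

lemma card_small_imbalance:
  assumes P: "pairs_up P A"
  shows "card {X. X \<subseteq> P \<and> (\<forall>c<K. \<bar>imbalance P X {v. col v \<le> c}\<bar> < int t)}
     * 2 ^ card {c. c < K \<and> 4 * t\<^sup>2 \<le> card (fresh_pairs col P c)} \<le> 2 ^ card P"
proof -
  have fin: "finite P" using P by (simp add: pairs_up_def)
  let ?\<alpha> = "\<lambda>c p. of_bool (Min p \<in> {v. col v \<le> c}) - of_bool (Max p \<in> {v. col v \<le> c}) :: int"
  have F: "\<exists>a b. {Min p, Max p} = {a, b} \<and> col a = c \<and> c < col b" if "p \<in> fresh_pairs col P c" for p c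
  proof -
    obtain a b where ab: "p \<in> P" "a \<in> p" "b \<in> p" "col a = c" "c < col b"
      using \<open>p \<in> fresh_pairs col P c\<close> by (auto simp: fresh_pairs_def)
    have "{a, b} \<subseteq> {Min p, Max p}" "a \<noteq> b" using ab pairs_up_elim(1)[OF P ab(1)] by (blast, auto)
    then have "{Min p, Max p} = {a, b}" by auto
    then show ?thesis using ab by blast
  qed
  show ?thesis
    unfolding imbalance_eq_sum[OF fin]
  proof (rule card_all_signed_sums_small[OF fin])
    show "fresh_pairs col P c \<subseteq> P" for c by (auto simp: fresh_pairs_def)
    show "?\<alpha> c p = 1 \<or> ?\<alpha> c p = -1" if "p \<in> fresh_pairs col P c" for c p
      using F[OF that] by (auto simp: doubleton_eq_iff)
    show "?\<alpha> c p = 0" if "c < c'" "p \<in> fresh_pairs col P c'" for c c' p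
      using F[OF that(2)] that(1) by (auto simp: doubleton_eq_iff)
  qed
qed

text \<open>A bichromatic pair is fresh at the smaller of its two colours. A colour owns at most
  \<open>w\<close> fresh pairs, since each uses a different point of its class; a colour below the
  threshold owns fewer than \<open>d\<close>.\<close>

lemma card_bichromatic_le:
  assumes P: "pairs_up P A"
    and col: "\<And>v. v \<in> A \<Longrightarrow> col v < K"
    and cls: "\<And>c. card {v \<in> A. col v = c} \<le> w" and finA: "finite A"
  shows "card {p \<in> P. \<exists>a\<in>p. \<exists>b\<in>p. col a \<noteq> col b}
     \<le> card {c. c < K \<and> d \<le> card (fresh_pairs col P c)} * w + K * d"
proof -
  have fin: "finite P" using P by (simp add: pairs_up_def)
  have disj: "p = q" if "p \<in> P" "q \<in> P" "i \<in> p" "i \<in> q" for p q i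
    using P that unfolding pairs_up_def disjoint_def disjnt_def by blast
  have finF: "finite (fresh_pairs col P c)" for c using fin by (auto simp: fresh_pairs_def)
  have F: "card (fresh_pairs col P c) \<le> w" for c
  proof -
    have "\<forall>p\<in>fresh_pairs col P c. \<exists>a. a \<in> p \<and> col a = c"
      by (auto simp: fresh_pairs_def)
    then obtain f where f: "\<And>p. p \<in> fresh_pairs col P c \<Longrightarrow> f p \<in> p \<and> col (f p) = c" by metis
    have "inj_on f (fresh_pairs col P c)"
      using f disj by (intro inj_onI) (metis (no_types, lifting) fresh_pairs_def mem_Collect_eq)
    moreover have "f ` fresh_pairs col P c \<subseteq> {v \<in> A. col v = c}"
      using f P by (auto simp: fresh_pairs_def pairs_up_def)
    ultimately have "card (fresh_pairs col P c) \<le> card {v \<in> A. col v = c}"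
      using finA by (intro card_inj_on_le) auto
    then show ?thesis using cls[of c] by simp
  qed
  have "{p \<in> P. \<exists>a\<in>p. \<exists>b\<in>p. col a \<noteq> col b} \<subseteq> (\<Union>c\<in>{..<K}. fresh_pairs col P c)"
  proof clarify
    fix p a b assume p: "p \<in> P" "a \<in> p" "b \<in> p" "col a \<noteq> col b"
    have "col a < K" "col b < K" using p P col by (auto simp: pairs_up_def)
    then show "p \<in> (\<Union>c\<in>{..<K}. fresh_pairs col P c)"
      using p by (cases "col a < col b") (auto simp: fresh_pairs_def neq_iff)
  qed
  then have "card {p \<in> P. \<exists>a\<in>p. \<exists>b\<in>p. col a \<noteq> col b} \<le> card (\<Union>c\<in>{..<K}. fresh_pairs col P c)"
    using finF by (intro card_mono) auto
  also have "\<dots> \<le> (\<Sum>c<K. card (fresh_pairs col P c))" by (rule card_UN_le) simp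
  also have "\<dots> \<le> (\<Sum>c<K. of_bool (d \<le> card (fresh_pairs col P c)) * w + d)"
    by (intro sum_mono) (use F in \<open>auto simp: trans_le_add1\<close>)
  also have "\<dots> = card {c. c < K \<and> d \<le> card (fresh_pairs col P c)} * w + K * d"
    by (simp add: sum.distrib Int_def flip: sum_distrib_right)
  finally show ?thesis .
qed

text \<open>The two points compared are partners in block \<open>i\<close> with shift
  \<open>a\<close>; the offsets 2 and \<open>n - 1\<close> are the first and the last point left
  over by the initial pair \<open>{0, 1}\<close>.\<close>

definition block_mismatch :: "nat \<Rightarrow> nat \<Rightarrow> (nat \<Rightarrow> nat) \<Rightarrow> nat \<Rightarrow> nat \<Rightarrow> nat" where
  "block_mismatch n m col i a =
     card {x. x < 2 * m - 2 * a \<and> col (2 + 2 * m * i + 2 * a + x) \<noteq> col (n - 1 - 2 * m * i - x)}"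

text \<open>
  Averaging over the shift: every point on one side of the block meets a constant fraction of the
  points on the other side, at most \<open>w\<close> of which share its colour.
\<close>

lemma card_good_shifts:
  assumes w: "w > 0" and m: "m = 4 * w" and cls: "\<And>c. card {v \<in> {..<n}. col v = c} \<le> w"
    and i: "2 + 2 * m * i + 2 * m \<le> n"
  shows "m + 1 \<le> 8 * card {a. a \<le> m \<and> w \<le> block_mismatch n m col i a}"
proof -
  let ?u = "\<lambda>a x. 2 + 2 * m * i + 2 * a + x" and ?v = "\<lambda>x. n - 1 - 2 * m * i - x"
  let ?g = "card {a. a \<le> m \<and> w \<le> block_mismatch n m col i a}"
  define same where "same a = card {x. x < 2 * m - 2 * a \<and> col (?u a x) = col (?v x)}" for a
  have split: "block_mismatch n m col i a + same a = 2 * m - 2 * a" for a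
  proof -
    let ?D = "{x. x < 2 * m - 2 * a \<and> col (?u a x) \<noteq> col (?v x)}"
    let ?E = "{x. x < 2 * m - 2 * a \<and> col (?u a x) = col (?v x)}"
    have "card {..<2 * m - 2 * a} = card (?D \<union> ?E)" by (rule arg_cong[where f = card]) blast
    also have "\<dots> = card ?D + card ?E" by (rule card_Un_disjoint) auto
    finally show ?thesis unfolding block_mismatch_def same_def by simp
  qed
  \<comment> \<open>Double counting: for a fixed right point, different shifts give different left
    partners, of which at most \<open>w\<close> have its colour.\<close>
  have "(\<Sum>a\<le>m. same a) = card (SIGMA a:{..m}. {x. x < 2 * m - 2 * a \<and> col (?u a x) = col (?v x)})"
    unfolding same_def by (subst card_SigmaI) auto
  also have "\<dots> \<le> card (SIGMA x:{..<2 * m}. {u \<in> {..<n}. col u = col (?v x)})"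
  proof (rule card_inj_on_le[where f = "\<lambda>(a, x). (x, ?u a x)"])
    show "inj_on (\<lambda>(a, x). (x, ?u a x)) (SIGMA a:{..m}. {x. x < 2 * m - 2 * a \<and> col (?u a x) = col (?v x)})"
      by (auto intro!: inj_onI)
    show "(\<lambda>(a, x). (x, ?u a x)) ` (SIGMA a:{..m}. {x. x < 2 * m - 2 * a \<and> col (?u a x) = col (?v x)})
        \<subseteq> (SIGMA x:{..<2 * m}. {u \<in> {..<n}. col u = col (?v x)})"
      using i by auto
  qed auto
  also have "\<dots> = (\<Sum>x<2 * m. card {u \<in> {..<n}. col u = col (?v x)})"
    by (rule card_SigmaI) auto
  also have "\<dots> \<le> (\<Sum>x<2 * m. w)" by (intro sum_mono cls)
  finally have same: "(\<Sum>a\<le>m. same a) \<le> 2 * m * w" by simp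
  have total: "(\<Sum>a\<le>m. 2 * m - 2 * a) = m * (m + 1)"
  proof -
    have "(\<Sum>a\<le>m. 2 * m - 2 * a) = (\<Sum>a\<le>m. 2 * a)"
      using sum.atLeastAtMost_rev[of "\<lambda>a. 2 * a" 0 m] by (simp add: atMost_atLeast0 diff_mult_distrib2)
    also have "\<dots> = m * (m + 1)" by (induction m) auto
    finally show ?thesis .
  qed
  have "(\<Sum>a\<le>m. block_mismatch n m col i a) + (\<Sum>a\<le>m. same a) = m * (m + 1)"
    using total by (simp add: split flip: sum.distrib)
  then have lower: "m * (m + 1) \<le> (\<Sum>a\<le>m. block_mismatch n m col i a) + 2 * m * w"
    using same by linarith
  \<comment> \<open>A good shift contributes at most \<open>2 * m\<close> mismatches, a bad one
    fewer than \<open>w\<close>. With \<open>m = 4 * w\<close> the lower bound on the total leaves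
    at least an eighth of the shifts good.\<close>
  have "(\<Sum>a\<le>m. block_mismatch n m col i a)
      \<le> (\<Sum>a\<le>m. of_bool (w \<le> block_mismatch n m col i a) * (2 * m) + w)"
  proof (rule sum_mono)
    fix a
    show "block_mismatch n m col i a \<le> of_bool (w \<le> block_mismatch n m col i a) * (2 * m) + w"
      using split[of a] by (cases "w \<le> block_mismatch n m col i a") auto
  qed
  also have "\<dots> = ?g * (2 * m) + (m + 1) * w"
    by (simp add: sum.distrib Int_def flip: sum_distrib_right)
  finally have bound: "m * (m + 1) \<le> ?g * (2 * m) + (m + 1) * w + 2 * m * w" using lower by linarith
  define g where "g = ?g"
  have "w * (4 * (4 * w + 1)) \<le> w * (8 * g + (4 * w + 1) + 8 * w)"
    using bound[folded g_def] unfolding m by (simp add: algebra_simps)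
  then have "4 * (4 * w + 1) \<le> 8 * g + (4 * w + 1) + 8 * w"
    using w by (simp only: mult_le_cancel1)
  then have "4 * w + 1 \<le> 8 * g" by presburger
  then show ?thesis by (simp only: g_def m)
qed

text \<open>The exponential moment of the number of good blocks factors over the independent shifts.\<close>

lemma sum_half_power_good_le:
  assumes g: "\<And>i. i < N \<Longrightarrow> m + 1 \<le> 8 * card {a. a \<le> m \<and> good i a}"
  shows "(\<Sum>f\<in>PiE {..<N} (\<lambda>_. {..m}). (1 / 2 :: real) ^ card {i. i < N \<and> good i (f i)})
     \<le> (15 / 16 * (real m + 1)) ^ N"
proof -
  have half: "(\<Prod>i<N. if Q i then 1 / 2 else 1 :: real) = (1 / 2) ^ card {i. i < N \<and> Q i}" for Q
    by (simp add: prod.If_cases Int_def)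
  have "(\<Sum>f\<in>PiE {..<N} (\<lambda>_. {..m}). (1 / 2 :: real) ^ card {i. i < N \<and> good i (f i)})
      = (\<Sum>f\<in>PiE {..<N} (\<lambda>_. {..m}). \<Prod>i<N. if good i (f i) then 1 / 2 else 1)"
    by (simp only: half)
  also have "\<dots> = (\<Prod>i<N. \<Sum>a\<le>m. if good i a then 1 / 2 else 1)"
    by (subst prod_sum_PiE) auto
  \<comment> \<open>At least an eighth of the shifts is good and weighs one half, so the average
    weight is at most \<open>1 - 1 / 16\<close>.\<close>
  also have "\<dots> \<le> (\<Prod>i<N. 15 / 16 * (real m + 1))"
  proof (rule prod_mono, intro conjI)
    fix i assume "i \<in> {..<N}"
    then have g': "m + 1 \<le> 8 * card {a. a \<le> m \<and> good i a}" using g by simp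
    have "(\<Sum>a\<le>m. if good i a then 1 / 2 else 1 :: real) = (\<Sum>a\<le>m. 1 - 1 / 2 * of_bool (good i a))"
      by (intro sum.cong) auto
    also have "\<dots> = real (m + 1) - 1 / 2 * real (card {a. a \<le> m \<and> good i a})"
      by (simp add: sum_subtractf Int_def flip: sum_distrib_left sum_divide_distrib)
    also have "\<dots> \<le> 15 / 16 * (real m + 1)"
      using of_nat_mono[OF g', where 'a = real] by simp
    finally show "(\<Sum>a\<le>m. if good i a then 1 / 2 else 1 :: real) \<le> 15 / 16 * (real m + 1)" .
    show "0 \<le> (\<Sum>a\<le>m. if good i a then 1 / 2 else 1 :: real)" by (intro sum_nonneg) auto
  qed
  finally show ?thesis by simp
qed

text \<open>The shifts prescribe only the pairs made by the cross steps; any arc pairing that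
  contains these will do.\<close>

definition block_pairing :: "nat \<Rightarrow> nat \<Rightarrow> nat \<Rightarrow> (nat \<Rightarrow> nat) \<Rightarrow> pairing" where
  "block_pairing n m N f = (SOME P. P \<in> arc_pairings n \<and> (\<forall>i<N. \<forall>x<2 * m - 2 * f i.
     {2 + 2 * m * i + 2 * f i + x, n - 1 - 2 * m * i - x} \<in> P))"

lemma block_pairing:
  assumes n: "even n" "2 + 4 * m * N \<le> n" and f: "\<And>i. i < N \<Longrightarrow> f i \<le> m"
  shows "block_pairing n m N f \<in> arc_pairings n"
    and "i < N \<Longrightarrow> x < 2 * m - 2 * f i \<Longrightarrow>
      {2 + 2 * m * i + 2 * f i + x, n - 1 - 2 * m * i - x} \<in> block_pairing n m N f"
proof -
  define k where "k = n div 2 - 1 - 2 * m * N"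
  have k: "n div 2 - 1 = k + 2 * m * N" "2 + 2 * (k + 2 * m * N) = n"
    using n by (auto simp: k_def elim!: evenE)
  obtain Q where Q: "Q \<in> arc_matchings (k + 2 * m * N) 2" "\<forall>i<N. \<forall>x<2 * m - 2 * f i.
     {2 + 2 * m * i + 2 * f i + x, 2 + 2 * (k + 2 * m * N) - 1 - 2 * m * i - x} \<in> Q"
    using arc_matchings_blocks[of N f m k 2, OF f] by blast
  have "insert {0, 1} Q \<in> arc_pairings n"
    using Q(1) n k by (simp add: arc_pairings_eq)
  moreover have "\<forall>i<N. \<forall>x<2 * m - 2 * f i.
     {2 + 2 * m * i + 2 * f i + x, n - 1 - 2 * m * i - x} \<in> insert {0, 1} Q"
    using Q(2) unfolding k(2) by blast
  ultimately have "\<exists>P. P \<in> arc_pairings n \<and> (\<forall>i<N. \<forall>x<2 * m - 2 * f i.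
     {2 + 2 * m * i + 2 * f i + x, n - 1 - 2 * m * i - x} \<in> P)" by blast
  from someI_ex[OF this, folded block_pairing_def]
  show "block_pairing n m N f \<in> arc_pairings n"
    "i < N \<Longrightarrow> x < 2 * m - 2 * f i \<Longrightarrow>
      {2 + 2 * m * i + 2 * f i + x, n - 1 - 2 * m * i - x} \<in> block_pairing n m N f" by blast+
qed

lemma bichromatic_block_pairing_ge:
  assumes n: "even n" "2 + 4 * m * N \<le> n" and f: "\<And>i. i < N \<Longrightarrow> f i \<le> m"
  shows "w * card {i. i < N \<and> w \<le> block_mismatch n m col i (f i)}
    \<le> card {p \<in> block_pairing n m N f. \<exists>a\<in>p. \<exists>b\<in>p. col a \<noteq> col b}"
proof -
  let ?u = "\<lambda>i x. 2 + 2 * m * i + 2 * f i + x" and ?v = "\<lambda>i x. n - 1 - 2 * m * i - x"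
  let ?B = "{p \<in> block_pairing n m N f. \<exists>a\<in>p. \<exists>b\<in>p. col a \<noteq> col b}"
  let ?I = "{i. i < N \<and> w \<le> block_mismatch n m col i (f i)}"
  let ?S = "SIGMA i:?I. {x. x < 2 * m - 2 * f i \<and> col (?u i x) \<noteq> col (?v i x)}"
  have "pairs_up (block_pairing n m N f) {..<n}"
    using block_pairing(1)[OF n f] pairs_up_arc_pairings n by simp
  then have finB: "finite ?B" by (simp add: pairs_up_def)
  \<comment> \<open>All left points lie in the lower half of the indices and all right points in the
    upper half, so a pair determines which of its elements is which.\<close>
  have arith: "2 * (2 + A + 2 * d + x) \<le> n \<and> n < 2 * V \<and> A + x < n - 1"
    if "A + 2 * m \<le> B" "x + 2 * d < 2 * m" "V + (A + x + 1) = n" "2 + 2 * B \<le> n" for A B d x V :: nat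
    using that by (intro conjI; simp)
  have bounds: "2 * ?u i x \<le> n \<and> n < 2 * ?v i x \<and> 2 * m * i + x < n - 1" if "i < N" "x < 2 * m - 2 * f i" for i x
  proof -
    have "2 * m * (i + 1) \<le> 2 * m * N" using that(1) by (intro mult_le_mono2) simp
    then have "2 * m * i + 2 * m \<le> 2 * m * N" by simp
    moreover have "x + 2 * f i < 2 * m" using that(2) by simp
    moreover from calculation have "?v i x + (2 * m * i + x + 1) = n" using n(2) by simp
    moreover have "2 + 2 * (2 * m * N) \<le> n" using n(2) by simp
    ultimately show ?thesis by (rule arith)
  qed
  have "w * card ?I = (\<Sum>i\<in>?I. w)" by simp
  also have "\<dots> \<le> (\<Sum>i\<in>?I. block_mismatch n m col i (f i))" by (intro sum_mono) auto
  also have "\<dots> = card ?S" unfolding block_mismatch_def by (subst card_SigmaI) auto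
  also have "\<dots> \<le> card ?B"
  proof (rule card_inj_on_le[OF _ _ finB])
    show "(\<lambda>(i, x). {?u i x, ?v i x}) ` ?S \<subseteq> ?B"
      using block_pairing(2)[OF n f] by auto
    show "inj_on (\<lambda>(i, x). {?u i x, ?v i x}) ?S"
    proof (rule inj_onI, clarify)
      fix i x j y
      assume i: "i < N" "x < 2 * m - 2 * f i" and j: "j < N" "y < 2 * m - 2 * f j"
        and e: "{?u i x, ?v i x} = {?u j y, ?v j y}"
      have b: "?v i x \<noteq> ?u j y" using bounds[OF i] bounds[OF j] by (metis not_le)
      have "?v i x = ?v j y" using e b by (metis doubleton_eq_iff)
      \<comment> \<open>The right point yields \<open>2 * m * i + x\<close>; as
        \<open>x < 2 * m\<close>, division by \<open>2 * m\<close> recovers the block.\<close>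
      then have q: "2 * m * i + x = 2 * m * j + y" using bounds[OF i] bounds[OF j] by linarith
      have "x < 2 * m" "y < 2 * m" using i j by auto
      then have "(2 * m * i + x) div (2 * m) = i" "(2 * m * j + y) div (2 * m) = j" by auto
      then have "i = j" using q by metis
      then show "i = j \<and> x = y" using q by simp
    qed
  qed
  finally show ?thesis .
qed

text \<open>With \<open>G\<close> good blocks there are at least \<open>w * G\<close> bichromatic
  pairs. Colours with few fresh pairs account for at most \<open>K * (4 * t^2) \<le> J * w\<close>
  of them, so at least \<open>G - J\<close> colours are rich, and each rich colour halves the number
  of bad splits. Summing \<open>2 ^ J * (1 / 2) ^ G\<close> over the shifts is the moment
  bound.\<close>

lemma sum_small_imbalance_le:
  assumes n: "even n" "2 + 4 * m * N \<le> n" and w: "w > 0" "m = 4 * w"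
    and col: "\<And>v. v < n \<Longrightarrow> col v < K" and cls: "\<And>c. card {v \<in> {..<n}. col v = c} \<le> w"
    and J: "K * (4 * t\<^sup>2) \<le> J * w"
  shows "(\<Sum>f\<in>PiE {..<N} (\<lambda>_. {..m}). real (card {X. X \<subseteq> block_pairing n m N f \<and>
       (\<forall>c<K. \<bar>imbalance (block_pairing n m N f) X {v. col v \<le> c}\<bar> < int t)}))
     \<le> 2 ^ (n div 2) * 2 ^ J * (15 / 16) ^ N * (real m + 1) ^ N"
proof -
  let ?\<Omega> = "PiE {..<N} (\<lambda>_. {..m})"
  let ?G = "\<lambda>f. card {i. i < N \<and> w \<le> block_mismatch n m col i (f i)}"
  let ?bad = "\<lambda>f. {X. X \<subseteq> block_pairing n m N f \<and>
       (\<forall>c<K. \<bar>imbalance (block_pairing n m N f) X {v. col v \<le> c}\<bar> < int t)}"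
  have "real (card (?bad f)) \<le> 2 ^ (n div 2) * 2 ^ J * (1 / 2) ^ ?G f" if f: "f \<in> ?\<Omega>" for f
  proof -
    let ?P = "block_pairing n m N f"
    let ?r = "card {c. c < K \<and> 4 * t\<^sup>2 \<le> card (fresh_pairs col ?P c)}"
    have fm: "\<And>i. i < N \<Longrightarrow> f i \<le> m" using f by (auto simp: PiE_def)
    have pu: "pairs_up ?P {..<n}"
      using block_pairing(1)[OF n fm] pairs_up_arc_pairings n by simp
    have cP: "card ?P = n div 2" using card_pairs_up[OF pu] by simp
    have "w * ?G f \<le> ?r * w + K * (4 * t\<^sup>2)"
      using bichromatic_block_pairing_ge[OF n fm, where w = w and col = col]
        card_bichromatic_le[OF pu, where col = col and K = K and w = w and d = "4 * t\<^sup>2"] col cls by fastforce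
    then have "w * ?G f \<le> w * (?r + J)" using J by (simp add: algebra_simps)
    then have G: "?G f \<le> ?r + J" using w by simp
    have "real (card (?bad f)) * 2 ^ ?r \<le> 2 ^ (n div 2)"
      using of_nat_mono[OF card_small_imbalance[OF pu, where col = col and K = K and t = t], where 'a = real] by (simp add: cP)
    then have "real (card (?bad f)) * 2 ^ ?r * 2 ^ J \<le> 2 ^ (n div 2) * 2 ^ J"
      by (intro mult_right_mono) auto
    moreover have "real (card (?bad f)) * 2 ^ ?G f \<le> real (card (?bad f)) * 2 ^ ?r * 2 ^ J"
      unfolding mult.assoc power_add[symmetric] using G by (intro mult_left_mono power_increasing) auto
    ultimately have "real (card (?bad f)) * 2 ^ ?G f \<le> 2 ^ (n div 2) * 2 ^ J" by linarith
    then show ?thesis by (simp add: power_one_over field_simps)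
  qed
  then have "(\<Sum>f\<in>?\<Omega>. real (card (?bad f))) \<le> (\<Sum>f\<in>?\<Omega>. 2 ^ (n div 2) * 2 ^ J * (1 / 2) ^ ?G f)"
    by (rule sum_mono)
  also have "\<dots> = 2 ^ (n div 2) * 2 ^ J * (\<Sum>f\<in>?\<Omega>. (1 / 2) ^ ?G f)"
    by (simp only: sum_distrib_left)
  also have "\<dots> \<le> 2 ^ (n div 2) * 2 ^ J * (15 / 16 * (real m + 1)) ^ N"
  proof (intro mult_left_mono sum_half_power_good_le)
    fix i assume "i < N"
    then have "4 * m * (i + 1) \<le> 4 * m * N" by (intro mult_le_mono2) simp
    then have "2 + 2 * m * i + 2 * m \<le> n" using n(2) by (simp add: algebra_simps)
    with card_good_shifts[OF w cls] show "m + 1 \<le> 8 * card {a. a \<le> m \<and> w \<le> block_mismatch n m col i a}" .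
  qed auto
  finally show ?thesis by (simp only: power_mult_distrib mult.assoc)
qed

text \<open>Union bound over shifts and splits: of all \<open>(m + 1) ^ N * 2 ^ (n div 2)\<close>
  combinations, each order spoils at most a fraction \<open>2 ^ J * (15 / 16) ^ N\<close>, so
  \<open>s\<close> orders cannot spoil all of them.\<close>

lemma exists_imbalanced_orientation:
  assumes n: "even n" "2 + 4 * m * N \<le> n" and w: "w > 0" "m = 4 * w"
    and col: "\<And>j v. j < s \<Longrightarrow> v < n \<Longrightarrow> col j v < K"
    and cls: "\<And>j c. j < s \<Longrightarrow> card {v \<in> {..<n}. col j v = c} \<le> w"
    and J: "K * (4 * t\<^sup>2) \<le> J * w"
    and s: "real s * 2 ^ J * (15 / 16) ^ N < 1"
  shows "\<exists>P\<in>arc_pairings n. \<exists>X\<subseteq>P. \<forall>j<s. \<exists>c<K. int t \<le> \<bar>imbalance P X {v. col j v \<le> c}\<bar>"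
proof (rule ccontr)
  assume none: "\<not> ?thesis"
  have none': "\<exists>j<s. \<forall>c<K. \<not> int t \<le> \<bar>imbalance P X {v. col j v \<le> c}\<bar>"
    if "P \<in> arc_pairings n" "X \<subseteq> P" for P X
  proof (rule ccontr)
    assume "\<not> ?thesis"
    then have "\<forall>j<s. \<exists>c<K. int t \<le> \<bar>imbalance P X {v. col j v \<le> c}\<bar>" by simp
    with that(2) have "\<exists>X\<subseteq>P. \<forall>j<s. \<exists>c<K. int t \<le> \<bar>imbalance P X {v. col j v \<le> c}\<bar>"
      by (intro exI[of _ X] conjI)
    then show False using none that(1) by (elim notE) (rule bexI)
  qed
  let ?\<Omega> = "PiE {..<N} (\<lambda>_. {..m})"
  let ?P = "block_pairing n m N"
  let ?bad = "\<lambda>j f. {X. X \<subseteq> ?P f \<and> (\<forall>c<K. \<bar>imbalance (?P f) X {v. col j v \<le> c}\<bar> < int t)}"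
  have fin\<Omega>: "finite ?\<Omega>" by (intro finite_PiE) auto
  have "2 ^ (n div 2) \<le> (\<Sum>j<s. card (?bad j f))" if f: "f \<in> ?\<Omega>" for f
  proof -
    have fm: "\<And>i. i < N \<Longrightarrow> f i \<le> m" using f by (auto simp: PiE_def)
    have P: "?P f \<in> arc_pairings n" by (rule block_pairing(1)[OF n fm])
    then have pu: "pairs_up (?P f) {..<n}" using pairs_up_arc_pairings n by simp
    then have fin: "finite (?P f)" and cP: "card (?P f) = n div 2"
      using card_pairs_up[OF pu] by (simp_all add: pairs_up_def)
    have "Pow (?P f) \<subseteq> (\<Union>j<s. ?bad j f)"
    proof
      fix X assume "X \<in> Pow (?P f)"
      then have "\<exists>j<s. \<forall>c<K. \<not> int t \<le> \<bar>imbalance (?P f) X {v. col j v \<le> c}\<bar>"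
        using none'[OF P, of X] by simp
      then obtain j where "j < s" "\<forall>c<K. \<not> int t \<le> \<bar>imbalance (?P f) X {v. col j v \<le> c}\<bar>"
        by blast
      then show "X \<in> (\<Union>j<s. ?bad j f)" using \<open>X \<in> Pow (?P f)\<close> by (auto simp: not_le)
    qed
    then have "card (Pow (?P f)) \<le> card (\<Union>j<s. ?bad j f)"
      using fin by (intro card_mono) auto
    also have "\<dots> \<le> (\<Sum>j<s. card (?bad j f))" by (rule card_UN_le) simp
    finally show ?thesis using fin by (simp add: card_Pow cP)
  qed
  then have "(\<Sum>f\<in>?\<Omega>. 2 ^ (n div 2)) \<le> (\<Sum>f\<in>?\<Omega>. \<Sum>j<s. card (?bad j f))" by (rule sum_mono)
  then have "card ?\<Omega> * 2 ^ (n div 2) \<le> (\<Sum>j<s. \<Sum>f\<in>?\<Omega>. card (?bad j f))"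
    by (subst sum.swap) simp
  from of_nat_mono[OF this, where 'a = real]
  have "real (card ?\<Omega>) * 2 ^ (n div 2) \<le> (\<Sum>j<s. \<Sum>f\<in>?\<Omega>. real (card (?bad j f)))"
    by (simp only: of_nat_mult of_nat_power of_nat_numeral of_nat_sum)
  moreover have "real (card ?\<Omega>) = (real m + 1) ^ N" by (simp add: card_PiE add.commute)
  ultimately have "(real m + 1) ^ N * 2 ^ (n div 2) \<le> (\<Sum>j<s. \<Sum>f\<in>?\<Omega>. real (card (?bad j f)))"
    by (simp only:)
  also have "\<dots> \<le> (\<Sum>j<s. 2 ^ (n div 2) * 2 ^ J * (15 / 16) ^ N * (real m + 1) ^ N)"
    using col cls by (intro sum_mono sum_small_imbalance_le[OF n w _ _ J]) auto
  also have "\<dots> = (real s * 2 ^ J * (15 / 16) ^ N) * ((real m + 1) ^ N * 2 ^ (n div 2))" by simp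
  also have "\<dots> < 1 * ((real m + 1) ^ N * 2 ^ (n div 2))"
    using s by (intro mult_strict_right_mono) auto
  finally show False by simp
qed

section \<open>Cutting a branching program at a layer\<close>

definition paths_between :: "(nat \<times> nat) set \<Rightarrow> nat \<Rightarrow> nat \<Rightarrow> nat list set" where
  "paths_between E u v =
     {p. p \<noteq> [] \<and> hd p = u \<and> last p = v \<and> successively (\<lambda>a b. (a, b) \<in> E) p}"

lemma abp_paths_eq: "abp_paths A = paths_between (edges A) (src A) (snk A)"
  by (simp add: abp_paths_def paths_between_def)

lemma layer_nth_path:
  assumes layered: "\<And>a b. (a, b) \<in> E \<Longrightarrow> lay b = Suc (lay a)"
    and p: "successively (\<lambda>a b. (a, b) \<in> E) p" and i: "i < length p"
  shows "lay (p ! i) = lay (hd p) + i"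
  using i
proof (induction i)
  case 0
  then show ?case by (simp add: hd_conv_nth)
next
  case (Suc i)
  then have "(p ! i, p ! Suc i) \<in> E"
    using p by (simp add: successively_conv_nth)
  then show ?case using layered Suc by fastforce
qed

lemma length_path_between:
  assumes layered: "\<And>a b. (a, b) \<in> E \<Longrightarrow> lay b = Suc (lay a)"
    and p: "p \<in> paths_between E u v"
  shows "lay v + 1 = lay u + length p"
proof -
  have "lay (p ! (length p - 1)) = lay (hd p) + (length p - 1)"
    using p by (intro layer_nth_path[where lay = lay, OF layered]) (auto simp: paths_between_def)
  moreover have "p ! (length p - 1) = v" "hd p = u" "length p > 0"
    using p by (auto simp: paths_between_def last_conv_nth)
  ultimately show ?thesis by simp
qed

lemma finite_paths_between:
  assumes layered: "\<And>a b. (a, b) \<in> E \<Longrightarrow> lay b = Suc (lay a)"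
    and fin: "finite N" and E: "E \<subseteq> N \<times> N"
  shows "finite (paths_between E u v)"
proof (rule finite_subset)
  show "paths_between E u v \<subseteq> {p. set p \<subseteq> insert u N \<and> length p = lay v + 1 - lay u}"
  proof
    fix p assume p: "p \<in> paths_between E u v"
    have "p ! i \<in> insert u N" if "i < length p" for i
    proof (cases i)
      case 0
      then show ?thesis using p by (auto simp: paths_between_def hd_conv_nth)
    next
      case (Suc j)
      then have "(p ! j, p ! i) \<in> E"
        using p that by (auto simp: paths_between_def successively_conv_nth)
      then show ?thesis using E by auto
    qed
    then have "set p \<subseteq> insert u N" by (metis in_set_conv_nth subsetI)
    then show "p \<in> {p. set p \<subseteq> insert u N \<and> length p = lay v + 1 - lay u}"
      using length_path_between[where lay = lay, OF layered p] by auto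
  qed
  show "finite {p. set p \<subseteq> insert u N \<and> length p = lay v + 1 - lay u}"
    using fin by (intro finite_lists_length_eq) simp
qed

text \<open>Since each edge climbs one layer, a path meets layer \<open>l\<close> exactly once. The
  cut node belongs to both halves, hence the \<open>tl\<close>.\<close>

lemma paths_between_cut:
  assumes layered: "\<And>a b. (a, b) \<in> E \<Longrightarrow> lay b = Suc (lay a)"
    and E: "E \<subseteq> N \<times> N" and u: "u \<in> N" and l: "lay u \<le> l" "l \<le> lay w"
  shows "bij_betw (\<lambda>(v, p, q). p @ tl q)
    (SIGMA v:{v \<in> N. lay v = l}. paths_between E u v \<times> paths_between E v w) (paths_between E u w)"
proof -
  let ?T = "\<lambda>p. (p ! (l - lay u), take (Suc (l - lay u)) p, drop (l - lay u) p)"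
  show ?thesis
  proof (rule bij_betwI[where g = ?T])
    show "(\<lambda>(v, p, q). p @ tl q) \<in>
        (SIGMA v:{v \<in> N. lay v = l}. paths_between E u v \<times> paths_between E v w) \<rightarrow> paths_between E u w"
    proof clarsimp
      fix v p q
      assume p: "p \<in> paths_between E u v" and q: "q \<in> paths_between E v w"
      obtain q' where "q = v # q'"
        using q by (cases q) (auto simp: paths_between_def)
      then show "p @ tl q \<in> paths_between E u w"
        using p q by (auto simp: paths_between_def successively_append_iff successively_Cons)
    qed
    show "?T \<in> paths_between E u w \<rightarrow>
        (SIGMA v:{v \<in> N. lay v = l}. paths_between E u v \<times> paths_between E v w)"
    proof
      fix p assume p: "p \<in> paths_between E u w"
      define i where "i = l - lay u"
      have len: "i < length p" using length_path_between[where lay = lay, OF layered p] l by (simp add: i_def)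
      have s: "successively (\<lambda>a b. (a, b) \<in> E) p" and hd: "hd p = u" and ne: "p \<noteq> []" and last: "last p = w"
        using p by (auto simp: paths_between_def)
      have lay: "lay (p ! i) = l"
        using layer_nth_path[where lay = lay, OF layered s len] hd l by (simp add: i_def)
      have "p ! i \<in> N"
      proof (cases i)
        case 0
        then show ?thesis using hd ne u by (simp add: hd_conv_nth)
      next
        case (Suc j)
        then have "(p ! j, p ! i) \<in> E" using s len by (simp add: successively_conv_nth)
        then show ?thesis using E by auto
      qed
      moreover have "last (take (Suc i) p) = p ! i"
        using len by (simp add: take_Suc_conv_app_nth)
      then have "take (Suc i) p \<in> paths_between E u (p ! i)"
        using s hd ne len by (auto simp: paths_between_def successively_conv_nth)
      moreover have "drop i p \<in> paths_between E (p ! i) w"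
        using s ne len last
        by (auto simp: paths_between_def successively_conv_nth hd_drop_conv_nth)
      ultimately show "?T p \<in> (SIGMA v:{v \<in> N. lay v = l}. paths_between E u v \<times> paths_between E v w)"
        using lay unfolding i_def[symmetric] by simp
    qed
    show "?T ((\<lambda>(v, p, q). p @ tl q) x) = x"
      if elem: "x \<in> (SIGMA v:{v \<in> N. lay v = l}. paths_between E u v \<times> paths_between E v w)" for x
    proof -
      obtain v p q where x: "x = (v, p, q)" "lay v = l" "p \<in> paths_between E u v" "q \<in> paths_between E v w"
        using elem by auto
      obtain q' where q: "q = v # q'"
        using x by (cases q) (auto simp: paths_between_def)
      have len: "length p = Suc (l - lay u)"
        using length_path_between[where lay = lay, OF layered x(3)] x(2) l by simp
      have ne: "p \<noteq> []" and last: "last p = v" using x by (auto simp: paths_between_def)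
      have pn: "p ! (l - lay u) = v" using last len ne by (simp add: last_conv_nth)
      have "drop (l - lay u) p = [v]"
        using len pn by (metis Cons_nth_drop_Suc drop_all lessI order_refl)
      then show ?thesis using x q len pn by (simp add: nth_append)
    qed
    show "(\<lambda>(v, p, q). p @ tl q) (?T p) = p" if "p \<in> paths_between E u w" for p
      by (simp add: tl_drop drop_Suc[symmetric])
  qed
qed

section \<open>Coefficients of multilinear monomials along paths\<close>

definition set_mono :: "nat set \<Rightarrow> nat \<Rightarrow>\<^sub>0 nat" where
  "set_mono S = (\<Sum>i\<in>S. Poly_Mapping.single i 1)"

lemma lookup_set_mono: "finite S \<Longrightarrow> Poly_Mapping.lookup (set_mono S) i = of_bool (i \<in> S)"
  by (simp add: set_mono_def lookup_sum lookup_single when_def sum.delta' if_distrib cong: if_cong)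

definition label_mono :: "'c label list \<Rightarrow> nat \<Rightarrow>\<^sub>0 nat" where
  "label_mono ls = (\<Sum>l\<leftarrow>ls. case l of Var i \<Rightarrow> Poly_Mapping.single i 1 | Const c \<Rightarrow> 0)"

definition label_const :: "'c::comm_semiring_1 label list \<Rightarrow> 'c" where
  "label_const ls = (\<Prod>l\<leftarrow>ls. case l of Var i \<Rightarrow> 1 | Const c \<Rightarrow> c)"

lemma label_mono_append: "label_mono (xs @ ys) = label_mono xs + label_mono ys"
  by (simp add: label_mono_def)

lemma label_const_append: "label_const (xs @ ys) = label_const xs * label_const ys"
  by (simp add: label_const_def)

lemma prod_list_label_poly:
  "prod_list (map label_poly ls) = Poly_Mapping.single (label_mono ls) (label_const ls)"
proof (induction ls)
  case Nil
  then show ?case by (simp add: label_mono_def label_const_def)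
next
  case (Cons l ls)
  then show ?case
    by (cases l) (simp_all add: label_mono_def label_const_def mvar_def mconst_def mult_single)
qed

lemma lookup_label_mono_nonzero:
  "Poly_Mapping.lookup (label_mono ls) i \<noteq> 0 \<Longrightarrow> Var i \<in> set ls"
  by (induction ls)
     (auto simp: label_mono_def lookup_add lookup_single when_def split: label.splits if_splits)

lemma path_labels_append:
  "p \<noteq> [] \<Longrightarrow> last p = v \<Longrightarrow> path_labels A (p @ q) = path_labels A p @ path_labels A (v # q)"
proof (induction p)
  case (Cons a p)
  then show ?case by (cases p) (auto simp: path_labels_def)
qed simp

lemma in_set_path_labels:
  assumes layered: "\<And>a b. (a, b) \<in> edges A \<Longrightarrow> lay b = Suc (lay a)"
    and p: "p \<in> paths_between (edges A) u w" and l: "l \<in> set (path_labels A p)"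
  shows "\<exists>(a, b)\<in>edges A. lab A (a, b) = l \<and> lay u \<le> lay a \<and> lay a < lay w"
proof -
  obtain i where i: "i < length p - 1" "l = lab A (p ! i, p ! Suc i)"
    using l by (auto simp: path_labels_def in_set_conv_nth nth_tl)
  have s: "successively (\<lambda>a b. (a, b) \<in> edges A) p" and hd: "hd p = u"
    using p by (auto simp: paths_between_def)
  have "(p ! i, p ! Suc i) \<in> edges A" using s i by (simp add: successively_conv_nth)
  moreover have "lay (p ! i) = lay u + i"
    using layer_nth_path[where lay = lay, OF layered s] i hd by simp
  moreover have "lay w + 1 = lay u + length p" by (rule length_path_between[where lay = lay, OF layered p])
  ultimately show ?thesis using i by (intro bexI[of _ "(p ! i, p ! Suc i)"]) auto
qed

lemma lookup_abp_poly:
  assumes "finite (abp_paths A)"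
  shows "Poly_Mapping.lookup (abp_poly A) m
    = (\<Sum>p\<in>abp_paths A. label_const (path_labels A p) when label_mono (path_labels A p) = m)"
  by (simp add: abp_poly_def prod_list_label_poly lookup_sum lookup_single)

text \<open>The half of a path below the cut reads only variables in \<open>C\<close>, the half
  above only variables in \<open>D\<close>. So the path produces the monomial of \<open>S\<close>
  iff its halves produce those of \<open>S \<inter> C\<close> and \<open>S \<inter> D\<close>, and
  the constants multiply.\<close>

lemma abp_coeff_cut:
  fixes A :: "'c::comm_semiring_1 abp"
  assumes abp: "is_abp K n A" and l: "l \<le> layer A (snk A)" and disj: "C \<inter> D = {}"
    and below: "\<And>u v i. (u, v) \<in> edges A \<Longrightarrow> lab A (u, v) = Var i \<Longrightarrow> layer A u < l \<Longrightarrow> i \<in> C"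
    and above: "\<And>u v i. (u, v) \<in> edges A \<Longrightarrow> lab A (u, v) = Var i \<Longrightarrow> l \<le> layer A u \<Longrightarrow> i \<in> D"
  shows "\<exists>g h :: nat \<Rightarrow> nat set \<Rightarrow> 'c. \<forall>S. finite S \<longrightarrow> S \<subseteq> C \<union> D \<longrightarrow>
    Poly_Mapping.lookup (abp_poly A) (set_mono S)
      = (\<Sum>v\<in>{v \<in> nodes A. layer A v = l}. g v (S \<inter> C) * h v (S \<inter> D))"
proof -
  let ?E = "edges A" and ?s = "src A" and ?t = "snk A"
  have fin: "finite (nodes A)" and E: "?E \<subseteq> nodes A \<times> nodes A" and s: "?s \<in> nodes A" "layer A ?s = 0"
    and layered: "\<And>a b. (a, b) \<in> ?E \<Longrightarrow> layer A b = Suc (layer A a)"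
    using abp by (auto simp: is_abp_def)
  note finp = finite_paths_between[where lay = "layer A", OF layered fin E]
  define wt where "wt T p = (label_const (path_labels A p) when label_mono (path_labels A p) = set_mono T)" for T p
  have split: "wt S (p @ tl q) = wt (S \<inter> C) p * wt (S \<inter> D) q"
    if S: "finite S" "S \<subseteq> C \<union> D" and v: "layer A v = l"
      and p: "p \<in> paths_between ?E ?s v" and q: "q \<in> paths_between ?E v ?t" for S v p q
  proof -
    obtain q' where q': "q = v # q'"
      using q by (cases q) (auto simp: paths_between_def)
    have lab: "path_labels A (p @ tl q) = path_labels A p @ path_labels A q"
      using path_labels_append[of p v A q'] p q' by (simp add: paths_between_def)
    let ?a = "Poly_Mapping.lookup (label_mono (path_labels A p))"
    let ?b = "Poly_Mapping.lookup (label_mono (path_labels A q))"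
    have a0: "?a i = 0" if "i \<notin> C" for i
    proof (rule ccontr)
      assume "?a i \<noteq> 0"
      from lookup_label_mono_nonzero[OF this] in_set_path_labels[where lay = "layer A", OF layered p]
      obtain a b where "(a, b) \<in> ?E" "lab A (a, b) = Var i" "layer A a < l" using v by blast
      with below that show False by blast
    qed
    have b0: "?b i = 0" if "i \<notin> D" for i
    proof (rule ccontr)
      assume "?b i \<noteq> 0"
      from lookup_label_mono_nonzero[OF this] in_set_path_labels[where lay = "layer A", OF layered q]
      obtain a b where "(a, b) \<in> ?E" "lab A (a, b) = Var i" "l \<le> layer A a" using v by blast
      with above that show False by blast
    qed
    \<comment> \<open>The two exponent vectors have disjoint supports, so their sum is prescribed
      iff each of them is.\<close>
    have "(\<forall>i. ?a i + ?b i = of_bool (i \<in> S)) \<longleftrightarrow>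
      (\<forall>i. ?a i = of_bool (i \<in> S \<inter> C)) \<and> (\<forall>i. ?b i = of_bool (i \<in> S \<inter> D))"
      (is "?L = (?R1 \<and> ?R2)")
    proof
      assume L: ?L
      have "?a i = of_bool (i \<in> S \<inter> C)" for i
        using spec[OF L, of i] a0[of i] b0[of i] disj by (cases "i \<in> C"; cases "i \<in> D") auto
      moreover have "?b i = of_bool (i \<in> S \<inter> D)" for i
        using spec[OF L, of i] a0[of i] b0[of i] disj by (cases "i \<in> C"; cases "i \<in> D") auto
      ultimately show "?R1 \<and> ?R2" by blast
    next
      assume R: "?R1 \<and> ?R2"
      have "of_bool (i \<in> S \<inter> C) + of_bool (i \<in> S \<inter> D) = (of_bool (i \<in> S) :: nat)" for i
        using S(2) disj by auto
      then show ?L using R by simp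
    qed
    then have "label_mono (path_labels A p) + label_mono (path_labels A q) = set_mono S \<longleftrightarrow>
        label_mono (path_labels A p) = set_mono (S \<inter> C) \<and> label_mono (path_labels A q) = set_mono (S \<inter> D)"
      using S(1) by (simp add: poly_mapping_eq_iff fun_eq_iff lookup_add lookup_set_mono)
    then show ?thesis
      by (simp add: wt_def lab label_mono_append label_const_append when_def)
  qed
  define g where "g v T = (\<Sum>p\<in>paths_between ?E ?s v. wt T p)" for v T
  define h where "h v T = (\<Sum>q\<in>paths_between ?E v ?t. wt T q)" for v T
  have "Poly_Mapping.lookup (abp_poly A) (set_mono S)
      = (\<Sum>v\<in>{v \<in> nodes A. layer A v = l}. g v (S \<inter> C) * h v (S \<inter> D))"
    if S: "finite S" "S \<subseteq> C \<union> D" for S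
  proof -
    let ?V = "{v \<in> nodes A. layer A v = l}"
    have "Poly_Mapping.lookup (abp_poly A) (set_mono S) = (\<Sum>p\<in>paths_between ?E ?s ?t. wt S p)"
      using lookup_abp_poly[of A] finp by (simp add: abp_paths_eq wt_def)
    also have "\<dots> = (\<Sum>(v, p, q)\<in>(SIGMA v:?V. paths_between ?E ?s v \<times> paths_between ?E v ?t). wt S (p @ tl q))"
      using sum.reindex_bij_betw[OF paths_between_cut[where lay = "layer A", OF layered E s(1), of l ?t], of "wt S"] l s(2)
      by (simp add: case_prod_unfold)
    also have "\<dots> = (\<Sum>(v, p, q)\<in>(SIGMA v:?V. paths_between ?E ?s v \<times> paths_between ?E v ?t).
        wt (S \<inter> C) p * wt (S \<inter> D) q)"
      by (intro sum.cong refl) (auto simp: split[OF S])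
    also have "\<dots> = (\<Sum>v\<in>?V. \<Sum>(p, q)\<in>paths_between ?E ?s v \<times> paths_between ?E v ?t.
        wt (S \<inter> C) p * wt (S \<inter> D) q)"
      using fin finp by (subst sum.Sigma[symmetric]) (auto simp: case_prod_unfold)
    also have "\<dots> = (\<Sum>v\<in>?V. g v (S \<inter> C) * h v (S \<inter> D))"
      by (simp add: g_def h_def sum_product sum.cartesian_product)
    finally show ?thesis .
  qed
  then show ?thesis by blast
qed

section \<open>The variable order of a ROABP\<close>

lemma exists_sorting_bijection:
  fixes key :: "nat \<Rightarrow> nat"
  shows "\<exists>pos. bij_betw pos {..<n} {..<n} \<and> (\<forall>i<n. \<forall>j<n. pos j < pos i \<longrightarrow> key j \<le> key i)"
proof -
  define xs where "xs = sort_key key [0..<n]"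
  have xs: "length xs = n" "set xs = {..<n}" "distinct xs" "sorted (map key xs)"
    by (auto simp: xs_def)
  have nth: "bij_betw ((!) xs) {..<n} {..<n}"
    by (rule bij_betw_nth[OF xs(3)]) (simp_all only: xs)
  define pos where "pos = the_inv_into {..<n} ((!) xs)"
  have pos: "bij_betw pos {..<n} {..<n}"
    unfolding pos_def by (rule bij_betw_the_inv_into[OF nth])
  moreover have "key j \<le> key i" if "i < n" "j < n" "pos j < pos i" for i j
  proof -
    have "xs ! pos k = k" if "k < n" for k
      unfolding pos_def using nth that by (intro f_the_inv_into_f_bij_betw) auto
    moreover have "pos i < n" using pos that by (auto simp: bij_betw_def)
    then have "map key xs ! pos j \<le> map key xs ! pos i"
      using xs that by (intro sorted_nth_mono) auto
    ultimately show ?thesis using that xs \<open>pos i < n\<close> by simp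
  qed
  ultimately show ?thesis by blast
qed

text \<open>Sorting the variables by the layer that reads them gives the order \<open>pos\<close>.
  Different read variables have different layers, so every prefix of the order corresponds to a cut
  of the program.\<close>

lemma read_once_oblivious_order:
  assumes abp: "is_abp K n A" and ro: "read_once_oblivious A"
  shows "\<exists>pos. bij_betw pos {..<n} {..<n} \<and> (\<forall>k. \<exists>l\<le>layer A (snk A). \<forall>u v i.
    (u, v) \<in> edges A \<longrightarrow> lab A (u, v) = Var i \<longrightarrow> i < n \<and> (layer A u < l \<longleftrightarrow> pos i < k))"
proof -
  define L where "L = layer A (snk A)"
  have range: "i < n" if "(u, v) \<in> edges A" "lab A (u, v) = Var i" for u v i
    using abp that unfolding is_abp_def by (metis (mono_tags, lifting) label.simps(5))
  have lt: "layer A u < L" if "(u, v) \<in> edges A" for u v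
  proof -
    have "v \<in> nodes A" "layer A v = Suc (layer A u)" using abp that by (auto simp: is_abp_def)
    moreover have "layer A v \<le> L" using abp \<open>v \<in> nodes A\<close> by (auto simp: is_abp_def L_def)
    ultimately show ?thesis by simp
  qed
  have same: "layer A u = layer A u' \<longleftrightarrow> i = j"
    if "(u, v) \<in> edges A" "(u', v') \<in> edges A" "lab A (u, v) = Var i" "lab A (u', v') = Var j" for u v u' v' i j
  proof -
    have "\<forall>(u, v)\<in>edges A. \<forall>(u', v')\<in>edges A. \<forall>i j.
        lab A (u, v) = Var i \<longrightarrow> lab A (u', v') = Var j \<longrightarrow> (layer A u = layer A u' \<longleftrightarrow> i = j)"
      using ro unfolding read_once_oblivious_def by (rule conjunct2)
    from bspec[OF this that(1)]
    have "\<forall>(u', v')\<in>edges A. \<forall>i j.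
        lab A (u, v) = Var i \<longrightarrow> lab A (u', v') = Var j \<longrightarrow> (layer A u = layer A u' \<longleftrightarrow> i = j)"
      by (simp only: prod.case)
    from bspec[OF this that(2)] show ?thesis using that(3,4) by (simp only: prod.case simp_thms)
  qed
  define key where "key i = (SOME m. \<exists>u v. (u, v) \<in> edges A \<and> lab A (u, v) = Var i \<and> m = layer A u)" for i
  \<comment> \<open>Variables that are never read get the key \<open>L\<close>, above the layer of
    every edge, and so come last.\<close>
  define key' where "key' i = (if \<exists>u v. (u, v) \<in> edges A \<and> lab A (u, v) = Var i then key i else L)" for i
  have key: "key' i = layer A u" if "(u, v) \<in> edges A" "lab A (u, v) = Var i" for u v i
  proof -
    have "\<exists>u' v'. (u', v') \<in> edges A \<and> lab A (u', v') = Var i \<and> key i = layer A u'"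
      unfolding key_def by (rule someI_ex) (use that in blast)
    then obtain u' v' where "(u', v') \<in> edges A" "lab A (u', v') = Var i" "key i = layer A u'" by blast
    moreover from this have "layer A u' = layer A u" using same that by blast
    ultimately show ?thesis using that by (auto simp: key'_def)
  qed
  obtain pos where pos: "bij_betw pos {..<n} {..<n}"
    and sorted: "\<And>i j. i < n \<Longrightarrow> j < n \<Longrightarrow> pos j < pos i \<Longrightarrow> key' j \<le> key' i"
    using exists_sorting_bijection[of n key'] by blast
  have "\<exists>l\<le>L. \<forall>u v i. (u, v) \<in> edges A \<longrightarrow> lab A (u, v) = Var i \<longrightarrow> i < n \<and> (layer A u < l \<longleftrightarrow> pos i < k)" for k
  proof -
    \<comment> \<open>The cut is the least layer above all edges reading the prefix. By minimality,
      an edge below it lies no higher than some edge reading the prefix, which forces its own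
      variable into the prefix.\<close>
    define bnd where "bnd l \<longleftrightarrow> (\<forall>u v i. (u, v) \<in> edges A \<longrightarrow> lab A (u, v) = Var i \<longrightarrow> pos i < k \<longrightarrow> layer A u < l)" for l
    define l where "l = (LEAST l. bnd l)"
    have bL: "bnd L" unfolding bnd_def using lt by blast
    then have bl: "bnd l" and lL: "l \<le> L" unfolding l_def by (auto intro: LeastI Least_le)
    have "pos i < k" if e: "(u, v) \<in> edges A" "lab A (u, v) = Var i" and u: "layer A u < l" for u v i
    proof (rule ccontr)
      assume ik: "\<not> pos i < k"
      have "\<not> bnd (layer A u)" using u unfolding l_def by (rule not_less_Least)
      then obtain u' v' j where e': "(u', v') \<in> edges A" "lab A (u', v') = Var j" "pos j < k" "layer A u \<le> layer A u'"
        unfolding bnd_def by (meson not_less)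
      then have "key' j \<le> key' i" using sorted[of i j] ik range e by simp
      then have "layer A u = layer A u'" using key e e' by fastforce
      then have "i = j" using same e e' by blast
      then show False using ik e' by simp
    qed
    then show ?thesis using bl lL range unfolding bnd_def by blast
  qed
  then show ?thesis using pos unfolding L_def by blast
qed

section \<open>The rank of split coefficient matrices\<close>

text \<open>Rank as the inner dimension of a factorisation into a \<open>D\<close> by
  \<open>r\<close> and an \<open>r\<close> by \<open>D\<close> matrix. In this form the bounds add
  up over sums, and a cut of a program supplies the factors directly.\<close>

definition rank_le :: "nat \<Rightarrow> 'd set \<Rightarrow> ('d \<Rightarrow> 'd \<Rightarrow> 'c::comm_semiring_1) \<Rightarrow> bool" where
  "rank_le r D M \<longleftrightarrow>
     (\<exists>\<phi> \<psi>. \<forall>W\<in>D. \<forall>W'\<in>D. M W W' = (\<Sum>k<r. \<phi> (k::nat) W * \<psi> k W'))"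

lemma rank_leI:
  assumes "finite R" "card R \<le> r"
    and eq: "\<And>W W'. W \<in> D \<Longrightarrow> W' \<in> D \<Longrightarrow> M W W' = (\<Sum>k\<in>R. \<phi> k W * \<psi> k W')"
  shows "rank_le r D M"
proof -
  obtain f where f: "bij_betw f {0..<card R} R"
    using ex_bij_betw_nat_finite[OF assms(1)] by blast
  let ?\<phi> = "\<lambda>k W. if k < card R then \<phi> (f k) W else 0"
  have "M W W' = (\<Sum>k<r. ?\<phi> k W * \<psi> (f k) W')" if "W \<in> D" "W' \<in> D" for W W'
  proof -
    have "M W W' = (\<Sum>k\<in>{0..<card R}. \<phi> (f k) W * \<psi> (f k) W')"
      using eq[OF that] sum.reindex_bij_betw[OF f, of "\<lambda>k. \<phi> k W * \<psi> k W'"] by simp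
    also have "\<dots> = (\<Sum>k<r. ?\<phi> k W * \<psi> (f k) W')"
      using assms(2) by (intro sum.mono_neutral_cong_left) auto
    finally show ?thesis .
  qed
  then show ?thesis
    unfolding rank_le_def by (intro exI[of _ ?\<phi>] exI[of _ "\<lambda>k. \<psi> (f k)"] ballI)
qed

lemma rank_le_sum:
  assumes "\<And>i. i < s \<Longrightarrow> rank_le r D (M i)"
  shows "rank_le (s * r) D (\<lambda>W W'. \<Sum>i<s. M i W W')"
proof -
  have "\<forall>i. \<exists>\<phi> \<psi>. i < s \<longrightarrow> (\<forall>W\<in>D. \<forall>W'\<in>D. M i W W' = (\<Sum>k<r. \<phi> (k::nat) W * \<psi> k W'))"
    using assms unfolding rank_le_def by blast
  then obtain \<phi> \<psi> where
    eq: "\<And>i W W'. i < s \<Longrightarrow> W \<in> D \<Longrightarrow> W' \<in> D \<Longrightarrow> M i W W' = (\<Sum>k<r. \<phi> i (k::nat) W * \<psi> i k W')"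
    by metis
  show ?thesis
  proof (rule rank_leI[where R = "{..<s} \<times> {..<r}" and \<phi> = "\<lambda>(i, k). \<phi> i k" and \<psi> = "\<lambda>(i, k). \<psi> i k"])
    show "(\<Sum>i<s. M i W W') = (\<Sum>k\<in>{..<s} \<times> {..<r}.
        (case k of (i, k) \<Rightarrow> \<phi> i k) W * (case k of (i, k) \<Rightarrow> \<psi> i k) W')"
      if "W \<in> D" "W' \<in> D" for W W'
      using eq that by (simp add: case_prod_unfold sum.cartesian_product)
  qed auto
qed

text \<open>
  Once the values that \<open>W'\<close> contributes to the factor \<open>G\<close> and \<open>W\<close> to the factor \<open>H\<close> are guessed,
  every summand separates.
\<close>

lemma rank_le_sum_products:
  fixes G :: "'v \<Rightarrow> 'x \<Rightarrow> 'y \<Rightarrow> 'c::comm_semiring_1"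
  assumes fin: "finite N" "finite I" "finite J" and r: "card N * card I * card J \<le> r"
    and I: "\<And>W. W \<in> D \<Longrightarrow> b1 W \<in> I" and J: "\<And>W. W \<in> D \<Longrightarrow> a2 W \<in> J"
    and eq: "\<And>W W'. W \<in> D \<Longrightarrow> W' \<in> D \<Longrightarrow>
      M W W' = (\<Sum>v\<in>N. G v (a1 W) (b1 W') * H v (a2 W) (b2 W'))"
  shows "rank_le r D M"
proof (rule rank_leI[where R = "N \<times> I \<times> J"
      and \<phi> = "\<lambda>(v, x, y) W. of_bool (a2 W = y) * G v (a1 W) x"
      and \<psi> = "\<lambda>(v, x, y) W'. of_bool (b1 W' = x) * H v y (b2 W')"])
  show "finite (N \<times> I \<times> J)" using fin by simp
  show "card (N \<times> I \<times> J) \<le> r" using r by (simp add: card_cartesian_product mult.assoc)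
  fix W W' assume W: "W \<in> D" "W' \<in> D"
  have "G v (a1 W) (b1 W') * H v (a2 W) (b2 W') = (\<Sum>x\<in>I. \<Sum>y\<in>J.
      of_bool (a2 W = y) * G v (a1 W) x * (of_bool (b1 W' = x) * H v y (b2 W')))" for v
  proof -
    have "(\<Sum>x\<in>I. \<Sum>y\<in>J. of_bool (a2 W = y) * G v (a1 W) x * (of_bool (b1 W' = x) * H v y (b2 W')))
      = (\<Sum>x\<in>I. if x = b1 W' then (\<Sum>y\<in>J. if y = a2 W then G v (a1 W) x * H v y (b2 W') else 0) else 0)"
      by (intro sum.cong refl) (auto intro!: sum.cong sum.neutral)
    also have "\<dots> = G v (a1 W) (b1 W') * H v (a2 W) (b2 W')"
      using fin I[OF W(2)] J[OF W(1)] by (simp add: sum.delta)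
    finally show ?thesis by simp
  qed
  then show "M W W' = (\<Sum>k\<in>N \<times> I \<times> J.
      (case k of (v, x, y) \<Rightarrow> \<lambda>W. of_bool (a2 W = y) * G v (a1 W) x) W *
      (case k of (v, x, y) \<Rightarrow> \<lambda>W'. of_bool (b1 W' = x) * H v y (b2 W')) W')"
    by (simp add: eq[OF W] sum.cartesian_product[symmetric] case_prod_unfold sum.cartesian_product)
qed

text \<open>Gaussian elimination: the last equation is solved for an unknown \<open>W0\<close> with
  nonzero coefficient and substituted into the others.\<close>

lemma exists_nontrivial_solution:
  fixes \<phi> :: "nat \<Rightarrow> 'd \<Rightarrow> 'c::field"
  assumes "finite D" "r < card D"
  shows "\<exists>c. (\<exists>W\<in>D. c W \<noteq> 0) \<and> (\<forall>k<r. (\<Sum>W\<in>D. c W * \<phi> k W) = 0)"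
  using assms
proof (induction r arbitrary: D \<phi>)
  case 0
  then show ?case by (intro exI[of _ "\<lambda>_. 1"]) (auto simp: card_gt_0_iff)
next
  case (Suc r)
  show ?case
  proof (cases "\<forall>W\<in>D. \<phi> r W = 0")
    case True
    moreover obtain c where "\<exists>W\<in>D. c W \<noteq> 0" "\<forall>k<r. (\<Sum>W\<in>D. c W * \<phi> k W) = 0"
      using Suc.IH[of D \<phi>] Suc.prems by auto
    ultimately show ?thesis by (intro exI[of _ c]) (auto simp: less_Suc_eq)
  next
    case False
    then obtain W0 where W0: "W0 \<in> D" "\<phi> r W0 \<noteq> 0" by blast
    define D' where "D' = D - {W0}"
    have D': "finite D'" "r < card D'" using Suc.prems W0 by (auto simp: D'_def)
    obtain c where c: "\<exists>W\<in>D'. c W \<noteq> 0"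
      and eq: "\<And>k. k < r \<Longrightarrow> (\<Sum>W\<in>D'. c W * (\<phi> k W - \<phi> k W0 * \<phi> r W / \<phi> r W0)) = 0"
      using Suc.IH[OF D', of "\<lambda>k W. \<phi> k W - \<phi> k W0 * \<phi> r W / \<phi> r W0"] by blast
    define a where "a = - (\<Sum>W\<in>D'. c W * \<phi> r W) / \<phi> r W0"
    have sum: "(\<Sum>W\<in>D. (c(W0 := a)) W * \<phi> k W) = a * \<phi> k W0 + (\<Sum>W\<in>D'. c W * \<phi> k W)" for k
    proof -
      have "(\<Sum>W\<in>D. (c(W0 := a)) W * \<phi> k W)
          = (c(W0 := a)) W0 * \<phi> k W0 + (\<Sum>W\<in>D'. (c(W0 := a)) W * \<phi> k W)"
        unfolding D'_def using Suc.prems W0 by (intro sum.remove) auto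
      also have "(\<Sum>W\<in>D'. (c(W0 := a)) W * \<phi> k W) = (\<Sum>W\<in>D'. c W * \<phi> k W)"
        by (intro sum.cong) (auto simp: D'_def)
      finally show ?thesis by simp
    qed
    have "(\<Sum>W\<in>D. (c(W0 := a)) W * \<phi> k W) = 0" if "k < Suc r" for k
    proof (cases "k = r")
      case True
      have "a * \<phi> r W0 + (\<Sum>W\<in>D'. c W * \<phi> r W) = 0" using W0 by (simp add: a_def)
      then show ?thesis by (simp only: True sum)
    next
      case False
      then have "0 = (\<Sum>W\<in>D'. c W * (\<phi> k W - \<phi> k W0 * \<phi> r W / \<phi> r W0))"
        using eq that by simp
      also have "\<dots> = (\<Sum>W\<in>D'. c W * \<phi> k W) - (\<Sum>W\<in>D'. c W * \<phi> r W) * (\<phi> k W0 / \<phi> r W0)"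
        by (simp add: algebra_simps sum_subtractf sum_distrib_left)
      also have "\<dots> = a * \<phi> k W0 + (\<Sum>W\<in>D'. c W * \<phi> k W)" by (simp add: a_def)
      also have "\<dots> = (\<Sum>W\<in>D. (c(W0 := a)) W * \<phi> k W)" by (simp only: sum)
      finally show ?thesis by simp
    qed
    moreover have "\<exists>W\<in>D. (c(W0 := a)) W \<noteq> 0" using c by (auto simp: D'_def)
    ultimately show ?thesis by blast
  qed
qed

lemma rank_le_kernel:
  fixes M :: "'d \<Rightarrow> 'd \<Rightarrow> 'c::field"
  assumes "rank_le r D M" "finite D" "r < card D"
  shows "\<exists>c. (\<exists>W\<in>D. c W \<noteq> 0) \<and> (\<forall>W'\<in>D. (\<Sum>W\<in>D. c W * M W W') = 0)"
proof -
  obtain \<phi> \<psi> where M: "\<And>W W'. W \<in> D \<Longrightarrow> W' \<in> D \<Longrightarrow> M W W' = (\<Sum>k<r. \<phi> (k::nat) W * \<psi> k W')"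
    using assms(1) unfolding rank_le_def by blast
  obtain c where c: "\<exists>W\<in>D. c W \<noteq> 0" "\<And>k. k < r \<Longrightarrow> (\<Sum>W\<in>D. c W * \<phi> k W) = 0"
    using exists_nontrivial_solution[OF assms(2,3), of \<phi>] by blast
  have "(\<Sum>W\<in>D. c W * M W W') = 0" if "W' \<in> D" for W'
  proof -
    have "(\<Sum>W\<in>D. c W * M W W') = (\<Sum>W\<in>D. \<Sum>k<r. c W * \<phi> k W * \<psi> k W')"
      using M that by (simp add: sum_distrib_left mult.assoc)
    also have "\<dots> = (\<Sum>k<r. (\<Sum>W\<in>D. c W * \<phi> k W) * \<psi> k W')"
      by (subst sum.swap) (simp add: sum_distrib_right)
    finally show ?thesis using c(2) by simp
  qed
  then show ?thesis using c(1) by blast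
qed

text \<open>
  \<open>y p\<close> and \<open>z p\<close> are the two elements of the pair \<open>p\<close>. The monomials indexed by \<open>W\<close> and \<open>W'\<close> run over
  all products of a multilinear monomial in the \<open>y p\<close> and one in the \<open>z p\<close>; the complement is taken so
  that the matrix of \<open>pairing_poly P\<close> is the identity.
\<close>

definition split_set :: "pairing \<Rightarrow> (nat set \<Rightarrow> nat) \<Rightarrow> (nat set \<Rightarrow> nat) \<Rightarrow> pairing \<Rightarrow> pairing \<Rightarrow> nat set" where
  "split_set P y z W W' = y ` W \<union> z ` (P - W')"

definition split_coeff :: "'c::zero mpoly \<Rightarrow> pairing \<Rightarrow> (nat set \<Rightarrow> nat) \<Rightarrow> (nat set \<Rightarrow> nat) \<Rightarrow> pairing \<Rightarrow> pairing \<Rightarrow> 'c" where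
  "split_coeff f P y z W W' = Poly_Mapping.lookup f (set_mono (split_set P y z W W'))"

text \<open>Each node of the cut layer contributes a product of a matrix on the variables in
  \<open>C\<close> and one on those outside. If \<open>C\<close> has a surplus of \<open>y\<close>,
  the values guessed are the column part inside \<open>C\<close> and the row part outside; otherwise
  the roles are exchanged. Both sides have \<open>card P\<close> variables in total, so the surplus
  \<open>t\<close> saves \<open>t\<close> binary choices.\<close>

lemma rank_le_abp:
  fixes A :: "'c::comm_semiring_1 abp"
  assumes abp: "is_abp K n A"
    and l: "l \<le> layer A (snk A)"
    and cut: "\<And>u v i. (u, v) \<in> edges A \<Longrightarrow> lab A (u, v) = Var i \<Longrightarrow> layer A u < l \<longleftrightarrow> i \<in> C"
    and fin: "finite P"
    and t: "int t \<le> \<bar>int (card {p \<in> P. y p \<in> C}) - int (card {p \<in> P. z p \<in> C})\<bar>"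
  shows "rank_le (abp_size A * 2 ^ (card P - t)) (Pow P) (split_coeff (abp_poly A) P y z)"
proof -
  let ?N = "{v \<in> nodes A. layer A v = l}"
  let ?a = "card {p \<in> P. y p \<in> C}" and ?b = "card {p \<in> P. z p \<in> C}"
  let ?a' = "card {p \<in> P. y p \<notin> C}" and ?b' = "card {p \<in> P. z p \<notin> C}"
  have finN: "finite ?N" and cN: "card ?N \<le> abp_size A"
    using abp by (auto simp: is_abp_def abp_size_def intro: card_mono)
  have "?a + ?a' = card P" "?b + ?b' = card P"
    using fin by (subst card_Un_disjoint[symmetric]; auto intro!: arg_cong[where f = card])+
  then have le: "?b + ?a' \<le> card P - t \<or> ?a + ?b' \<le> card P - t"
    using t by linarith
  obtain g h where gh: "\<And>S. finite S \<Longrightarrow> Poly_Mapping.lookup (abp_poly A) (set_mono S)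
      = (\<Sum>v\<in>?N. g v (S \<inter> C) * h v (S \<inter> - C))"
    using abp_coeff_cut[OF abp l, of C "- C"] cut by (force simp: not_less)
  have coeff: "split_coeff (abp_poly A) P y z W W'
      = (\<Sum>v\<in>?N. g v (y ` (W \<inter> {p. y p \<in> C}) \<union> z ` ((P - W') \<inter> {p. z p \<in> C}))
          * h v (y ` (W \<inter> {p. y p \<notin> C}) \<union> z ` ((P - W') \<inter> {p. z p \<notin> C})))"
    if "W \<in> Pow P" for W W'
  proof -
    have "finite (split_set P y z W W')"
      using fin that by (auto simp: split_set_def intro: finite_subset)
    moreover have "split_set P y z W W' \<inter> C = y ` (W \<inter> {p. y p \<in> C}) \<union> z ` ((P - W') \<inter> {p. z p \<in> C})"
      "split_set P y z W W' \<inter> - C = y ` (W \<inter> {p. y p \<notin> C}) \<union> z ` ((P - W') \<inter> {p. z p \<notin> C})"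
      by (auto simp: split_set_def)
    ultimately show ?thesis by (simp add: split_coeff_def gh)
  qed
  from le show ?thesis
  proof
    assume e: "?b + ?a' \<le> card P - t"
    show ?thesis
    proof (rule rank_le_sum_products[where N = ?N
          and I = "Pow {p \<in> P. z p \<in> C}" and J = "Pow {p \<in> P. y p \<notin> C}"
          and G = "\<lambda>v U V. g v (y ` U \<union> z ` V)" and H = "\<lambda>v U V. h v (y ` U \<union> z ` V)"
          and ?a1.0 = "\<lambda>W. W \<inter> {p. y p \<in> C}" and ?b1.0 = "\<lambda>W'. (P - W') \<inter> {p. z p \<in> C}"
          and ?a2.0 = "\<lambda>W. W \<inter> {p. y p \<notin> C}" and ?b2.0 = "\<lambda>W'. (P - W') \<inter> {p. z p \<notin> C}"])
      have "card ?N * card (Pow {p \<in> P. z p \<in> C}) * card (Pow {p \<in> P. y p \<notin> C}) = card ?N * 2 ^ (?b + ?a')"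
        using fin by (simp add: card_Pow power_add)
      also have "\<dots> \<le> abp_size A * 2 ^ (card P - t)"
        using cN e by (intro mult_le_mono power_increasing) auto
      finally show "card ?N * card (Pow {p \<in> P. z p \<in> C}) * card (Pow {p \<in> P. y p \<notin> C})
        \<le> abp_size A * 2 ^ (card P - t)" .
    qed (use fin finN coeff in auto)
  next
    assume e: "?a + ?b' \<le> card P - t"
    show ?thesis
    proof (rule rank_le_sum_products[where N = ?N
          and I = "Pow {p \<in> P. z p \<notin> C}" and J = "Pow {p \<in> P. y p \<in> C}"
          and G = "\<lambda>v U V. h v (y ` U \<union> z ` V)" and H = "\<lambda>v U V. g v (y ` U \<union> z ` V)"
          and ?a1.0 = "\<lambda>W. W \<inter> {p. y p \<notin> C}" and ?b1.0 = "\<lambda>W'. (P - W') \<inter> {p. z p \<notin> C}"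
          and ?a2.0 = "\<lambda>W. W \<inter> {p. y p \<in> C}" and ?b2.0 = "\<lambda>W'. (P - W') \<inter> {p. z p \<in> C}"])
      have "card ?N * card (Pow {p \<in> P. z p \<notin> C}) * card (Pow {p \<in> P. y p \<in> C}) = card ?N * 2 ^ (?a + ?b')"
        using fin by (simp add: card_Pow power_add)
      also have "\<dots> \<le> abp_size A * 2 ^ (card P - t)"
        using cN e by (intro mult_le_mono power_increasing) auto
      finally show "card ?N * card (Pow {p \<in> P. z p \<notin> C}) * card (Pow {p \<in> P. y p \<in> C})
        \<le> abp_size A * 2 ^ (card P - t)" .
    qed (use fin finN coeff in \<open>auto simp: mult.commute\<close>)
  qed
qed

section \<open>Full rank of the arc polynomials\<close>

lemma lookup_single_times:
  fixes b :: "(nat \<Rightarrow>\<^sub>0 nat) \<Rightarrow>\<^sub>0 'c::comm_semiring_1"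
  shows "Poly_Mapping.lookup (Poly_Mapping.single \<mu> c * b) (\<mu> + m) = c * Poly_Mapping.lookup b m"
  by (simp add: lookup_mult lookup_single when_mult)

lemma lookup_of_nat_times:
  fixes b :: "(nat \<Rightarrow>\<^sub>0 nat) \<Rightarrow>\<^sub>0 'c::comm_semiring_1"
  shows "Poly_Mapping.lookup (of_nat j * b) m = of_nat j * Poly_Mapping.lookup b m"
  by (induction j) (simp_all add: distrib_right lookup_add)

lemma pairing_poly_eq_sum:
  assumes "finite P" "\<And>p. p \<in> P \<Longrightarrow> finite p"
  shows "(pairing_poly P :: 'c::comm_semiring_1 mpoly)
    = (\<Sum>f\<in>PiE P (\<lambda>p. p). Poly_Mapping.single (\<Sum>p\<in>P. Poly_Mapping.single (f p) 1) 1)"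
proof -
  have "(\<Prod>p\<in>P. mvar (f p) :: 'c mpoly)
      = Poly_Mapping.single (\<Sum>p\<in>P. Poly_Mapping.single (f p) 1) 1" for f
    using assms(1) by (induction P rule: finite_induct) (simp_all add: mvar_def mult_single)
  then show ?thesis
    using prod_sum_PiE[where A = P and B = "\<lambda>p. p" and f = "\<lambda>_ i. mvar i :: 'c mpoly"] assms by (simp add: pairing_poly_def)
qed

text \<open>Kept as a natural number: the coefficients of \<open>pairing_poly\<close> then visibly
  contain no formal variable, as the degree argument below requires.\<close>

definition selection_count :: "pairing \<Rightarrow> nat set \<Rightarrow> nat" where
  "selection_count P S = card {f \<in> PiE P (\<lambda>p. p). (\<Sum>p\<in>P. Poly_Mapping.single (f p) 1) = set_mono S}"

lemma lookup_pairing_poly: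
  assumes "finite P" "\<And>p. p \<in> P \<Longrightarrow> finite p"
  shows "Poly_Mapping.lookup (pairing_poly P :: 'c::comm_semiring_1 mpoly) (set_mono S)
    = of_nat (selection_count P S)"
proof -
  have "finite (PiE P (\<lambda>p. p))" using assms by (rule finite_PiE)
  moreover have "(pairing_poly P :: 'c mpoly)
    = (\<Sum>f\<in>PiE P (\<lambda>p. p). Poly_Mapping.single (\<Sum>p\<in>P. Poly_Mapping.single (f p) 1) 1)"
    by (rule pairing_poly_eq_sum) (use assms in auto)
  ultimately show ?thesis
    by (simp add: selection_count_def lookup_sum lookup_single when_def sum.If_cases Int_def)
qed

lemma lookup_arc_poly:
  assumes "even n" "n \<ge> 2"
  shows "Poly_Mapping.lookup (arc_poly w n :: 'c::comm_semiring_1 mpoly) (set_mono S)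
    = (\<Sum>P\<in>arc_pairings n. w P * of_nat (selection_count P S))"
proof -
  have "Poly_Mapping.lookup (mconst (w P) * pairing_poly P :: 'c mpoly) (set_mono S)
      = w P * of_nat (selection_count P S)" if "P \<in> arc_pairings n" for P
  proof -
    have "pairs_up P {..<n}" using pairs_up_arc_pairings assms that by blast
    then have "finite P" "\<And>p. p \<in> P \<Longrightarrow> finite p"
      by (auto simp: pairs_up_def intro: card_ge_0_finite)
    then have "Poly_Mapping.lookup (pairing_poly P :: 'c mpoly) (set_mono S) = of_nat (selection_count P S)"
      by (rule lookup_pairing_poly)
    then show ?thesis
      using lookup_single_times[of 0 "w P" "pairing_poly P" "set_mono S"] by (simp add: mconst_def)
  qed
  then show ?thesis by (simp add: arc_poly_def lookup_sum)
qed

text \<open>The monomial can arise only if the set meets every pair in exactly one element, which is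
  then the one selected. It contains \<open>y p\<close> iff \<open>p \<in> W\<close> and
  \<open>z p\<close> iff \<open>p \<notin> W'\<close>, so this happens precisely for
  \<open>W = W'\<close>.\<close>

lemma selection_count_split_set:
  assumes P: "pairs_up P A"
    and yz: "\<And>p. p \<in> P \<Longrightarrow> p = {y p, z p} \<and> y p \<noteq> z p"
    and W: "W \<subseteq> P" "W' \<subseteq> P"
  shows "selection_count P (split_set P y z W W') = of_bool (W = W')"
proof -
  have fin: "finite P" using P by (simp add: pairs_up_def)
  have same: "p = q" if "p \<in> P" "q \<in> P" "i \<in> p" "i \<in> q" for p q i
    using P that unfolding pairs_up_def disjoint_def disjnt_def by blast
  define S where "S = split_set P y z W W'"
  have finS: "finite S" using W fin by (auto simp: S_def split_set_def intro: finite_subset)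
  have pe: "p = {y p, z p}" and ne: "y p \<noteq> z p" and mem: "y p \<in> p" "z p \<in> p" if "p \<in> P" for p
    using yz[OF that] by blast+
  have Sy: "y p \<in> S \<longleftrightarrow> p \<in> W" if p: "p \<in> P" for p
  proof
    assume "y p \<in> S"
    then consider q where "q \<in> W" "y p = y q" | q where "q \<in> P" "y p = z q"
      unfolding S_def split_set_def by blast
    then show "p \<in> W"
      by cases (metis W(1) mem(1) p same subsetD, metis mem ne p same)
  qed (simp add: S_def split_set_def)
  have Sz: "z p \<in> S \<longleftrightarrow> p \<notin> W'" if p: "p \<in> P" for p
  proof
    assume "z p \<in> S"
    then consider q where "q \<in> P - W'" "z p = z q" | q where "q \<in> P" "z p = y q"
      using W(1) unfolding S_def split_set_def by blast
    then show "p \<notin> W'"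
      by cases (metis DiffE mem(2) p same, metis mem ne p same)
  qed (use p in \<open>simp add: S_def split_set_def\<close>)
  have sel: "(\<Sum>p\<in>P. Poly_Mapping.single (f p) 1) = set_mono S \<longleftrightarrow> (\<forall>p\<in>P. p \<inter> S = {f p})"
    if f: "f \<in> PiE P (\<lambda>p. p)" for f
  proof -
    have fp: "f p \<in> p" if "p \<in> P" for p using f that by (auto simp: PiE_def)
    have inj: "inj_on f P" using fp same by (intro inj_onI) metis
    have "(\<Sum>p\<in>P. Poly_Mapping.single (f p) (1::nat)) = set_mono (f ` P)"
      by (simp add: set_mono_def sum.reindex[OF inj])
    moreover have "set_mono (f ` P) = set_mono S \<longleftrightarrow> f ` P = S"
    proof
      assume e: "set_mono (f ` P) = set_mono S"
      have "i \<in> f ` P \<longleftrightarrow> i \<in> S" for i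
        using arg_cong[OF e, of "\<lambda>m. Poly_Mapping.lookup m i"] fin finS
        by (auto simp: lookup_set_mono of_bool_def split: if_splits)
      then show "f ` P = S" by blast
    qed simp
    moreover have "f ` P = S \<longleftrightarrow> (\<forall>p\<in>P. p \<inter> S = {f p})"
    proof
      assume e: "f ` P = S"
      have "p \<inter> S = {f p}" if p: "p \<in> P" for p
      proof -
        have "i = f p" if "i \<in> p" "i \<in> S" for i
          using that e fp same p by blast
        then show ?thesis using e fp p by blast
      qed
      then show "\<forall>p\<in>P. p \<inter> S = {f p}" by blast
    next
      assume a: "\<forall>p\<in>P. p \<inter> S = {f p}"
      have "S \<subseteq> \<Union>P" using mem W unfolding S_def split_set_def by blast
      then show "f ` P = S" using a by blast
    qed
    ultimately show ?thesis by simp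
  qed
  have "{f \<in> PiE P (\<lambda>p. p). (\<Sum>p\<in>P. Poly_Mapping.single (f p) 1) = set_mono S}
      = (if W = W' then {\<lambda>p\<in>P. if p \<in> W then y p else z p} else {})" (is "?F = _")
  proof (cases "W = W'")
    case True
    have c: "p \<inter> S = {if p \<in> W then y p else z p}" if "p \<in> P" for p
    proof -
      have "p \<inter> S = {i \<in> {y p, z p}. i \<in> S}" using pe[OF that] by blast
      also have "\<dots> = {if p \<in> W then y p else z p}"
        using Sy[OF that] Sz[OF that] ne[OF that] True by auto
      finally show ?thesis .
    qed
    define g where "g = (\<lambda>p\<in>P. if p \<in> W then y p else z p)"
    have "f = g" if "f \<in> ?F" for f
    proof (rule extensionalityI[of _ P])
      show "f x = g x" if "x \<in> P" for x
        using sel[of f] \<open>f \<in> ?F\<close> c[OF that] that by (auto simp: g_def)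
    qed (use that in \<open>auto simp: PiE_def g_def\<close>)
    moreover have "g \<in> PiE P (\<lambda>p. p)"
      unfolding g_def restrict_PiE_iff using mem by simp
    moreover have "\<forall>p\<in>P. p \<inter> S = {g p}" using c by (simp add: g_def)
    ultimately have "?F = {g}" using sel by blast
    then show ?thesis using True by (simp add: g_def)
  next
    case False
    then obtain p where p: "p \<in> P" "p \<in> W \<longleftrightarrow> p \<notin> W'" using W by blast
    have "p \<inter> S \<noteq> {i}" for i
    proof (cases "p \<in> W")
      case True
      then have "{y p, z p} \<subseteq> p \<inter> S"
        using Sy[OF p(1)] Sz[OF p(1)] mem[OF p(1)] p(2) by simp
      then show ?thesis using ne[OF p(1)] by (metis insert_subset singletonD)
    next
      case False
      then have "y p \<notin> S" "z p \<notin> S" using Sy Sz p by blast+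
      then have "a \<notin> S" if "a \<in> p" for a using pe[OF p(1)] that by (metis insertE singletonD)
      then show ?thesis by blast
    qed
    then have "?F = {}" using sel p(1) by blast
    then show ?thesis using False by simp
  qed
  then show ?thesis by (simp add: selection_count_def S_def)
qed

lemma exists_common_denominator:
  fixes c :: "'d \<Rightarrow> 'a::idom fract"
  assumes "finite D"
  shows "\<exists>d. d \<noteq> 0 \<and> (\<forall>W\<in>D. \<exists>b. to_fract d * c W = to_fract b)"
  using assms
proof (induction D rule: finite_induct)
  case empty
  then show ?case by (intro exI[of _ 1]) auto
next
  case (insert W D)
  then obtain d where d: "d \<noteq> 0" "\<forall>W\<in>D. \<exists>b. to_fract d * c W = to_fract b" by blast
  obtain a e where ae: "c W = to_fract a / to_fract e" "e \<noteq> 0"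
    by (metis Fract_conv_to_fract Fract_cases)
  have "\<exists>b. to_fract (e * d) * c V = to_fract b" if V: "V \<in> insert W D" for V
  proof (cases "V = W")
    case True
    have "to_fract (e * d) * c W = to_fract (d * a)" using ae by simp
    then show ?thesis using True by blast
  next
    case False
    then obtain b where "to_fract d * c V = to_fract b" using d V by blast
    then have "to_fract (e * d) * c V = to_fract (e * b)" by (simp add: mult.assoc)
    then show ?thesis by blast
  qed
  then show ?case using d ae by (intro exI[of _ "e * d"]) simp
qed

text \<open>
  Among all monomials of the cleared coefficients \<open>c W\<close> take one of maximal degree: multiplied by the
  dominant weight it cannot be cancelled by any other term.
\<close>

lemma dominant_weight_kernel_trivial:
  fixes c :: "'d \<Rightarrow> 'f::field ratfun" and deg :: "(nat \<Rightarrow>\<^sub>0 nat) \<Rightarrow> nat"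
  assumes fin: "finite D" "finite Q" and P0: "P0 \<in> Q"
    and deg_add: "\<And>a b. deg (a + b) = deg a + deg b"
    and dominant: "\<And>P. P \<in> Q \<Longrightarrow> P \<noteq> P0 \<Longrightarrow> deg (\<mu> P) < deg (\<mu> P0)"
    and J0: "\<And>W W'. W \<in> D \<Longrightarrow> W' \<in> D \<Longrightarrow> J P0 W W' = of_bool (W = W')"
    and eq: "\<And>W'. W' \<in> D \<Longrightarrow> (\<Sum>W\<in>D. c W *
       (\<Sum>P\<in>Q. to_fract (Poly_Mapping.single (\<mu> P) 1) * of_nat (J P W W'))) = 0"
    and W: "W \<in> D"
  shows "c W = 0"
proof (rule ccontr)
  assume nz: "c W \<noteq> 0"
  obtain d where d: "d \<noteq> 0" "\<forall>W\<in>D. \<exists>b. to_fract d * c W = to_fract b"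
    using exists_common_denominator[OF fin(1)] by blast
  then obtain b where b: "\<And>W. W \<in> D \<Longrightarrow> to_fract d * c W = to_fract (b W)" by metis
  have of_nat_fract: "(of_nat j :: 'f ratfun) = to_fract (of_nat j)" for j
    by (induction j) simp_all
  have eq0: "(\<Sum>W\<in>D. \<Sum>P\<in>Q. of_nat (J P W W') * (Poly_Mapping.single (\<mu> P) 1 * b W)) = 0"
    if "W' \<in> D" for W'
  proof -
    have "to_fract (\<Sum>W\<in>D. \<Sum>P\<in>Q. of_nat (J P W W') * (Poly_Mapping.single (\<mu> P) 1 * b W))
       = (\<Sum>W\<in>D. (to_fract d * c W) *
           (\<Sum>P\<in>Q. to_fract (Poly_Mapping.single (\<mu> P) 1) * of_nat (J P W W')))"
      by (simp add: b of_nat_fract sum_distrib_left mult_ac)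
    also have "\<dots> = to_fract d * (\<Sum>W\<in>D. c W *
           (\<Sum>P\<in>Q. to_fract (Poly_Mapping.single (\<mu> P) 1) * of_nat (J P W W')))"
      by (simp only: sum_distrib_left mult.assoc)
    also have "\<dots> = 0" by (simp only: eq[OF that] mult_zero_right)
    finally show ?thesis by (simp only: to_fract_eq_0_iff)
  qed
  define M where "M = (SIGMA W:D. Poly_Mapping.keys (b W))"
  have finM: "finite M" using fin by (simp add: M_def)
  have "b W \<noteq> 0" using nz b[OF W] d(1) by (metis mult_eq_0_iff to_fract_eq_0_iff)
  then obtain m where "m \<in> Poly_Mapping.keys (b W)" by (metis all_not_in_conv keys_eq_empty)
  then have "(W, m) \<in> M" using W by (simp add: M_def)
  then have "Max ((\<lambda>x. deg (snd x)) ` M) \<in> (\<lambda>x. deg (snd x)) ` M"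
    using finM by (intro Max_in) auto
  then obtain x where "x \<in> M" "Max ((\<lambda>x. deg (snd x)) ` M) = deg (snd x)" by blast
  then have x: "x \<in> M" "\<And>x'. x' \<in> M \<Longrightarrow> deg (snd x') \<le> deg (snd x)"
    using finM Max_ge by (metis finite_imageI imageI)+
  obtain W1 m1 where x_eq: "x = (W1, m1)" by fastforce
  have W1: "W1 \<in> D" "m1 \<in> Poly_Mapping.keys (b W1)"
    and max: "\<And>W m. W \<in> D \<Longrightarrow> m \<in> Poly_Mapping.keys (b W) \<Longrightarrow> deg m \<le> deg m1"
    using x x_eq by (auto simp: M_def)
  \<comment> \<open>The relation for \<open>W' = W1\<close> is read off at this monomial. Terms with
    \<open>P \<noteq> P0\<close> have too small a degree to reach it, and for \<open>P0\<close> the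
    identity matrix leaves only \<open>W = W1\<close>.\<close>
  let ?k = "\<mu> P0 + m1"
  have other: "Poly_Mapping.lookup (Poly_Mapping.single (\<mu> P) 1 * b W) ?k = 0"
    if P: "P \<in> Q" "P \<noteq> P0" and W: "W \<in> D" for P W
  proof (rule ccontr)
    assume "Poly_Mapping.lookup (Poly_Mapping.single (\<mu> P) 1 * b W) ?k \<noteq> 0"
    then have "?k \<in> Poly_Mapping.keys (Poly_Mapping.single (\<mu> P) 1 * b W)"
      by (simp add: in_keys_iff)
    then obtain m where "m \<in> Poly_Mapping.keys (b W)" "?k = \<mu> P + m"
      using keys_mult[of "Poly_Mapping.single (\<mu> P) 1" "b W"] by auto
    then show False
      using dominant[OF P] max[OF W] deg_add[of "\<mu> P0" m1] deg_add[of "\<mu> P" m] by fastforce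
  qed
  have "0 = (\<Sum>W\<in>D. \<Sum>P\<in>Q. of_nat (J P W W1) *
      Poly_Mapping.lookup (Poly_Mapping.single (\<mu> P) 1 * b W) ?k)"
    using arg_cong[OF eq0[OF W1(1)], of "\<lambda>p. Poly_Mapping.lookup p ?k"]
    by (simp add: lookup_sum lookup_of_nat_times)
  also have "\<dots> = (\<Sum>W\<in>D. of_nat (J P0 W W1) * Poly_Mapping.lookup (b W) m1)"
  proof (rule sum.cong[OF refl])
    fix W assume W: "W \<in> D"
    show "(\<Sum>P\<in>Q. of_nat (J P W W1) * Poly_Mapping.lookup (Poly_Mapping.single (\<mu> P) 1 * b W) ?k)
        = of_nat (J P0 W W1) * Poly_Mapping.lookup (b W) m1"
      using sum.remove[OF fin(2) P0,
          of "\<lambda>P. of_nat (J P W W1) * Poly_Mapping.lookup (Poly_Mapping.single (\<mu> P) 1 * b W) ?k"]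
        other[OF _ _ W] lookup_single_times[of "\<mu> P0" 1 "b W" m1]
      by (simp add: sum.neutral)
  qed
  also have "\<dots> = (\<Sum>W\<in>D. if W = W1 then Poly_Mapping.lookup (b W1) m1 else 0)"
    using J0[OF _ W1(1)] by (intro sum.cong) auto
  also have "\<dots> = Poly_Mapping.lookup (b W1) m1" using fin W1 by simp
  finally show False using W1 by (simp add: in_keys_iff)
qed

lemma arc_poly_full_rank:
  fixes deg :: "(nat \<Rightarrow>\<^sub>0 nat) \<Rightarrow> nat"
  assumes n: "even n" "n \<ge> 2" and P0: "P0 \<in> arc_pairings n"
    and yz: "\<And>p. p \<in> P0 \<Longrightarrow> p = {y p, z p} \<and> y p \<noteq> z p"
    and deg_add: "\<And>a b. deg (a + b) = deg a + deg b"
    and dominant: "\<And>P. P \<in> arc_pairings n \<Longrightarrow> P \<noteq> P0 \<Longrightarrow> deg (\<mu> P) < deg (\<mu> P0)"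
    and rank: "rank_le r (Pow P0) (split_coeff
      (arc_poly (\<lambda>P. to_fract (Poly_Mapping.single (\<mu> P) 1)) n :: 'f::field ratfun mpoly) P0 y z)"
  shows "2 ^ card P0 \<le> r"
proof (rule ccontr)
  have pu: "pairs_up P0 {..<n}" by (rule pairs_up_arc_pairings[OF n P0])
  then have fin: "finite P0" by (simp add: pairs_up_def)
  assume "\<not> 2 ^ card P0 \<le> r"
  then have "r < card (Pow P0)" using fin by (simp add: card_Pow)
  from rank_le_kernel[OF rank _ this] obtain c where c: "\<exists>W\<in>Pow P0. c W \<noteq> 0"
    and ker: "\<And>W'. W' \<in> Pow P0 \<Longrightarrow> (\<Sum>W\<in>Pow P0. c W * split_coeff
      (arc_poly (\<lambda>P. to_fract (Poly_Mapping.single (\<mu> P) 1)) n :: 'f ratfun mpoly) P0 y z W W') = 0"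
    using fin by blast
  have "c W = 0" if "W \<in> Pow P0" for W
  proof (rule dominant_weight_kernel_trivial[where D = "Pow P0" and Q = "arc_pairings n"
        and ?P0.0 = P0 and deg = deg and \<mu> = \<mu>
        and J = "\<lambda>P W W'. selection_count P (split_set P0 y z W W')"])
    show "selection_count P0 (split_set P0 y z V V') = of_bool (V = V')"
      if "V \<in> Pow P0" "V' \<in> Pow P0" for V V'
      using selection_count_split_set[OF pu yz] that by blast
    show "(\<Sum>W\<in>Pow P0. c W * (\<Sum>P\<in>arc_pairings n. to_fract (Poly_Mapping.single (\<mu> P) 1) *
        of_nat (selection_count P (split_set P0 y z W W')))) = 0" if "W' \<in> Pow P0" for W'
      using ker[OF that] by (simp add: split_coeff_def lookup_arc_poly[OF n])
  qed (use fin finite_arc_pairings[OF n] P0 deg_add dominant that in auto)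
  then show False using c by blast
qed

section \<open>Gradings for the two weight families\<close>

definition pair_weight_mono :: "pairing \<Rightarrow> nat \<Rightarrow>\<^sub>0 nat" where
  "pair_weight_mono P = (\<Sum>p\<in>P. Poly_Mapping.single (set_encode p) 1)"

lemma pair_weight_eq:
  assumes "finite P"
  shows "(pair_weight P :: 'f::field ratfun) = to_fract (Poly_Mapping.single (pair_weight_mono P) 1)"
  using assms
  by (induction P rule: finite_induct)
     (simp_all add: pair_weight_def pair_weight_mono_def rvar_def mvar_def mult_single to_fract_def
        fract_collapse flip: to_fract_mult)

text \<open>The grading counts only the formal variables of the pairs of \<open>P0\<close>, so the
  weight of \<open>P\<close> has degree \<open>card (P \<inter> P0)\<close>. As all arc pairings
  have the same size, only \<open>P0\<close> itself attains the maximum.\<close>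

lemma fhat_full_rank:
  assumes n: "even n" "n \<ge> 2" and P0: "P0 \<in> arc_pairings n"
    and yz: "\<And>p. p \<in> P0 \<Longrightarrow> p = {y p, z p} \<and> y p \<noteq> z p"
    and rank: "rank_le r (Pow P0) (split_coeff (fhat n :: 'f::field ratfun mpoly) P0 y z)"
  shows "2 ^ card P0 \<le> r"
proof -
  note pu = pairs_up_arc_pairings[OF n]
  define deg where "deg m = (\<Sum>k\<in>set_encode ` P0. Poly_Mapping.lookup m k)" for m :: "nat \<Rightarrow>\<^sub>0 nat"
  have finp: "finite p" if "P \<in> arc_pairings n" "p \<in> P" for P p
    using pu[OF that(1)] that(2) by (auto simp: pairs_up_def intro: card_ge_0_finite)
  have degP: "deg (pair_weight_mono P) = card (P \<inter> P0)" if P: "P \<in> arc_pairings n" for P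
  proof -
    have fin: "finite P" "finite P0" using pu P P0 by (auto simp: pairs_up_def)
    have inj: "inj_on set_encode P0"
      using finp[OF P0] by (intro inj_onI) (simp add: set_encode_eq)
    have "deg (pair_weight_mono P) = (\<Sum>p\<in>P. \<Sum>q\<in>P0. of_bool (p = q))"
      unfolding deg_def pair_weight_mono_def
      using finp[OF P0] finp[OF P]
      by (simp add: sum.reindex[OF inj] lookup_sum lookup_single when_def set_encode_eq sum.swap[of _ P] of_bool_def)
        (simp only: One_nat_def)
    also have "\<dots> = (\<Sum>p\<in>P. of_bool (p \<in> P0))"
      using fin by (intro sum.cong) (auto simp: of_bool_def)
    also have "\<dots> = card (P \<inter> P0)"
      using fin by (simp add: Int_def)
    finally show ?thesis .
  qed
  have "fhat n = arc_poly (\<lambda>P. to_fract (Poly_Mapping.single (pair_weight_mono P) 1) :: 'f ratfun) n"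
    unfolding fhat_def arc_poly_def
    using pu by (intro sum.cong) (auto simp: pairs_up_def pair_weight_eq)
  moreover have "deg (pair_weight_mono P) < deg (pair_weight_mono P0)"
    if "P \<in> arc_pairings n" "P \<noteq> P0" for P
  proof -
    have "finite P" "finite P0" "card P = card P0"
      using pu that(1) P0 card_pairs_up[OF pu[OF that(1)]] card_pairs_up[OF pu[OF P0]]
      by (auto simp: pairs_up_def)
    then have "\<not> P0 \<subseteq> P" using that(2) by (metis card_subset_eq)
    then have "P \<inter> P0 \<subset> P0" by blast
    then show ?thesis
      using degP[OF that(1)] degP[OF P0] \<open>finite P0\<close> by (simp add: psubset_card_mono)
  qed
  ultimately show ?thesis
    using arc_poly_full_rank[OF n P0 yz, of deg pair_weight_mono r] rank
    by (simp add: deg_def lookup_add sum.distrib)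
qed

text \<open>Here the grading is the degree in the single formal variable that belongs to
  \<open>P0\<close>.\<close>

lemma fhat_indep_full_rank:
  assumes n: "even n" "n \<ge> 2" and P0: "P0 \<in> arc_pairings n"
    and yz: "\<And>p. p \<in> P0 \<Longrightarrow> p = {y p, z p} \<and> y p \<noteq> z p"
    and rank: "rank_le r (Pow P0) (split_coeff (fhat_indep n :: 'f::field ratfun mpoly) P0 y z)"
  shows "2 ^ card P0 \<le> r"
proof -
  note pu = pairs_up_arc_pairings[OF n]
  let ?\<mu> = "\<lambda>P. Poly_Mapping.single (indep_index P) (1::nat)"
  define deg where "deg m = Poly_Mapping.lookup m (indep_index P0)" for m :: "nat \<Rightarrow>\<^sub>0 nat"
  have inj: "indep_index P = indep_index P0 \<longleftrightarrow> P = P0" if P: "P \<in> arc_pairings n" for P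
  proof -
    have fin: "finite P" "finite P0" using pu P P0 by (auto simp: pairs_up_def)
    have finp: "\<forall>p\<in>P \<union> P0. finite p"
      using pu[OF P] pu[OF P0] by (auto simp: pairs_up_def intro: card_ge_0_finite)
    have "inj_on set_encode (P \<union> P0)"
      using finp by (intro inj_onI) (simp add: set_encode_eq)
    then have "set_encode ` P = set_encode ` P0 \<longleftrightarrow> P = P0"
      by (rule inj_on_image_eq_iff) auto
    then show ?thesis using fin by (simp add: indep_index_def set_encode_eq)
  qed
  have "fhat_indep n = arc_poly (\<lambda>P. to_fract (Poly_Mapping.single (?\<mu> P) 1) :: 'f ratfun) n"
    by (simp add: fhat_indep_def rvar_def mvar_def to_fract_def)
  moreover have "deg (?\<mu> P) < deg (?\<mu> P0)" if "P \<in> arc_pairings n" "P \<noteq> P0" for P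
    using inj[OF that(1)] that(2) by (simp add: deg_def lookup_single)
  ultimately show ?thesis
    using arc_poly_full_rank[OF n P0 yz, of deg ?\<mu> r] rank
    by (simp add: deg_def lookup_add)
qed

section \<open>The lower bound for sums of ROABPs\<close>

lemma rank_le_mono:
  assumes "rank_le r D M" "r \<le> r'"
  shows "rank_le r' D M"
proof -
  obtain \<phi> \<psi> where "\<And>W W'. W \<in> D \<Longrightarrow> W' \<in> D \<Longrightarrow> M W W' = (\<Sum>k<r. \<phi> (k::nat) W * \<psi> k W')"
    using assms(1) unfolding rank_le_def by blast
  then show ?thesis using assms(2) by (intro rank_leI[of "{..<r}"]) auto
qed

lemma split_coeff_sum:
  "split_coeff (\<Sum>i<s. g i) P y z = (\<lambda>W W'. \<Sum>i<s. split_coeff (g i) P y z W W')"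
  by (simp add: split_coeff_def lookup_sum fun_eq_iff)

lemma orient_pair:
  assumes "pairs_up P A" "p \<in> P"
  shows "p = {orient_y X p, orient_z X p} \<and> orient_y X p \<noteq> orient_z X p"
  using pairs_up_elim(1,2)[OF assms] by (auto simp: orient_y_def orient_z_def insert_commute)

lemma imbalance_le_card:
  assumes "finite P"
  shows "\<bar>imbalance P X C\<bar> \<le> int (card P)"
proof -
  have "card {p \<in> P. f p \<in> C} \<le> card P" for f :: "nat set \<Rightarrow> nat"
    using assms by (intro card_mono) auto
  from this[of "orient_y X"] this[of "orient_z X"] show ?thesis by (simp add: imbalance_def)
qed

lemma card_block_class_le:
  assumes pos: "bij_betw pos {..<n} {..<n}" and w: "w > 0"
  shows "card {v \<in> {..<n}. pos v div w = c} \<le> w"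
proof -
  have "card {v \<in> {..<n}. pos v div w = c} \<le> card {c * w..<c * w + w}"
  proof (rule card_inj_on_le)
    show "inj_on pos {v \<in> {..<n}. pos v div w = c}"
      using pos by (auto simp: bij_betw_def inj_on_def)
    show "pos ` {v \<in> {..<n}. pos v div w = c} \<subseteq> {c * w..<c * w + w}"
      using w by (auto simp: div_nat_eqI dividend_less_div_times add.commute)
  qed simp
  then show ?thesis by simp
qed

lemma roabp_sum_lower_bound:
  fixes f :: "'c::field mpoly"
  assumes n: "even n" "2 + 4 * m * N \<le> n" and w: "w > 0" "m = 4 * w"
    and J: "(n div w + 1) * (4 * t\<^sup>2) \<le> J * w"
    and full: "\<And>P y z r. P \<in> arc_pairings n \<Longrightarrow> (\<And>p. p \<in> P \<Longrightarrow> p = {y p, z p} \<and> y p \<noteq> z p) \<Longrightarrow>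
      rank_le r (Pow P) (split_coeff f P y z) \<Longrightarrow> 2 ^ card P \<le> r"
    and sum: "sum_of_ROABPs K n S s f"
    and s: "real s * 2 ^ J * (15 / 16) ^ N < 1"
  shows "2 ^ t \<le> s * S"
proof -
  obtain g where f: "f = (\<Sum>i<s. g i)" and g: "\<And>i. i < s \<Longrightarrow> ROABP_computable K n S (g i)"
    using sum unfolding sum_of_ROABPs_def by blast
  then have "\<forall>i. \<exists>A. i < s \<longrightarrow> is_abp K n A \<and> read_once_oblivious A \<and> abp_size A \<le> S \<and> abp_poly A = g i"
    unfolding ROABP_computable_def by blast
  then obtain A where A: "\<And>i. i < s \<Longrightarrow> is_abp K n (A i)" "\<And>i. i < s \<Longrightarrow> read_once_oblivious (A i)"
    "\<And>i. i < s \<Longrightarrow> abp_size (A i) \<le> S" "\<And>i. i < s \<Longrightarrow> abp_poly (A i) = g i" by metis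
  have "\<forall>i. \<exists>pos. i < s \<longrightarrow> bij_betw pos {..<n} {..<n} \<and> (\<forall>k. \<exists>l\<le>layer (A i) (snk (A i)). \<forall>u v x.
    (u, v) \<in> edges (A i) \<longrightarrow> lab (A i) (u, v) = Var x \<longrightarrow> x < n \<and> (layer (A i) u < l \<longleftrightarrow> pos x < k))"
    using read_once_oblivious_order[OF A(1,2)] by blast
  then obtain pos where pos: "\<And>i. i < s \<Longrightarrow> bij_betw (pos i) {..<n} {..<n}"
    and cut: "\<And>i k. i < s \<Longrightarrow> \<exists>l\<le>layer (A i) (snk (A i)). \<forall>u v x.
    (u, v) \<in> edges (A i) \<longrightarrow> lab (A i) (u, v) = Var x \<longrightarrow> x < n \<and> (layer (A i) u < l \<longleftrightarrow> pos i x < k)"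
    by metis
  define col where "col i v = pos i v div w" for i v
  have "\<exists>P\<in>arc_pairings n. \<exists>X\<subseteq>P. \<forall>j<s. \<exists>c<n div w + 1. int t \<le> \<bar>imbalance P X {v. col j v \<le> c}\<bar>"
  proof (rule exists_imbalanced_orientation[OF n w _ _ J s])
    fix j v assume "j < s" "v < n"
    then have "pos j v < n" using pos[of j] by (auto simp: bij_betw_def)
    then show "col j v < n div w + 1" unfolding col_def by (simp add: div_le_mono less_Suc_eq_le)
  next
    fix j c assume "j < s"
    then show "card {v \<in> {..<n}. col j v = c} \<le> w"
      unfolding col_def by (intro card_block_class_le pos w)
  qed
  then obtain P X where P: "P \<in> arc_pairings n"
    and imb: "\<And>j. j < s \<Longrightarrow> \<exists>c. int t \<le> \<bar>imbalance P X {v. col j v \<le> c}\<bar>" by blast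
  have pu: "pairs_up P {..<n}" using pairs_up_arc_pairings P n by simp
  then have finP: "finite P" by (simp add: pairs_up_def)
  have "rank_le (S * 2 ^ (card P - t)) (Pow P) (split_coeff (g i) P (orient_y X) (orient_z X))"
    if i: "i < s" for i
  proof -
    obtain c where c: "int t \<le> \<bar>imbalance P X {v. col i v \<le> c}\<bar>" using imb[OF i] by blast
    obtain l where l: "l \<le> layer (A i) (snk (A i))" and lc: "\<And>u v x. (u, v) \<in> edges (A i) \<Longrightarrow>
        lab (A i) (u, v) = Var x \<Longrightarrow> layer (A i) u < l \<longleftrightarrow> pos i x < (c + 1) * w"
      using cut[OF i, of "(c + 1) * w"] by blast
    have "pos i x < (c + 1) * w \<longleftrightarrow> x \<in> {v. col i v \<le> c}" for x
      using div_less_iff_less_mult[OF w(1), of "pos i x" "c + 1"] by (simp add: col_def less_Suc_eq_le)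
    then have "rank_le (abp_size (A i) * 2 ^ (card P - t)) (Pow P)
        (split_coeff (abp_poly (A i)) P (orient_y X) (orient_z X))"
      using lc c by (intro rank_le_abp[where C = "{v. col i v \<le> c}", OF A(1)[OF i] l _ finP]) (simp_all add: imbalance_def)
    then show ?thesis
      unfolding A(4)[OF i] by (rule rank_le_mono) (simp add: A(3)[OF i])
  qed
  then have "rank_le (s * (S * 2 ^ (card P - t))) (Pow P) (split_coeff f P (orient_y X) (orient_z X))"
    unfolding f split_coeff_sum by (rule rank_le_sum)
  from full[OF P orient_pair[OF pu] this]
  have le: "2 ^ card P \<le> s * S * 2 ^ (card P - t)" by (simp add: mult.assoc)
  \<comment> \<open>Some program must exist to give an imbalance of at least \<open>t\<close>; this
    yields \<open>t \<le> card P\<close>, so that \<open>card P - t\<close> is not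
    truncated.\<close>
  have "s \<noteq> 0"
  proof
    assume "s = 0"
    then show False using le by simp
  qed
  then obtain c where "int t \<le> \<bar>imbalance P X {v. col 0 v \<le> c}\<bar>" using imb[of 0] by blast
  then have "t \<le> card P" using imbalance_le_card[OF finP, of X "{v. col 0 v \<le> c}"] by linarith
  then have "2 ^ card P = 2 ^ t * (2 ^ (card P - t) :: nat)" by (simp flip: power_add)
  with le have "2 ^ t * 2 ^ (card P - t) \<le> s * S * (2 ^ (card P - t) :: nat)" by simp
  then show ?thesis by simp
qed

text \<open>With \<open>e\<close> the power of \<open>n\<close>, the term \<open>- 1 / 2\<close>
  pays for rounding \<open>e\<close> down to \<open>t\<close>:
  \<open>exp (e / 4) * exp (e / 4 - 1 / 2) = exp ((e - 1) / 2)\<close>, which is at most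
  \<open>2 ^ t\<close>.\<close>

lemma eventually_poly_le_exp:
  "\<forall>\<^sub>F n in sequentially. C * real n ^ k \<le> exp (real n powr (1 / 1000) / 4 - 1 / 2)"
  by real_asymp

text \<open>The constant is \<open>600 * 2000\<close>: 2000 comes from
  \<open>w = 2000 * t^2\<close>, and 600 from the margin between the gain of the blocks and the cost
  of the colours.\<close>

lemma eventually_block_count:
  "\<forall>\<^sub>F n in sequentially. real n powr (1 / 1000) / 4 + 3
     < real n / (1200000 * (real n powr (1 / 1000))\<^sup>2)"
  by real_asymp

text \<open>
  With \<open>w = 2000 t\<^sup>2\<close> the colours cost a factor \<open>2 ^ J\<close> with \<open>J\<close> about \<open>n / (500 w)\<close>, less than what
  the \<open>N\<close>, about \<open>n / (16 w)\<close>, blocks gain.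
\<close>

lemma roabp_sum_exponential:
  fixes f :: "'c::field mpoly"
  assumes n: "even n" "n \<ge> 2"
    and poly: "C * real n ^ k \<le> exp (real n powr (1 / 1000) / 4 - 1 / 2)" "real S \<le> C * real n ^ k"
    and blocks: "real n powr (1 / 1000) / 4 + 3 < real n / (1200000 * (real n powr (1 / 1000))\<^sup>2)"
    and full: "\<And>P y z r. P \<in> arc_pairings n \<Longrightarrow> (\<And>p. p \<in> P \<Longrightarrow> p = {y p, z p} \<and> y p \<noteq> z p) \<Longrightarrow>
      rank_le r (Pow P) (split_coeff f P y z) \<Longrightarrow> 2 ^ card P \<le> r"
    and sum: "sum_of_ROABPs K n S s f"
  shows "exp (1 / 4 * real n powr (1 / 1000)) \<le> real s"
proof (rule ccontr)
  define e where "e = real n powr (1 / 1000)"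
  assume "\<not> ?thesis"
  then have s: "real s < exp (e / 4)" by (simp add: e_def)
  define t where "t = nat \<lfloor>e\<rfloor>"
  define w where "w = 2000 * t\<^sup>2"
  define m where "m = 4 * w"
  define N where "N = (n - 2) div (4 * m)"
  define J where "J = (n div w + 1) div 500 + 1"
  have "e \<ge> 1" unfolding e_def using n by (intro ge_one_powr_ge_zero) auto
  then have t: "1 \<le> t" "real t \<le> e" "e - 1 \<le> real t"
    unfolding t_def by (linarith | simp add: le_nat_floor)+
  have w: "w > 0" using t by (simp add: w_def)
  define x where "x = real n / real w"
  have "real w \<le> 2000 * e\<^sup>2"
    using t by (simp add: w_def power_mono)
  then have "real n / (2000 * e\<^sup>2) \<le> x"
    unfolding x_def using w n \<open>e \<ge> 1\<close> by (intro divide_left_mono) auto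
  then have x: "e / 4 + 3 < x / 600"
    using blocks unfolding e_def[symmetric] by (simp add: field_simps)
  have nw: "real (n div w) \<le> x" unfolding x_def by (rule of_nat_div_le_of_nat)
  have J_le: "real J \<le> x / 500 + 2"
  proof -
    have "real ((n div w + 1) div 500) \<le> real (n div w + 1) / 500"
      using of_nat_div_le_of_nat[of "n div w + 1" 500, where 'a = real] by simp
    then show ?thesis using nw by (simp add: J_def)
  qed
  have N_ge: "x / 16 - 2 \<le> real N"
  proof -
    have "real (n - 2) / real (4 * m) - 1 \<le> real N"
      unfolding N_def using floor_divide_of_nat_eq[of "n - 2" "4 * m", where 'a = real] by linarith
    moreover have "real (n - 2) / real (4 * m) = x / 16 - 1 / (8 * real w)"
      using n w by (simp add: x_def m_def of_nat_diff field_simps)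
    moreover have "1 / (8 * real w) \<le> 1" using w by (simp add: field_simps)
    ultimately show ?thesis by linarith
  qed
  have "2 ^ t \<le> s * S"
  proof (rule roabp_sum_lower_bound[OF n(1) _ w m_def _ full sum])
    have "4 * m * N \<le> n - 2" unfolding N_def by simp
    then show "2 + 4 * m * N \<le> n" using n by simp
    have "a \<le> 500 * (a div 500 + 1)" for a :: nat
      using dividend_less_times_div[of 500 a] by simp
    then have "n div w + 1 \<le> 500 * J" unfolding J_def by blast
    then have "(n div w + 1) * (4 * t\<^sup>2) \<le> 500 * J * (4 * t\<^sup>2)" by (rule mult_le_mono1)
    then show "(n div w + 1) * (4 * t\<^sup>2) \<le> J * w" by (simp add: w_def)
    have "(2 :: real) \<le> exp 1" using exp_ge_add_one_self[of 1] by simp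
    then have "(2 :: real) ^ J \<le> exp 1 ^ J" by (rule power_mono) simp
    then have p2: "(2 :: real) ^ J \<le> exp (real J)" by (simp flip: exp_of_nat_mult)
    have "(15 / 16 :: real) \<le> exp (- 1 / 16)" using exp_ge_add_one_self[of "- 1 / 16"] by simp
    then have "(15 / 16 :: real) ^ N \<le> exp (- 1 / 16) ^ N" by (rule power_mono) simp
    then have pN: "(15 / 16 :: real) ^ N \<le> exp (- real N / 16)" by (simp flip: exp_of_nat_mult)
    have "real s * 2 ^ J * (15 / 16) ^ N \<le> exp (e / 4) * exp (real J) * exp (- real N / 16)"
      using s p2 pN by (intro mult_mono) auto
    also have "\<dots> = exp (e / 4 + real J - real N / 16)" by (simp flip: exp_add)
    also have "\<dots> < 1"
    proof -
      have "x \<ge> 0" by (simp add: x_def)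
      \<comment> \<open>The blocks gain about \<open>x / 256\<close> in the exponent and the colours
        cost about \<open>x / 500\<close>. The difference exceeds \<open>x / 600\<close>, which by
        assumption covers \<open>e / 4\<close> and the rounding terms.\<close>
      then have "e / 4 + real J - real N / 16 < 0" using x J_le N_ge by argo
      then show ?thesis by simp
    qed
    finally show "real s * 2 ^ J * (15 / 16) ^ N < 1" .
  qed
  then have "(2 :: real) ^ t \<le> real s * real S" by (metis of_nat_le_iff of_nat_mult of_nat_numeral of_nat_power)
  also have "\<dots> < exp (e / 4) * exp (e / 4 - 1 / 2)"
  proof -
    have S: "real S \<le> exp (e / 4 - 1 / 2)" using poly unfolding e_def by linarith
    have "real s * real S \<le> real s * exp (e / 4 - 1 / 2)" using S by (rule mult_left_mono) simp
    also have "\<dots> < exp (e / 4) * exp (e / 4 - 1 / 2)" using s by (rule mult_strict_right_mono) simp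
    finally show ?thesis .
  qed
  also have "\<dots> = exp ((e - 1) / 2)" by (simp add: diff_divide_distrib flip: exp_add)
  also have "\<dots> \<le> exp (real t * ln 2)"
  proof -
    have "(e - 1) / 2 \<le> real t * (1 / 2)" using t by simp
    also have "\<dots> \<le> real t * ln 2" using ln2_ge_two_thirds by (intro mult_left_mono) auto
    finally show ?thesis by simp
  qed
  also have "\<dots> = 2 ^ t" by (simp add: exp_of_nat_mult)
  finally show False by simp
qed

text \<open>The value \<open>1 / 4\<close> of \<open>\<delta>\<close> serves every polynomial size
  bound; only the threshold for \<open>n\<close> depends on it.\<close>

lemma fhat_roabp_sum_lower_bound:
  "(\<exists>\<epsilon>::real. 0 < \<epsilon> \<and> \<epsilon> < 1 / 500 \<and>
            (\<forall>S. poly_bounded S \<longrightarrow>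
               (\<exists>\<delta>>0. \<forall>\<^sub>F n in sequentially. even n \<longrightarrow>
                  (\<forall>s. sum_of_ROABPs (fhat_field n) n (S n) s (fhat n :: 'f::field ratfun mpoly) \<or>
                       sum_of_ROABPs (fhat_indep_field n) n (S n) s (fhat_indep n :: 'f ratfun mpoly)
                       \<longrightarrow> exp (\<delta> * real n powr \<epsilon>) \<le> real s))))"
proof (rule exI[of _ "1 / 1000"], intro conjI allI impI)
  fix S assume "poly_bounded S"
  then obtain k where "(\<lambda>n. real (S n)) \<in> O(\<lambda>n. real n ^ k)" unfolding poly_bounded_def by blast
  then obtain C where C: "\<forall>\<^sub>F n in sequentially. norm (real (S n)) \<le> C * norm (real n ^ k)"
    unfolding bigo_def by blast
  have "\<forall>\<^sub>F n in sequentially. even n \<longrightarrow>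
     (\<forall>s. sum_of_ROABPs (fhat_field n) n (S n) s (fhat n :: 'f::field ratfun mpoly) \<or>
          sum_of_ROABPs (fhat_indep_field n) n (S n) s (fhat_indep n :: 'f ratfun mpoly)
          \<longrightarrow> exp (1 / 4 * real n powr (1 / 1000)) \<le> real s)"
    using C eventually_poly_le_exp[of C k] eventually_block_count eventually_ge_at_top[of 2]
  proof eventually_elim
    case (elim n)
    have S: "real (S n) \<le> C * real n ^ k" using elim(1) by simp
    show ?case
    proof (intro impI allI, elim disjE)
      fix s assume n: "even n"
      assume "sum_of_ROABPs (fhat_field n) n (S n) s (fhat n :: 'f ratfun mpoly)"
      then show "exp (1 / 4 * real n powr (1 / 1000)) \<le> real s"
        using roabp_sum_exponential[OF n elim(4,2) S elim(3)] fhat_full_rank[OF n elim(4)] by blast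
    next
      fix s assume n: "even n"
      assume "sum_of_ROABPs (fhat_indep_field n) n (S n) s (fhat_indep n :: 'f ratfun mpoly)"
      then show "exp (1 / 4 * real n powr (1 / 1000)) \<le> real s"
        using roabp_sum_exponential[OF n elim(4,2) S elim(3)] fhat_indep_full_rank[OF n elim(4)] by blast
    qed
  qed
  then show "\<exists>\<delta>>0. \<forall>\<^sub>F n in sequentially. even n \<longrightarrow>
     (\<forall>s. sum_of_ROABPs (fhat_field n) n (S n) s (fhat n :: 'f ratfun mpoly) \<or>
          sum_of_ROABPs (fhat_indep_field n) n (S n) s (fhat_indep n :: 'f ratfun mpoly)
          \<longrightarrow> exp (\<delta> * real n powr (1 / 1000)) \<le> real s)"
    by (intro exI[of _ "1 / 4"]) simp
qed simp_all

section \<open>A multilinear branching program\<close>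

text \<open>Paths run to the sink rather than from the source, so that the recursion over outgoing
  edges matches the recursion of the matchings on the interval still to be paired.\<close>

definition path_poly :: "'c::comm_semiring_1 abp \<Rightarrow> nat \<Rightarrow> 'c mpoly" where
  "path_poly A v = (\<Sum>p\<in>paths_between (edges A) v (snk A). prod_list (map label_poly (path_labels A p)))"

lemma paths_between_Cons:
  assumes "u \<noteq> t"
  shows "paths_between E u t = (\<Union>w\<in>{w. (u, w) \<in> E}. (#) u ` paths_between E w t)"
proof (intro equalityI subsetI)
  fix p assume p: "p \<in> paths_between E u t"
  then obtain q where q: "p = u # q" by (cases p) (auto simp: paths_between_def)
  then obtain w r where "q = w # r" using p assms by (cases q) (auto simp: paths_between_def)
  then show "p \<in> (\<Union>w\<in>{w. (u, w) \<in> E}. (#) u ` paths_between E w t)"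
    using p q by (auto simp: paths_between_def)
next
  fix p assume "p \<in> (\<Union>w\<in>{w. (u, w) \<in> E}. (#) u ` paths_between E w t)"
  then obtain w q where "(u, w) \<in> E" "q \<in> paths_between E w t" "p = u # q" by blast
  then show "p \<in> paths_between E u t"
    by (cases q) (auto simp: paths_between_def)
qed

lemma path_poly_snk:
  assumes layered: "\<And>a b. (a, b) \<in> edges A \<Longrightarrow> lay b = Suc (lay a)"
  shows "path_poly A (snk A) = 1"
proof -
  have "paths_between (edges A) (snk A) (snk A) = {[snk A]}"
  proof (intro equalityI subsetI)
    fix p assume p: "p \<in> paths_between (edges A) (snk A) (snk A)"
    then have "length p = 1" using length_path_between[where lay = lay, OF layered p] by simp
    then show "p \<in> {[snk A]}" using p by (auto simp: paths_between_def length_Suc_conv)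
  qed (simp add: paths_between_def)
  then show ?thesis by (simp add: path_poly_def path_labels_def)
qed

lemma path_poly_step:
  assumes layered: "\<And>a b. (a, b) \<in> edges A \<Longrightarrow> lay b = Suc (lay a)"
    and fin: "finite N" "edges A \<subseteq> N \<times> N" and v: "v \<noteq> snk A"
  shows "path_poly A v = (\<Sum>w\<in>{w. (v, w) \<in> edges A}. label_poly (lab A (v, w)) * path_poly A w)"
proof -
  let ?E = "edges A" and ?t = "snk A"
  let ?W = "{w. (v, w) \<in> ?E}"
  let ?m = "\<lambda>p. prod_list (map label_poly (path_labels A p))"
  have finp: "finite (paths_between ?E w ?t)" for w
    by (rule finite_paths_between[where lay = lay, OF layered fin])
  have finW: "finite ?W" using fin by (auto intro: finite_subset[of _ N])
  have "path_poly A v = (\<Sum>p\<in>(\<Union>w\<in>?W. (#) v ` paths_between ?E w ?t). ?m p)"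
    unfolding path_poly_def paths_between_Cons[OF v] ..
  also have "\<dots> = (\<Sum>w\<in>?W. \<Sum>p\<in>(#) v ` paths_between ?E w ?t. ?m p)"
    by (rule sum.UNION_disjoint) (use finW finp in \<open>auto simp: paths_between_def\<close>)
  also have "\<dots> = (\<Sum>w\<in>?W. \<Sum>p\<in>paths_between ?E w ?t. ?m (v # p))"
    by (rule sum.cong[OF refl]) (simp add: sum.reindex)
  also have "\<dots> = (\<Sum>w\<in>?W. \<Sum>p\<in>paths_between ?E w ?t. label_poly (lab A (v, w)) * ?m p)"
  proof (intro sum.cong refl)
    fix w p assume "p \<in> paths_between ?E w ?t"
    then have "path_labels A (v # p) = lab A (v, w) # path_labels A p"
      by (cases p) (auto simp: paths_between_def path_labels_def)
    then show "?m (v # p) = label_poly (lab A (v, w)) * ?m p" by simp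
  qed
  finally show ?thesis by (simp add: path_poly_def sum_distrib_left)
qed

text \<open>\<open>avail v\<close> is the stock of variables that may still be read after
  \<open>v\<close>: it never grows along an edge, and an edge that reads a variable removes
  it.\<close>

lemma syntactic_multilinearI:
  assumes "\<And>u v. (u, v) \<in> edges A \<Longrightarrow> avail v \<subseteq> avail u"
    and "\<And>u v i. (u, v) \<in> edges A \<Longrightarrow> lab A (u, v) = Var i \<Longrightarrow> i \<in> avail u - avail v"
  shows "syntactic_multilinear A"
proof -
  have count: "count_list (path_labels A p) (Var i) \<le> of_bool (i \<in> avail (hd p))"
    if "p \<noteq> []" "successively (\<lambda>u v. (u, v) \<in> edges A) p" for p i
    using that
  proof (induction p)
    case (Cons u p)
    show ?case
    proof (cases p)
      case Nil
      then show ?thesis by (simp add: path_labels_def)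
    next
      case (Cons v q)
      then have e: "(u, v) \<in> edges A" and IH: "count_list (path_labels A p) (Var i) \<le> of_bool (i \<in> avail v)"
        using Cons.IH Cons.prems by auto
      have "path_labels A (u # p) = lab A (u, v) # path_labels A p"
        using Cons by (simp add: path_labels_def)
      then show ?thesis
        using IH assms(1)[OF e] assms(2)[OF e, of i] by (auto simp: of_bool_def split: if_splits)
    qed
  qed simp
  show ?thesis
    unfolding syntactic_multilinear_def abp_paths_def
  proof (intro ballI allI)
    fix p i assume "p \<in> {p. p \<noteq> [] \<and> hd p = src A \<and> last p = snk A \<and> successively (\<lambda>u v. (u, v) \<in> edges A) p}"
    then have "count_list (path_labels A p) (Var i) \<le> of_bool (i \<in> avail (hd p))"
      by (intro count) simp_all
    also have "\<dots> \<le> 1" by simp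
    finally show "count_list (path_labels A p) (Var i) \<le> 1" .
  qed
qed

text \<open>If the pair occurs at all, the first step can take it: a cross step would pair
  \<open>lo\<close> with the far end, and a left step taken earlier commutes with the right step.
  With only two points left all three steps agree.\<close>

lemma arc_matchings_first_pair:
  "{lo, lo + 1} \<in> Q \<and> Q \<in> arc_matchings (Suc k) lo \<longleftrightarrow> Q \<in> insert {lo, lo + 1} ` arc_matchings k (lo + 2)"
proof
  show "Q \<in> insert {lo, lo + 1} ` arc_matchings k (lo + 2)"
    if "{lo, lo + 1} \<in> Q \<and> Q \<in> arc_matchings (Suc k) lo"
    using that
  proof (induction k arbitrary: Q)
    case 0
    then show ?case by auto
  next
    case (Suc k)
    consider "Q \<in> insert {lo, lo + 1} ` arc_matchings (Suc k) (lo + 2)"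
      | Q' where "Q = insert {lo, lo + 2 * Suc k + 1} Q'" "Q' \<in> arc_matchings (Suc k) (lo + 1)"
      | Q' where "Q = insert {lo + 2 * Suc k, lo + 2 * Suc k + 1} Q'" "Q' \<in> arc_matchings (Suc k) lo"
      using Suc.prems unfolding arc_matchings.simps(2)[of "Suc k" lo] by blast
    then show ?case
    proof cases
      case 2
      have "\<Union>Q' = {lo + 1..<lo + 1 + 2 * Suc k}"
        using pairs_up_arc_matchings[OF 2(2)] by (simp add: pairs_up_def)
      then have "{lo, lo + 1} \<notin> Q'" by (metis UnionI atLeastLessThan_iff insertI1 not_less_eq_eq Suc_eq_plus1 order_refl)
      moreover have "{lo, lo + 1} \<noteq> {lo, lo + 2 * Suc k + 1}" by (simp add: doubleton_eq_iff)
      ultimately show ?thesis using Suc.prems 2(1) by simp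
    next
      case 3
      have "{lo, lo + 1} \<noteq> {lo + 2 * Suc k, lo + 2 * Suc k + 1}" by (simp add: doubleton_eq_iff)
      then have "{lo, lo + 1} \<in> Q'" using Suc.prems 3(1) by simp
      then obtain R where R: "Q' = insert {lo, lo + 1} R" "R \<in> arc_matchings k (lo + 2)"
        using Suc.IH[of Q'] 3(2) by blast
      let ?p = "{lo + 2 + 2 * k, lo + 2 + 2 * k + 1}"
      have "insert ?p R \<in> arc_matchings (Suc k) (lo + 2)" using R(2) by auto
      moreover have "Q = insert {lo, lo + 1} (insert ?p R)"
        using 3(1) R(1) by (simp add: insert_commute)
      ultimately show ?thesis by blast
    qed
  qed
qed auto

text \<open>
  Different sequences of steps yield the same pairing, so a branching program that follows the process
  would count pairings several times. The flag makes the steps unique: a left step, taken only from flags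
  \<open>0\<close> and \<open>1\<close>, promises that \<open>lo\<close> will not be paired with its neighbour (flag \<open>1\<close>), and flag \<open>2\<close>
  forces this pair.
\<close>

definition flagged_matchings :: "nat \<Rightarrow> nat \<Rightarrow> nat \<Rightarrow> pairing set" where
  "flagged_matchings k lo fl = {Q \<in> arc_matchings k lo.
     (fl = 1 \<longrightarrow> {lo, lo + 1} \<notin> Q) \<and> (fl = 2 \<longrightarrow> {lo, lo + 1} \<in> Q)}"

lemma flagged_matchings_0: "flagged_matchings k lo 0 = arc_matchings k lo"
  by (simp add: flagged_matchings_def)

lemma flagged_matchings_2: "flagged_matchings (Suc k) lo 2 = insert {lo, lo + 1} ` flagged_matchings k (lo + 2) 0"
  using arc_matchings_first_pair[of lo _ k] by (auto simp: flagged_matchings_def simp del: arc_matchings.simps)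

text \<open>The guards exclude the small cases: with two points the cross pair is itself the
  forbidden \<open>{lo, lo + 1}\<close>, and with four points a left step leaves only that
  pair.\<close>

lemma flagged_matchings_1:
  "flagged_matchings (Suc k) lo 1 =
     (if 1 \<le> k then insert {lo, lo + 2 * k + 1} ` flagged_matchings k (lo + 1) 0 else {}) \<union>
     (if 2 \<le> k then insert {lo + 2 * k, lo + 2 * k + 1} ` flagged_matchings k lo 1 else {})"
proof (cases "k = 0")
  case True
  then show ?thesis by (auto simp: flagged_matchings_def)
next
  case False
  have C: "{lo, lo + 1} \<notin> insert {lo, lo + 2 * k + 1} Q" if "Q \<in> arc_matchings k (lo + 1)" for Q
  proof -
    have "\<Union>Q = {lo + 1..<lo + 1 + 2 * k}"
      using pairs_up_arc_matchings[OF that] by (simp add: pairs_up_def)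
    then have "{lo, lo + 1} \<notin> Q" by (metis UnionI atLeastLessThan_iff insertI1 not_less_eq_eq Suc_eq_plus1 order_refl)
    then show ?thesis using False by (simp add: doubleton_eq_iff)
  qed
  have L: "{lo, lo + 1} \<in> insert {lo + 2 * k, lo + 2 * k + 1} Q \<longleftrightarrow> {lo, lo + 1} \<in> Q" for Q
    using False by (simp add: doubleton_eq_iff)
  have filter: "{Q \<in> insert p ` A \<union> f ` B \<union> g ` D. p \<notin> Q} = f ` B \<union> g ` {Q \<in> D. p \<notin> Q}"
    if "\<And>Q. Q \<in> B \<Longrightarrow> p \<notin> f Q" "\<And>Q. p \<in> g Q \<longleftrightarrow> p \<in> Q"
    for p :: "nat set" and A B D and f g :: "pairing \<Rightarrow> pairing"
    using that by auto
  have "flagged_matchings (Suc k) lo 1 = {Q \<in> arc_matchings (Suc k) lo. {lo, lo + 1} \<notin> Q}"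
    unfolding flagged_matchings_def by (simp del: arc_matchings.simps)
  also have "\<dots> = insert {lo, lo + 2 * k + 1} ` arc_matchings k (lo + 1) \<union>
     insert {lo + 2 * k, lo + 2 * k + 1} ` {Q \<in> arc_matchings k lo. {lo, lo + 1} \<notin> Q}"
    unfolding arc_matchings.simps(2) by (rule filter[OF C L])
  also have "{Q \<in> arc_matchings k lo. {lo, lo + 1} \<notin> Q} = flagged_matchings k lo 1"
    by (simp add: flagged_matchings_def)
  also have "insert {lo + 2 * k, lo + 2 * k + 1} ` flagged_matchings k lo 1 =
      (if 2 \<le> k then insert {lo + 2 * k, lo + 2 * k + 1} ` flagged_matchings k lo 1 else {})"
  proof (cases "2 \<le> k")
    case False
    then have "k = 1" using \<open>k \<noteq> 0\<close> by simp
    then show ?thesis by (auto simp: flagged_matchings_def)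
  qed simp
  finally show ?thesis using False by (simp add: flagged_matchings_0)
qed

lemma flagged_matchings_split:
  "flagged_matchings k lo 0 = flagged_matchings k lo 1 \<union> flagged_matchings k lo 2"
  "flagged_matchings k lo 1 \<inter> flagged_matchings k lo 2 = {}"
  by (auto simp: flagged_matchings_def)

text \<open>No admissible step is a dead end. Hence the pair it takes occurs in some arc pairing,
  and its weight is a constant the program may use.\<close>

lemma flagged_matchings_nonempty:
  assumes "fl = 1 \<longrightarrow> 2 \<le> k" "fl = 2 \<longrightarrow> 1 \<le> k"
  shows "flagged_matchings k lo fl \<noteq> {}"
proof -
  consider "fl = 1" | "fl = 2" | "fl \<noteq> 1" "fl \<noteq> 2" by blast
  then show ?thesis
  proof cases
    case 1
    then obtain j where "k = Suc j" "1 \<le> j" using assms by (cases k) auto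
    then show ?thesis using 1 arc_matchings_nonempty[of j "lo + 1"]
      by (simp add: flagged_matchings_1[unfolded One_nat_def] flagged_matchings_0)
  next
    case 2
    then obtain j where "k = Suc j" using assms by (cases k) auto
    then show ?thesis using 2 arc_matchings_nonempty[of j "lo + 2"]
      by (simp add: flagged_matchings_2 flagged_matchings_0)
  next
    case 3
    then show ?thesis using arc_matchings_nonempty by (simp add: flagged_matchings_def)
  qed
qed

lemma finite_flagged_matchings: "finite (flagged_matchings k lo fl)"
  using finite_arc_matchings by (simp add: flagged_matchings_def)

definition flagged_sum :: "(nat set \<Rightarrow> 'c::comm_semiring_1) \<Rightarrow> nat \<Rightarrow> nat \<Rightarrow> nat \<Rightarrow> 'c" where
  "flagged_sum wt k lo fl = (\<Sum>Q\<in>flagged_matchings k lo fl. \<Prod>p\<in>Q. wt p)"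

lemma sum_insert_pair:
  fixes wt :: "nat set \<Rightarrow> 'c::comm_semiring_1"
  assumes S: "\<And>Q. Q \<in> S \<Longrightarrow> pairs_up Q B" and a: "a \<in> p" "a \<notin> B"
  shows "(\<Sum>Q\<in>insert p ` S. \<Prod>q\<in>Q. wt q) = wt p * (\<Sum>Q\<in>S. \<Prod>q\<in>Q. wt q)"
proof -
  have "p \<notin> Q \<and> finite Q" if "Q \<in> S" for Q
    using S[OF that] a by (auto simp: pairs_up_def)
  moreover from this have "inj_on (insert p) S"
    by (intro inj_onI) (metis Diff_insert_absorb)
  ultimately show ?thesis
    by (simp add: sum.reindex sum_distrib_left)
qed

lemma flagged_sum_step:
  fixes wt :: "nat set \<Rightarrow> 'c::comm_semiring_1"
  assumes "fl \<le> 2"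
  shows "flagged_sum wt (Suc k) lo fl =
     (if fl \<noteq> 1 then wt {lo, lo + 1} * flagged_sum wt k (lo + 2) 0 else 0) +
     (if fl \<noteq> 2 \<and> 1 \<le> k then wt {lo, lo + 2 * k + 1} * flagged_sum wt k (lo + 1) 0 else 0) +
     (if fl \<noteq> 2 \<and> 2 \<le> k then wt {lo + 2 * k, lo + 2 * k + 1} * flagged_sum wt k lo 1 else 0)"
proof -
  have pu: "pairs_up Q {lo'..<lo' + 2 * k}" if "Q \<in> flagged_matchings k lo' f" for Q lo' f
    using that pairs_up_arc_matchings by (simp add: flagged_matchings_def)
  let ?C = "insert {lo, lo + 2 * k + 1} ` flagged_matchings k (lo + 1) 0"
  let ?L = "insert {lo + 2 * k, lo + 2 * k + 1} ` flagged_matchings k lo 1"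
  have R: "(\<Sum>Q\<in>insert {lo, lo + 1} ` flagged_matchings k (lo + 2) 0. \<Prod>p\<in>Q. wt p)
      = wt {lo, lo + 1} * flagged_sum wt k (lo + 2) 0"
    unfolding flagged_sum_def by (rule sum_insert_pair[where a = lo, OF pu]) auto
  have C: "(\<Sum>Q\<in>?C. \<Prod>p\<in>Q. wt p) = wt {lo, lo + 2 * k + 1} * flagged_sum wt k (lo + 1) 0"
    unfolding flagged_sum_def by (rule sum_insert_pair[where a = lo, OF pu]) auto
  have L: "(\<Sum>Q\<in>?L. \<Prod>p\<in>Q. wt p) = wt {lo + 2 * k, lo + 2 * k + 1} * flagged_sum wt k lo 1"
    unfolding flagged_sum_def by (rule sum_insert_pair[where a = "lo + 2 * k", OF pu]) auto
  have two: "flagged_sum wt (Suc k) lo 2 = wt {lo, lo + 1} * flagged_sum wt k (lo + 2) 0"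
    using R by (simp add: flagged_sum_def flagged_matchings_2)
  \<comment> \<open>A matching in both families would pair the last point
    \<open>lo + 2 * k + 1\<close> with two different partners.\<close>
  have disj: "?C \<inter> ?L = {}" if "2 \<le> k"
  proof -
    have "False" if Q: "Q \<in> ?C" "Q \<in> ?L" for Q
    proof -
      have "Q \<in> arc_matchings (Suc k) lo" using Q(1) by (auto simp: flagged_matchings_0)
      then have "disjoint Q" using pairs_up_arc_matchings by (auto simp: pairs_up_def simp del: arc_matchings.simps)
      moreover have ins: "p \<in> Q" if "Q \<in> insert p ` S" for p :: "nat set" and Q S
        using that by auto
      have "{lo, lo + 2 * k + 1} \<in> Q" "{lo + 2 * k, lo + 2 * k + 1} \<in> Q"
        using ins[OF Q(1)] ins[OF Q(2)] .
      moreover have "{lo, lo + 2 * k + 1} \<noteq> {lo + 2 * k, lo + 2 * k + 1}"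
        using \<open>2 \<le> k\<close> by (simp add: doubleton_eq_iff)
      ultimately show False by (auto dest: disjointD)
    qed
    then show ?thesis by blast
  qed
  have one: "flagged_sum wt (Suc k) lo 1 =
     (if 1 \<le> k then wt {lo, lo + 2 * k + 1} * flagged_sum wt k (lo + 1) 0 else 0) +
     (if 2 \<le> k then wt {lo + 2 * k, lo + 2 * k + 1} * flagged_sum wt k lo 1 else 0)"
  proof -
    have "flagged_sum wt (Suc k) lo 1 = (\<Sum>Q\<in>(if 1 \<le> k then ?C else {}) \<union> (if 2 \<le> k then ?L else {}). \<Prod>p\<in>Q. wt p)"
      unfolding flagged_sum_def flagged_matchings_1 ..
    also have "\<dots> = (\<Sum>Q\<in>(if 1 \<le> k then ?C else {}). \<Prod>p\<in>Q. wt p) + (\<Sum>Q\<in>(if 2 \<le> k then ?L else {}). \<Prod>p\<in>Q. wt p)"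
      using disj finite_flagged_matchings by (intro sum.union_disjoint) auto
    finally show ?thesis using C L by simp
  qed
  have zero: "flagged_sum wt (Suc k) lo 0 = flagged_sum wt (Suc k) lo 1 + flagged_sum wt (Suc k) lo 2"
    unfolding flagged_sum_def flagged_matchings_split(1)[of "Suc k" lo]
    by (intro sum.union_disjoint finite_flagged_matchings flagged_matchings_split(2))
  have "fl = 0 \<or> fl = 1 \<or> fl = 2" using assms by auto
  then show ?thesis using zero one two by (elim disjE) (simp_all add: add_ac)
qed

text \<open>
  A node \<open>(k, lo, fl, a)\<close> with \<open>a = 0\<close> computes \<open>flagged_sum\<close>; the nodes \<open>a = 1, \<dots>, 6\<close> behind it read the
  two variables of the right (\<open>1, 2\<close>), cross (\<open>3, 4\<close>) and left (\<open>5, 6\<close>) pair. All states with \<open>k = 0\<close>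
  are merged into the sink.
\<close>

definition node :: "nat \<Rightarrow> nat \<Rightarrow> nat \<Rightarrow> nat \<Rightarrow> nat" where
  "node k lo fl a = (if k = 0 then prod_encode (0, 0) else prod_encode (k, prod_encode (lo, prod_encode (fl, a))))"

definition node_k :: "nat \<Rightarrow> nat" where "node_k v = fst (prod_decode v)"
definition node_lo :: "nat \<Rightarrow> nat" where "node_lo v = fst (prod_decode (snd (prod_decode v)))"
definition node_choice :: "nat \<Rightarrow> nat" where
  "node_choice v = snd (prod_decode (snd (prod_decode (snd (prod_decode v)))))"

lemma node_sel:
  "node_k (node k lo fl a) = k"
  "k \<noteq> 0 \<Longrightarrow> node_lo (node k lo fl a) = lo"
  "k \<noteq> 0 \<Longrightarrow> node_choice (node k lo fl a) = a"
  by (simp_all add: node_def node_k_def node_lo_def node_choice_def)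

lemma node_eq_iff:
  "k \<noteq> 0 \<Longrightarrow> node k lo fl a = node k' lo' fl' a' \<longleftrightarrow> k = k' \<and> lo = lo' \<and> fl = fl' \<and> a = a'"
  by (auto simp: node_def prod_encode_eq)

definition choice_var :: "nat \<Rightarrow> nat \<Rightarrow> nat \<Rightarrow> nat" where
  "choice_var k lo a = (if a = 1 \<or> a = 3 then lo else if a = 2 then lo + 1
     else if a = 5 then lo + 2 * k - 2 else lo + 2 * k - 1)"

definition choice_pair :: "nat \<Rightarrow> nat \<Rightarrow> nat \<Rightarrow> nat set" where
  "choice_pair k lo a = (if a \<le> 2 then {lo, lo + 1} else if a \<le> 4 then {lo, lo + 2 * k - 1}
     else {lo + 2 * k - 2, lo + 2 * k - 1})"

definition next_lo :: "nat \<Rightarrow> nat \<Rightarrow> nat" where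
  "next_lo lo a = (if a \<le> 2 then lo + 2 else if a \<le> 4 then lo + 1 else lo)"

definition next_flag :: "nat \<Rightarrow> nat" where
  "next_flag a = (if a \<le> 4 then 0 else 1)"

text \<open>Always applied to \<open>Suc k\<close>, so the thresholds 2 and 3 are the guards
  \<open>1 \<le> k\<close> and \<open>2 \<le> k\<close> of \<open>flagged_sum_step\<close>.\<close>

definition allowed :: "nat \<Rightarrow> nat \<Rightarrow> nat set" where
  "allowed k fl = (if fl \<noteq> 1 then {1, 2} else {}) \<union>
     (if fl \<noteq> 2 \<and> 2 \<le> k then {3, 4} else {}) \<union> (if fl \<noteq> 2 \<and> 3 \<le> k then {5, 6} else {})"

lemma allowed_cases:
  assumes "a \<in> allowed k fl"
  obtains "a = 1" "fl \<noteq> 1" | "a = 2" "fl \<noteq> 1" | "a = 3" "fl \<noteq> 2" "2 \<le> k" | "a = 4" "fl \<noteq> 2" "2 \<le> k"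
    | "a = 5" "fl \<noteq> 2" "3 \<le> k" | "a = 6" "fl \<noteq> 2" "3 \<le> k"
  using assms by (auto simp: allowed_def split: if_splits)

text \<open>The common set \<open>X\<close> stands for the pairs already taken. It ensures that
  every edge weight belongs to a pair of some arc pairing and so lies in
  \<open>fhat_field n\<close>.\<close>

definition extendable :: "nat \<Rightarrow> nat \<Rightarrow> nat \<Rightarrow> nat \<Rightarrow> bool" where
  "extendable n k lo fl \<longleftrightarrow> lo + 2 * k \<le> n \<and> fl \<le> 2 \<and> (fl = 1 \<longrightarrow> 2 \<le> k) \<and> (fl = 2 \<longrightarrow> 1 \<le> k) \<and>
     (\<exists>X. \<forall>Q\<in>flagged_matchings k lo fl. X \<union> Q \<in> arc_pairings n)"

lemma insert_choice_pair:
  assumes a: "a \<in> allowed (Suc k) fl" and Q: "Q \<in> flagged_matchings k (next_lo lo a) (next_flag a)" and fl: "fl \<le> 2"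
  shows "insert (choice_pair (Suc k) lo a) Q \<in> flagged_matchings (Suc k) lo fl"
proof -
  let ?Q = "insert (choice_pair (Suc k) lo a) Q"
  have up: ?thesis if "?Q \<in> flagged_matchings (Suc k) lo g" "g = 1 \<or> g = 2" "fl = 0 \<or> fl = g" for g
    using that flagged_matchings_split(1)[of "Suc k" lo] by auto
  show ?thesis
  proof (cases "a \<le> 2")
    case True
    then have "fl = 0 \<or> fl = 2" using a fl by (auto elim!: allowed_cases)
    moreover have "?Q \<in> flagged_matchings (Suc k) lo 2"
      using Q True unfolding flagged_matchings_2 by (simp add: choice_pair_def next_lo_def next_flag_def)
    ultimately show ?thesis by (intro up[of 2]) simp_all
  next
    case False
    then have "fl = 0 \<or> fl = 1" "1 \<le> k" "a \<le> 4 \<or> 2 \<le> k" using a fl by (auto elim!: allowed_cases)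
    moreover from this have "?Q \<in> flagged_matchings (Suc k) lo 1"
      using Q False unfolding flagged_matchings_1
      by (cases "a \<le> 4") (simp_all add: choice_pair_def next_lo_def next_flag_def)
    ultimately show ?thesis by (intro up[of 1]) simp_all
  qed
qed

lemma extendable_step:
  assumes e: "extendable n (Suc k) lo fl" and a: "a \<in> allowed (Suc k) fl"
  shows "extendable n k (next_lo lo a) (next_flag a)"
    and "choice_pair (Suc k) lo a \<in> \<Union>(arc_pairings n)"
proof -
  have fl: "fl \<le> 2" and lo: "lo + 2 * Suc k \<le> n" using e by (auto simp: extendable_def)
  obtain X where X: "\<And>Q. Q \<in> flagged_matchings (Suc k) lo fl \<Longrightarrow> X \<union> Q \<in> arc_pairings n"
    using e by (auto simp: extendable_def)
  have flag: "next_flag a = 1 \<longrightarrow> 2 \<le> k" "next_flag a \<noteq> 2" "next_flag a \<le> 2"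
    and lo': "next_lo lo a + 2 * k \<le> n"
    using a lo by (auto elim!: allowed_cases simp: next_flag_def next_lo_def)
  have ext: "insert (choice_pair (Suc k) lo a) X \<union> Q \<in> arc_pairings n"
    if "Q \<in> flagged_matchings k (next_lo lo a) (next_flag a)" for Q
    using X[OF insert_choice_pair[OF a that fl]] by simp
  then show "extendable n k (next_lo lo a) (next_flag a)"
    unfolding extendable_def using flag lo' by blast
  obtain Q where "Q \<in> flagged_matchings k (next_lo lo a) (next_flag a)"
    using flagged_matchings_nonempty[of "next_flag a" k "next_lo lo a"] flag by auto
  from ext[OF this] show "choice_pair (Suc k) lo a \<in> \<Union>(arc_pairings n)" by blast
qed

text \<open>The prescribed initial pair \<open>{0, 1}\<close> is just the forced pair of flag 2 on
  the whole interval, so the program needs no special start.\<close>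

lemma arc_pairings_eq_flagged:
  assumes "even n" "n \<ge> 2"
  shows "arc_pairings n = flagged_matchings (n div 2) 0 2"
proof -
  obtain k where k: "n div 2 = Suc k" using assms by (cases "n div 2") auto
  then show ?thesis
    using arc_pairings_eq[OF assms] flagged_matchings_2[of k 0]
    by (simp add: flagged_matchings_0 numeral_2_eq_2)
qed

text \<open>A step occupies two layers: an edge out of a node with choice 0 reads one variable of
  the pair, and the next edge multiplies by the weight of that pair. This works because the weight
  of a pairing is the product of the weights of its pairs.\<close>

definition arc_abp :: "nat \<Rightarrow> 'f::field ratfun abp" where
  "arc_abp n = \<lparr>
     nodes = (\<lambda>(k, lo, fl, a). node k lo fl a) ` ({..n} \<times> {..n} \<times> {..2} \<times> {..6}),
     edges = {(u, v). \<exists>k lo fl a. extendable n (Suc k) lo fl \<and> a \<in> allowed (Suc k) fl \<and>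
       (u = node (Suc k) lo fl 0 \<and> v = node (Suc k) lo fl a \<or>
        u = node (Suc k) lo fl a \<and> v = node k (next_lo lo a) (next_flag a) 0)},
     layer = (\<lambda>v. if node_k v = 0 then 2 * (n div 2)
                   else 2 * (n div 2 - node_k v) + (if node_choice v = 0 then 0 else 1)),
     lab = (\<lambda>(u, v). if node_choice u = 0 then Var (choice_var (node_k u) (node_lo u) (node_choice v))
                     else Const (rvar (set_encode (choice_pair (node_k u) (node_lo u) (node_choice u))))),
     src = node (n div 2) 0 2 0,
     snk = node 0 0 0 0\<rparr>"

lemma allowed_bounds: "a \<in> allowed k fl \<Longrightarrow> 1 \<le> a \<and> a \<le> 6"
  by (auto elim!: allowed_cases)

lemma arc_abp_edge_cases:
  assumes "(u, v) \<in> edges (arc_abp n :: 'f::field ratfun abp)"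
  obtains (read) k lo fl a where "extendable n (Suc k) lo fl" "a \<in> allowed (Suc k) fl"
      "u = node (Suc k) lo fl 0" "v = node (Suc k) lo fl a"
      "lab (arc_abp n :: 'f ratfun abp) (u, v) = Var (choice_var (Suc k) lo a)"
    | (weight) k lo fl a where "extendable n (Suc k) lo fl" "a \<in> allowed (Suc k) fl"
      "u = node (Suc k) lo fl a" "v = node k (next_lo lo a) (next_flag a) 0"
      "lab (arc_abp n :: 'f ratfun abp) (u, v) = Const (rvar (set_encode (choice_pair (Suc k) lo a)))"
proof -
  obtain k lo fl a where *: "extendable n (Suc k) lo fl" "a \<in> allowed (Suc k) fl"
      "u = node (Suc k) lo fl 0 \<and> v = node (Suc k) lo fl a \<or>
        u = node (Suc k) lo fl a \<and> v = node k (next_lo lo a) (next_flag a) 0"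
    using assms by (auto simp: arc_abp_def)
  have "a \<noteq> 0" using allowed_bounds[OF *(2)] by simp
  from *(3) show ?thesis
  proof (elim disjE conjE)
    assume uv: "u = node (Suc k) lo fl 0" "v = node (Suc k) lo fl a"
    show ?thesis by (rule read[OF *(1,2) uv]) (simp add: arc_abp_def uv node_sel)
  next
    assume uv: "u = node (Suc k) lo fl a" "v = node k (next_lo lo a) (next_flag a) 0"
    show ?thesis by (rule weight[OF *(1,2) uv]) (simp add: arc_abp_def uv node_sel \<open>a \<noteq> 0\<close>)
  qed
qed

lemma arc_abp_layered:
  assumes "(u, v) \<in> edges (arc_abp n :: 'f::field ratfun abp)"
  shows "layer (arc_abp n :: 'f ratfun abp) v = Suc (layer (arc_abp n :: 'f ratfun abp) u)"
  using assms
proof (cases rule: arc_abp_edge_cases)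
  case (read k lo fl a)
  then show ?thesis using allowed_bounds[OF read(2)] by (simp add: arc_abp_def node_sel)
next
  case (weight k lo fl a)
  then have "Suc k \<le> n div 2" by (auto simp: extendable_def)
  then show ?thesis using weight allowed_bounds[OF weight(2)]
    by (cases "k = 0") (simp_all add: arc_abp_def node_sel)
qed

lemma arc_abp_nodes: "k \<le> n \<Longrightarrow> lo \<le> n \<Longrightarrow> fl \<le> 2 \<Longrightarrow> a \<le> 6 \<Longrightarrow> node k lo fl a \<in> nodes (arc_abp n)"
  by (auto simp: arc_abp_def intro!: image_eqI[of _ _ "(k, lo, fl, a)"])

lemma finite_arc_abp_nodes: "finite (nodes (arc_abp n))"
  by (simp add: arc_abp_def)

lemma arc_abp_edges_nodes:
  "edges (arc_abp n :: 'f::field ratfun abp) \<subseteq> nodes (arc_abp n :: 'f ratfun abp) \<times> nodes (arc_abp n :: 'f ratfun abp)"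
proof clarify
  fix u v assume "(u, v) \<in> edges (arc_abp n :: 'f ratfun abp)"
  then show "u \<in> nodes (arc_abp n :: 'f ratfun abp) \<and> v \<in> nodes (arc_abp n :: 'f ratfun abp)"
  proof (cases rule: arc_abp_edge_cases)
    case (read k lo fl a)
    then show ?thesis using allowed_bounds[OF read(2)]
      by (auto simp: extendable_def intro!: arc_abp_nodes)
  next
    case (weight k lo fl a)
    have "extendable n k (next_lo lo a) (next_flag a)" by (rule extendable_step(1)[OF weight(1,2)])
    then show ?thesis using weight allowed_bounds[OF weight(2)]
      by (auto simp: extendable_def intro!: arc_abp_nodes)
  qed
qed

text \<open>The factor 21 is 3 flags times 7 choices.\<close>

lemma card_arc_abp_nodes: "card (nodes (arc_abp n)) \<le> 21 * (n + 1)\<^sup>2"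
proof -
  have "card (nodes (arc_abp n)) \<le> card ({..n} \<times> {..n} \<times> {..2::nat} \<times> {..6::nat})"
    unfolding arc_abp_def by (simp only: abp.simps) (rule card_image_le, simp)
  also have "\<dots> = 21 * (n + 1)\<^sup>2" by (simp add: card_cartesian_product power2_eq_square algebra_simps)
  finally show ?thesis .
qed

lemma rvar_in_ratfun_field: "k \<in> I \<Longrightarrow> (rvar k :: 'f::field ratfun) \<in> ratfun_field I"
  unfolding ratfun_field_def rvar_def
  by (intro CollectI exI[of _ "mvar k"] exI[of _ 1]) (auto simp: mvars_def mvar_def)

lemma choice_var_less:
  assumes "extendable n (Suc k) lo fl" "a \<in> allowed (Suc k) fl"
  shows "choice_var (Suc k) lo a < n"
  using assms(2,1) by (cases rule: allowed_cases) (auto simp: choice_var_def extendable_def)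

lemma is_abp_arc_abp:
  assumes n: "even n" "n \<ge> 2"
  shows "is_abp (fhat_field n) n (arc_abp n :: 'f::field ratfun abp)"
  unfolding is_abp_def
proof (intro conjI)
  let ?A = "arc_abp n :: 'f ratfun abp"
  show "finite (nodes ?A)" by (rule finite_arc_abp_nodes)
  show "src ?A \<in> nodes ?A" "snk ?A \<in> nodes ?A"
    using arc_abp_nodes[of "n div 2" n 0 2 0] arc_abp_nodes[of 0 n 0 0 0] by (simp_all add: arc_abp_def)
  show "edges ?A \<subseteq> nodes ?A \<times> nodes ?A" by (rule arc_abp_edges_nodes)
  show "layer ?A (src ?A) = 0" using n by (auto simp: arc_abp_def node_sel)
  show "\<forall>v\<in>nodes ?A. layer ?A v \<le> layer ?A (snk ?A)"
    using n by (auto simp: arc_abp_def node_sel)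
  show "\<forall>(u, v)\<in>edges ?A. layer ?A v = Suc (layer ?A u)" using arc_abp_layered by blast
  show "\<forall>e\<in>edges ?A. case lab ?A e of Var i \<Rightarrow> i < n | Const c \<Rightarrow> c \<in> fhat_field n"
  proof clarify
    fix u v assume "(u, v) \<in> edges ?A"
    then show "case lab ?A (u, v) of Var i \<Rightarrow> i < n | Const c \<Rightarrow> c \<in> fhat_field n"
    proof (cases rule: arc_abp_edge_cases)
      case (read k lo fl a)
      then show ?thesis using choice_var_less by simp
    next
      case (weight k lo fl a)
      from extendable_step(2)[OF weight(1,2)]
      have "(rvar (set_encode (choice_pair (Suc k) lo a)) :: 'f ratfun) \<in> fhat_field n"
        unfolding fhat_field_def by (intro rvar_in_ratfun_field imageI)
      then show ?thesis using weight by simp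
    qed
  qed
qed

lemma syntactic_multilinear_arc_abp: "syntactic_multilinear (arc_abp n :: 'f::field ratfun abp)"
proof (rule syntactic_multilinearI)
  \<comment> \<open>The points still uncovered. At an intermediate node the whole pair already
    counts as consumed, since only one of its two variables is read on any path.\<close>
  let ?avail = "\<lambda>v. if node_k v = 0 then {} else if node_choice v = 0 then {node_lo v..<node_lo v + 2 * node_k v}
    else {next_lo (node_lo v) (node_choice v)..<next_lo (node_lo v) (node_choice v) + 2 * (node_k v - 1)}"
  fix u v assume e: "(u, v) \<in> edges (arc_abp n :: 'f ratfun abp)"
  show "?avail v \<subseteq> ?avail u"
    using e
  proof (cases rule: arc_abp_edge_cases)
    case (read k lo fl a)
    then show ?thesis using allowed_bounds[OF read(2)] read(2)
      by (auto elim!: allowed_cases simp: node_sel next_lo_def)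
  next
    case (weight k lo fl a)
    then show ?thesis using allowed_bounds[OF weight(2)] by (cases "k = 0") (auto simp: node_sel)
  qed
  fix i assume i: "lab (arc_abp n :: 'f ratfun abp) (u, v) = Var i"
  show "i \<in> ?avail u - ?avail v"
    using e
  proof (cases rule: arc_abp_edge_cases)
    case (read k lo fl a)
    then have iv: "i = choice_var (Suc k) lo a" using i by simp
    from read(2) show ?thesis
      by (cases rule: allowed_cases) (auto simp: iv read(3,4) node_sel next_lo_def choice_var_def)
  next
    case (weight k lo fl a)
    then show ?thesis using i by simp
  qed
qed

definition pair_factor :: "nat set \<Rightarrow> 'f::field ratfun mpoly" where
  "pair_factor p = mconst (rvar (set_encode p)) * (\<Sum>i\<in>p. mvar i)"

lemma path_poly_arc_abp:
  "extendable n k lo fl \<Longrightarrow>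
    path_poly (arc_abp n :: 'f::field ratfun abp) (node k lo fl 0) = flagged_sum pair_factor k lo fl"
proof (induction k arbitrary: lo fl)
  case 0
  then have "fl = 0" by (auto simp: extendable_def)
  have "node 0 lo fl 0 = snk (arc_abp n :: 'f ratfun abp)" by (simp add: arc_abp_def node_def)
  then have "path_poly (arc_abp n :: 'f ratfun abp) (node 0 lo fl 0) = 1"
    using path_poly_snk[where lay = "layer (arc_abp n :: 'f ratfun abp)", OF arc_abp_layered] by simp
  then show ?case using \<open>fl = 0\<close> by (simp add: flagged_sum_def flagged_matchings_0)
next
  case (Suc k)
  let ?A = "arc_abp n :: 'f ratfun abp"
  let ?F = "\<lambda>a. flagged_sum pair_factor k (next_lo lo a) (next_flag a) :: 'f ratfun mpoly"
  let ?c = "\<lambda>a. mconst (rvar (set_encode (choice_pair (Suc k) lo a))) :: 'f ratfun mpoly"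
  let ?n0 = "node (Suc k) lo fl 0"
  have step: "path_poly ?A v = (\<Sum>w\<in>{w. (v, w) \<in> edges ?A}. label_poly (lab ?A (v, w)) * path_poly ?A w)"
    if "v \<noteq> snk ?A" for v
    by (rule path_poly_step[OF arc_abp_layered finite_arc_abp_nodes arc_abp_edges_nodes that])
  have snk: "node (Suc k) lo fl a \<noteq> snk ?A" for a by (simp add: arc_abp_def node_eq_iff)
  have aux: "path_poly ?A (node (Suc k) lo fl a) = ?c a * ?F a" if a: "a \<in> allowed (Suc k) fl" for a
  proof -
    let ?u = "node (Suc k) lo fl a" and ?v = "node k (next_lo lo a) (next_flag a) 0"
    have "{w. (?u, w) \<in> edges ?A} = {?v}"
      using Suc.prems a allowed_bounds[OF a] by (auto simp: arc_abp_def node_eq_iff)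
    moreover have "lab ?A (?u, ?v) = Const (rvar (set_encode (choice_pair (Suc k) lo a)))"
      using allowed_bounds[OF a] by (simp add: arc_abp_def node_sel)
    ultimately show ?thesis
      using step[OF snk[of a]] Suc.IH[OF extendable_step(1)[OF Suc.prems a]] by simp
  qed
  have succ: "{w. (?n0, w) \<in> edges ?A} = node (Suc k) lo fl ` allowed (Suc k) fl"
    using Suc.prems by (auto simp: arc_abp_def node_eq_iff dest: allowed_bounds)
  have "path_poly ?A ?n0 = (\<Sum>w\<in>node (Suc k) lo fl ` allowed (Suc k) fl.
      label_poly (lab ?A (?n0, w)) * path_poly ?A w)"
    using step[OF snk[of 0]] unfolding succ .
  also have "\<dots> = (\<Sum>a\<in>allowed (Suc k) fl.
      label_poly (lab ?A (?n0, node (Suc k) lo fl a)) * path_poly ?A (node (Suc k) lo fl a))"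
    by (rule sum.reindex[unfolded comp_def]) (auto simp: inj_on_def node_eq_iff)
  also have "\<dots> = (\<Sum>a\<in>allowed (Suc k) fl. mvar (choice_var (Suc k) lo a) * (?c a * ?F a))"
    by (rule sum.cong[OF refl]) (simp add: aux, simp add: arc_abp_def node_sel)
  also have "\<dots> = flagged_sum pair_factor (Suc k) lo fl"
  proof -
    have fl: "fl \<le> 2" using Suc.prems by (simp add: extendable_def)
    have union: "(\<Sum>a\<in>(if P then {1, 2} else {}) \<union> (if Q then {3, 4} else {}) \<union> (if R then {5, 6} else {}). h a)
      = (if P then h 1 + h 2 else 0) + (if Q then h 3 + h 4 else 0) + (if R then h 5 + h 6 else 0)"
      for P Q R and h :: "nat \<Rightarrow> 'f ratfun mpoly"
      by (cases P; cases Q; cases R) (simp_all add: add_ac)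
    have R: "mvar (choice_var (Suc k) lo 1) * (?c 1 * ?F 1) + mvar (choice_var (Suc k) lo 2) * (?c 2 * ?F 2)
       = pair_factor {lo, lo + 1} * flagged_sum pair_factor k (lo + 2) 0"
      by (simp add: choice_var_def choice_pair_def next_lo_def next_flag_def pair_factor_def algebra_simps)
    have C: "mvar (choice_var (Suc k) lo 3) * (?c 3 * ?F 3) + mvar (choice_var (Suc k) lo 4) * (?c 4 * ?F 4)
       = pair_factor {lo, lo + 2 * k + 1} * flagged_sum pair_factor k (lo + 1) 0"
      by (simp add: choice_var_def choice_pair_def next_lo_def next_flag_def pair_factor_def algebra_simps)
    have L: "mvar (choice_var (Suc k) lo 5) * (?c 5 * ?F 5) + mvar (choice_var (Suc k) lo 6) * (?c 6 * ?F 6)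
       = pair_factor {lo + 2 * k, lo + 2 * k + 1} * flagged_sum pair_factor k lo 1"
      by (simp add: choice_var_def choice_pair_def next_lo_def next_flag_def pair_factor_def algebra_simps)
    have "2 \<le> Suc k \<longleftrightarrow> 1 \<le> k" "3 \<le> Suc k \<longleftrightarrow> 2 \<le> k" by auto
    then show ?thesis
      unfolding allowed_def union R C L flagged_sum_step[OF fl] by simp
  qed
  finally show ?case .
qed

lemma fhat_eq_flagged_sum:
  assumes n: "even n" "n \<ge> 2"
  shows "(fhat n :: 'f::field ratfun mpoly) = flagged_sum pair_factor (n div 2) 0 2"
proof -
  have mconst_prod: "(mconst (\<Prod>p\<in>P. g p) :: 'f ratfun mpoly) = (\<Prod>p\<in>P. mconst (g p))"
    for P :: pairing and g
  proof -
    have "(mconst (a * b) :: 'f ratfun mpoly) = mconst a * mconst b" for a b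
      by (simp add: mconst_def mult_single)
    moreover have "(mconst 1 :: 'f ratfun mpoly) = 1" by (simp add: mconst_def)
    ultimately show ?thesis by (induction P rule: infinite_finite_induct) simp_all
  qed
  show ?thesis
    unfolding fhat_def arc_poly_def flagged_sum_def arc_pairings_eq_flagged[OF n]
    by (simp add: pair_weight_def mconst_prod pairing_poly_def pair_factor_def prod.distrib)
qed

lemma fhat_smABP_computable:
  assumes n: "even n" "n \<ge> 2"
  shows "smABP_computable (fhat_field n) n (21 * (n + 1)\<^sup>2) (fhat n :: 'f::field ratfun mpoly)"
proof -
  let ?A = "arc_abp n :: 'f ratfun abp"
  have "extendable n (n div 2) 0 2"
    unfolding extendable_def using n
    by (intro conjI exI[of _ "{}"]) (simp_all add: arc_pairings_eq_flagged[OF n] del: One_nat_def)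
  from path_poly_arc_abp[OF this] have "path_poly ?A (src ?A) = fhat n"
    by (simp add: fhat_eq_flagged_sum[OF n] arc_abp_def)
  then have "abp_poly ?A = fhat n"
    by (simp add: abp_poly_def path_poly_def abp_paths_eq)
  then show ?thesis
    unfolding smABP_computable_def abp_size_def
    using is_abp_arc_abp[OF n] syntactic_multilinear_arc_abp card_arc_abp_nodes by blast
qed

lemma poly_bounded_size: "poly_bounded (\<lambda>n. 21 * (n + 1)\<^sup>2)"
  unfolding poly_bounded_def
proof (intro exI[of _ 2] bigoI[of _ 84] eventually_sequentiallyI[of 1])
  fix n :: nat assume "1 \<le> n"
  then have "(real n + 1)\<^sup>2 \<le> (2 * real n)\<^sup>2" by (intro power_mono) auto
  then show "norm (real (21 * (n + 1)\<^sup>2)) \<le> 84 * norm (real n ^ 2)"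
    by (simp add: power_mult_distrib add.commute)
qed

theorem mainTheorem4:
  "(\<exists>S. poly_bounded S \<and>
            (\<forall>n\<ge>2. even n \<longrightarrow>
               smABP_computable (fhat_field n) n (S n) (fhat n :: 'f::field ratfun mpoly)))
       \<and> (\<exists>\<epsilon>::real. 0 < \<epsilon> \<and> \<epsilon> < 1 / 500 \<and>
            (\<forall>S. poly_bounded S \<longrightarrow>
               (\<exists>\<delta>>0. \<forall>\<^sub>F n in sequentially. even n \<longrightarrow>
                  (\<forall>s. sum_of_ROABPs (fhat_field n) n (S n) s (fhat n :: 'f ratfun mpoly) \<or>
                       sum_of_ROABPs (fhat_indep_field n) n (S n) s (fhat_indep n :: 'f ratfun mpoly)
                       \<longrightarrow> exp (\<delta> * real n powr \<epsilon>) \<le> real s))))"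
proof (rule conjI)
  show "\<exists>S. poly_bounded S \<and> (\<forall>n\<ge>2. even n \<longrightarrow>
      smABP_computable (fhat_field n) n (S n) (fhat n :: 'f ratfun mpoly))"
    using poly_bounded_size fhat_smABP_computable by (intro exI[of _ "\<lambda>n. 21 * (n + 1)\<^sup>2"]) blast
qed (rule fhat_roabp_sum_lower_bound)

end
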